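(* (a) Let $\gamma$ be a positive $n$-braid word. Then there exists a finite collection of simplifying weaves $(\mathfrak w_1,\dots,\mathfrak w_k)$, each from $\gamma$ (top) to the half twist $\Delta$ (bottom), which decomposes $X_0(\gamma;w_0)$: the images of $\mathcal M(\mathfrak w_i,w_0)$ in $X_0(\gamma;w_0)$ are pairwise disjoint and their union is $X_0(\gamma;w_0)$. (b) Furthermore, given any Demazure weave $\mathfrak w$ from $\gamma$ to $\Delta$, there is a decomposition of $X_0(\gamma;w_0)$ by a collection of simplifying weaves $(\mathfrak w_1=\mathfrak w,\mathfrak w_2,\dots,\mathfrak w_k)$ as in (a), where the correspondence $\mathcal M(\mathfrak w,w_0)\cong(\mathbb{C}^* )^{\ell(\gamma)-\binom n2}$ is the unique piece of maximal dimension.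
   Context: All varieties are over $\mathbb{C}$. A positive $n$-braid word is a finite sequence $\beta=\sigma_{i_1}\cdots\sigma_{i_\ell}$, $\ell(\beta)=\ell$. $B_i(z)$ is the identity $n\times n$ matrix except for the block $\begin{pmatrix}0&1\\1&z\end{pmatrix}$ in rows and columns $i,i+1$; $B_\beta(z)=B_{i_1}(z_1)\cdots B_{i_\ell}(z_\ell)$. Permutations are viewed as permutation matrices with $s_i\mapsto B_i(0)$; $w_0\in S_n$ is the longest element; $\Delta=(\sigma_1\cdots\sigma_{n-1})(\sigma_1\cdots\sigma_{n-2})\cdots(\sigma_1\sigma_2)\sigma_1$. $X_0(\beta;\pi)=\{z\in\mathbb{C}^\ell: B_\beta(z)\pi\text{ upper-triangular}\}$. A simplifying weave $\mathfrak w:\beta_2\to\beta_1$ is a finite sequence of words $\beta_2=\gamma_0\to\cdots\to\gamma_m=\beta_1$, each step applying one move to consecutive letters at a specified position: trivalent vertex $\sigma_i\sigma_i\to\sigma_i$; 6-valent vertex $\sigma_i\sigma_{i+1}\sigma_i\leftrightarrow\sigma_{i+1}\sigma_i\sigma_{i+1}$; 4-valent vertex $\sigma_i\sigma_j\to\sigma_j\sigma_i$ ($|i-j|>1$); cup $\sigma_i\sigma_i\to1$. It is a Demazure weave if it has no cups. $\mathcal M(\mathfrak w,w_0)$ is the variety of the following data: vectors $z^{(j)}\in\mathbb{C}^{\ell(\gamma_j)}$ for all $j$, and, for each step $\gamma_j\to\gamma_{j+1}$ that is a trivalent vertex or a cup with $p$ letters to the left of the move, invertible upper-triangular matrices $U_0,\dots,U_p$;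 such that, if the step replaces the subword $u$ by $v$: variables to the right of the move are unchanged; for a 4- or 6-valent vertex $B_u=B_v$ (at the corresponding entries of $z^{(j)},z^{(j+1)}$) and the variables to the left are unchanged; for a trivalent vertex or cup $B_u=U_pB_v$ (the empty word gives the identity) and $B_{i_q}(z_q^{(j)})U_q=U_{q-1}B_{i_q}(z_q^{(j+1)})$ for $q=p,\dots,1$, $i_q$ the index of the $q$-th letter; and $B_{\beta_1}(z^{(m)})w_0$ is upper-triangular. It maps (injectively) to $X_0(\beta_2;w_0)$ by $z^{(0)}$. Here $\beta_2=\gamma$ and $\beta_1=\Delta$. *)

theory Defs
  imports "HOL-Analysis.Abstract_Topology" "HOL-Library.Extended_Real"
    "HOL-Combinatorics.Permutations" "Jordan_Normal_Form.Matrix"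
begin

section \<open>Braid words and braid matrices\<close>

text \<open>A word is the list of the indices of its letters, which run over \<open>{1..n-1}\<close>.\<close>

type_synonym word = "nat list"

definition braid_word :: "nat \<Rightarrow> word \<Rightarrow> bool" where
  "braid_word n \<beta> \<longleftrightarrow> set \<beta> \<subseteq> {1..<n}"

fun half_twist :: "nat \<Rightarrow> word" where
  "half_twist 0 = []"
| "half_twist (Suc m) = [1..<Suc m] @ half_twist m"

text \<open>Matrices of \<^theory>\<open>Jordan_Normal_Form.Matrix\<close> are indexed from 0, so the
  rows and columns \<open>i, i+1\<close> become \<open>i-1, i\<close>.\<close>

definition braid_gen_mat :: "nat \<Rightarrow> nat \<Rightarrow> complex \<Rightarrow> complex mat" where
  "braid_gen_mat n i z = mat n n (\<lambda>(r, c).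
     if r = i - 1 \<and> c = i - 1 then 0
     else if r = i - 1 \<and> c = i then 1
     else if r = i \<and> c = i - 1 then 1
     else if r = i \<and> c = i then z
     else if r = c then 1 else 0)"

text \<open>The variables are likewise indexed from 0: \<open>z k\<close> belongs to the letter \<open>\<beta> ! k\<close>.\<close>

fun braid_mat :: "nat \<Rightarrow> word \<Rightarrow> (nat \<Rightarrow> complex) \<Rightarrow> complex mat" where
  "braid_mat n [] z = 1\<^sub>m n"
| "braid_mat n (i # \<beta>) z = braid_gen_mat n i (z 0) * braid_mat n \<beta> (\<lambda>k. z (Suc k))"

text \<open>Permutations of \<open>{1..n}\<close> as matrices, with \<open>e\<^sub>c \<mapsto> e\<^bsub>\<pi>(c)\<^esub>\<close>.\<close>

definition perm_mat :: "nat \<Rightarrow> (nat \<Rightarrow> nat) \<Rightarrow> complex mat" where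
  "perm_mat n \<pi> = mat n n (\<lambda>(r, c). if Suc r = \<pi> (Suc c) then 1 else 0)"

lemma perm_mat_transpose:
  assumes "1 \<le> i" "i < n"
  shows "perm_mat n (transpose i (Suc i)) = braid_gen_mat n i 0"
  using assms by (intro eq_matI) (auto simp: perm_mat_def braid_gen_mat_def transpose_def)

definition longest_perm :: "nat \<Rightarrow> nat \<Rightarrow> nat" where
  "longest_perm n i = (if i \<in> {1..n} then n + 1 - i else i)"

definition inversions :: "nat \<Rightarrow> (nat \<Rightarrow> nat) \<Rightarrow> (nat \<times> nat) set" where
  "inversions n \<pi> = {(i, j). 1 \<le> i \<and> i < j \<and> j \<le> n \<and> \<pi> j < \<pi> i}"

lemma longest_perm_permutes: "longest_perm n permutes {1..n}"
  by (rule bij_imp_permutes)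
     (auto simp: longest_perm_def intro!: bij_betw_byWitness[where f' = "\<lambda>i. n + 1 - i"])

lemma inversions_le_longest_perm:
  "card (inversions n \<pi>) \<le> card (inversions n (longest_perm n))"
proof (rule card_mono)
  show "finite (inversions n (longest_perm n))"
    by (rule finite_subset[of _ "{1..n} \<times> {1..n}"]) (auto simp: inversions_def)
  show "inversions n \<pi> \<subseteq> inversions n (longest_perm n)"
    by (auto simp: inversions_def longest_perm_def)
qed


section \<open>Subvarieties of affine space\<close>

text \<open>Affine space with coordinates in a finite set \<open>I\<close> is realised as the set of
  functions on the index type that vanish off \<open>I\<close>. Its Zariski topology is the one
  induced from the following topology on all functions, since a polynomial
  involves only finitely many coordinates and those off \<open>I\<close> are zero.\<close>

definition affine_space :: "'i set \<Rightarrow> ('i \<Rightarrow> complex) set" where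
  "affine_space I = {x. \<forall>i. i \<notin> I \<longrightarrow> x i = 0}"

inductive polyfun :: "(('i \<Rightarrow> complex) \<Rightarrow> complex) \<Rightarrow> bool" where
  const: "polyfun (\<lambda>x. c)"
| coord: "polyfun (\<lambda>x. x i)"
| add: "polyfun p \<Longrightarrow> polyfun q \<Longrightarrow> polyfun (\<lambda>x. p x + q x)"
| mult: "polyfun p \<Longrightarrow> polyfun q \<Longrightarrow> polyfun (\<lambda>x. p x * q x)"

definition zero_locus :: "(('i \<Rightarrow> complex) \<Rightarrow> complex) set \<Rightarrow> ('i \<Rightarrow> complex) set" where
  "zero_locus P = {x. \<forall>p\<in>P. p x = 0}"

definition zariski_closed :: "('i \<Rightarrow> complex) set \<Rightarrow> bool" where
  "zariski_closed S \<longleftrightarrow> (\<exists>P. (\<forall>p\<in>P. polyfun p) \<and> S = zero_locus P)"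

definition zariski :: "('i \<Rightarrow> complex) topology" where
  "zariski = topology (\<lambda>W. zariski_closed (- W))"

lemma zariski_closed_Un:
  assumes "zariski_closed S" "zariski_closed T"
  shows "zariski_closed (S \<union> T)"
proof -
  obtain P Q where P: "\<forall>p\<in>P. polyfun p" "S = zero_locus P"
    and Q: "\<forall>q\<in>Q. polyfun q" "T = zero_locus Q"
    using assms by (auto simp: zariski_closed_def)
  let ?R = "{\<lambda>x. p x * q x |p q. p \<in> P \<and> q \<in> Q}"
  have "S \<union> T = zero_locus ?R"
  proof
    show "S \<union> T \<subseteq> zero_locus ?R"
      by (auto simp: P Q zero_locus_def)
    show "zero_locus ?R \<subseteq> S \<union> T"
    proof
      fix x assume x: "x \<in> zero_locus ?R"
      have *: "p x * q x = 0" if "p \<in> P" "q \<in> Q" for p q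
      proof -
        have "(\<lambda>x. p x * q x) \<in> ?R" using that by blast
        with x show ?thesis unfolding zero_locus_def by fast
      qed
      show "x \<in> S \<union> T"
      proof (rule ccontr)
        assume "x \<notin> S \<union> T"
        then obtain p q where "p \<in> P" "p x \<noteq> 0" "q \<in> Q" "q x \<noteq> 0"
          unfolding P(2) Q(2) zero_locus_def by blast
        with *[of p q] show False by simp
      qed
    qed
  qed
  moreover have "\<forall>r\<in>?R. polyfun r" using P Q by (auto intro: polyfun.mult)
  ultimately show ?thesis unfolding zariski_closed_def by blast
qed

lemma zariski_closed_Inter:
  assumes "\<And>S. S \<in> K \<Longrightarrow> zariski_closed S"
  shows "zariski_closed (\<Inter>K)"
proof -
  have "\<forall>S\<in>K. \<exists>P. (\<forall>p\<in>P. polyfun p) \<and> S = zero_locus P"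
    using assms by (auto simp: zariski_closed_def)
  then obtain P where P: "\<And>S. S \<in> K \<Longrightarrow> (\<forall>p\<in>P S. polyfun p) \<and> S = zero_locus (P S)"
    by metis
  have "\<Inter>K = zero_locus (\<Union>(P ` K))"
    using P unfolding zero_locus_def by blast
  moreover have "\<forall>p\<in>\<Union>(P ` K). polyfun p" using P by auto
  ultimately show ?thesis unfolding zariski_closed_def by blast
qed

lemma istopology_zariski: "istopology (\<lambda>W. zariski_closed (- W))"
  unfolding istopology_def
proof (intro conjI allI impI)
  fix S T :: "('i \<Rightarrow> complex) set"
  assume "zariski_closed (- S)" "zariski_closed (- T)"
  then show "zariski_closed (- (S \<inter> T))"
    using zariski_closed_Un by (simp add: Compl_Int)
next
  fix K :: "('i \<Rightarrow> complex) set set"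
  assume "\<forall>S\<in>K. zariski_closed (- S)"
  then have "zariski_closed (\<Inter>(uminus ` K))" by (intro zariski_closed_Inter) auto
  then show "zariski_closed (- \<Union>K)" by (simp add: uminus_Sup)
qed

lemma openin_zariski: "openin zariski W \<longleftrightarrow> zariski_closed (- W)"
  by (simp add: zariski_def istopology_zariski)

lemma topspace_zariski [simp]: "topspace zariski = UNIV"
proof -
  have "zariski_closed (- UNIV :: ('i \<Rightarrow> complex) set)"
    unfolding zariski_closed_def
    by (rule exI[of _ "{\<lambda>x. 1}"]) (auto simp: zero_locus_def intro: polyfun.const)
  then have "openin zariski (UNIV :: ('i \<Rightarrow> complex) set)" by (simp only: openin_zariski)
  from openin_subset[OF this] show ?thesis by auto
qed

lemma closedin_zariski: "closedin zariski S \<longleftrightarrow> zariski_closed S"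
  by (simp add: closedin_def openin_zariski Compl_eq_Diff_UNIV[symmetric])

text \<open>A function on a quasi-affine variety is regular if it is locally a quotient of
  polynomials; \<open>variety_morphism\<close> asks this of every coordinate.\<close>

definition regular_on :: "('i \<Rightarrow> complex) set \<Rightarrow> (('i \<Rightarrow> complex) \<Rightarrow> complex) \<Rightarrow> bool" where
  "regular_on X f \<longleftrightarrow> (\<forall>x\<in>X. \<exists>W p q. openin (subtopology zariski X) W \<and> x \<in> W \<and>
     polyfun p \<and> polyfun q \<and> (\<forall>y\<in>W. q y \<noteq> 0 \<and> f y = p y / q y))"

definition variety_morphism ::
  "('i \<Rightarrow> complex) set \<Rightarrow> ('j \<Rightarrow> complex) set \<Rightarrow> (('i \<Rightarrow> complex) \<Rightarrow> ('j \<Rightarrow> complex)) \<Rightarrow> bool" where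
  "variety_morphism X Y f \<longleftrightarrow> f ` X \<subseteq> Y \<and> (\<forall>j. regular_on X (\<lambda>x. f x j))"

definition variety_isomorphic :: "('i \<Rightarrow> complex) set \<Rightarrow> ('j \<Rightarrow> complex) set \<Rightarrow> bool" where
  "variety_isomorphic X Y \<longleftrightarrow> (\<exists>f g. variety_morphism X Y f \<and> variety_morphism Y X g \<and>
     (\<forall>x\<in>X. g (f x) = x) \<and> (\<forall>y\<in>Y. f (g y) = y))"

definition irreducible_in :: "'a topology \<Rightarrow> 'a set \<Rightarrow> bool" where
  "irreducible_in T S \<longleftrightarrow> S \<subseteq> topspace T \<and> S \<noteq> {} \<and>
     (\<forall>A B. closedin T A \<and> closedin T B \<and> S \<subseteq> A \<union> B \<longrightarrow> S \<subseteq> A \<or> S \<subseteq> B)"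

text \<open>The supremum is taken in \<open>ereal\<close>, so that the empty space has dimension \<open>-\<infinity>\<close>.\<close>

definition krull_dim :: "'a topology \<Rightarrow> ereal" where
  "krull_dim T = Sup {ereal (real k) |k. \<exists>Z :: nat \<Rightarrow> 'a set.
     (\<forall>i\<le>k. closedin T (Z i) \<and> irreducible_in T (Z i)) \<and> (\<forall>i<k. Z i \<subset> Z (Suc i))}"

definition variety_dim :: "('i \<Rightarrow> complex) set \<Rightarrow> ereal" where
  "variety_dim X = krull_dim (subtopology zariski X)"

definition torus :: "nat \<Rightarrow> (nat \<Rightarrow> complex) set" where
  "torus d = {x \<in> affine_space {..<d}. \<forall>i<d. x i \<noteq> 0}"


section \<open>Braid varieties\<close>

definition X0 :: "nat \<Rightarrow> word \<Rightarrow> (nat \<Rightarrow> nat) \<Rightarrow> (nat \<Rightarrow> complex) set" where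
  "X0 n \<beta> \<pi> = {z \<in> affine_space {..<length \<beta>}. upper_triangular (braid_mat n \<beta> z * perm_mat n \<pi>)}"


section \<open>Simplifying weaves\<close>

datatype vertex = Trivalent nat | Hexavalent nat nat | Tetravalent nat nat | Cup nat

fun valid_vertex :: "vertex \<Rightarrow> bool" where
  "valid_vertex (Trivalent i) \<longleftrightarrow> True"
| "valid_vertex (Hexavalent i j) \<longleftrightarrow> j = i + 1 \<or> i = j + 1"
| "valid_vertex (Tetravalent i j) \<longleftrightarrow> i + 1 < j \<or> j + 1 < i"
| "valid_vertex (Cup i) \<longleftrightarrow> True"

fun vertex_source :: "vertex \<Rightarrow> word" where
  "vertex_source (Trivalent i) = [i, i]"
| "vertex_source (Hexavalent i j) = [i, j, i]"
| "vertex_source (Tetravalent i j) = [i, j]"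
| "vertex_source (Cup i) = [i, i]"

fun vertex_target :: "vertex \<Rightarrow> word" where
  "vertex_target (Trivalent i) = [i]"
| "vertex_target (Hexavalent i j) = [j, i, j]"
| "vertex_target (Tetravalent i j) = [j, i]"
| "vertex_target (Cup i) = []"

fun is_trivalent :: "vertex \<Rightarrow> bool" where
  "is_trivalent (Trivalent i) \<longleftrightarrow> True"
| "is_trivalent _ \<longleftrightarrow> False"

fun is_cup :: "vertex \<Rightarrow> bool" where
  "is_cup (Cup i) \<longleftrightarrow> True"
| "is_cup _ \<longleftrightarrow> False"

text \<open>A step carries the letters to the left and to the right of its vertex, hence
  also its position.\<close>

datatype step = Step (left_word: word) (vertex_of: vertex) (right_word: word)

definition step_source :: "step \<Rightarrow> word" where
  "step_source s = left_word s @ vertex_source (vertex_of s) @ right_word s"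

definition step_target :: "step \<Rightarrow> word" where
  "step_target s = left_word s @ vertex_target (vertex_of s) @ right_word s"

datatype weave = Weave (top_word: word) (weave_steps: "step list")

definition weave_words :: "weave \<Rightarrow> word list" where
  "weave_words w = top_word w # map step_target (weave_steps w)"

definition simplifying_weave :: "nat \<Rightarrow> weave \<Rightarrow> word \<Rightarrow> word \<Rightarrow> bool" where
  "simplifying_weave n w \<beta>\<^sub>2 \<beta>\<^sub>1 \<longleftrightarrow>
     top_word w = \<beta>\<^sub>2 \<and> last (weave_words w) = \<beta>\<^sub>1 \<and>
     (\<forall>\<gamma>\<in>set (weave_words w). braid_word n \<gamma>) \<and>
     (\<forall>j<length (weave_steps w). valid_vertex (vertex_of (weave_steps w ! j)) \<and>
        step_source (weave_steps w ! j) = weave_words w ! j)"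

definition demazure_weave :: "nat \<Rightarrow> weave \<Rightarrow> word \<Rightarrow> word \<Rightarrow> bool" where
  "demazure_weave n w \<beta>\<^sub>2 \<beta>\<^sub>1 \<longleftrightarrow> simplifying_weave n w \<beta>\<^sub>2 \<beta>\<^sub>1 \<and>
     (\<forall>s\<in>set (weave_steps w). \<not> is_cup (vertex_of s))"


section \<open>The correspondence of a weave\<close>

text \<open>Coordinates: \<open>ZC j k\<close> is the variable of the \<open>k\<close>-th letter of the \<open>j\<close>-th word, and
  \<open>UC j q r c\<close> is the \<open>(r, c)\<close> entry of the matrix \<open>U\<^sub>q\<close> of the \<open>j\<close>-th step (all counted
  from 0).\<close>

datatype coord = ZC nat nat | UC nat nat nat nat

definition has_U :: "step \<Rightarrow> bool" where
  "has_U s \<longleftrightarrow> is_trivalent (vertex_of s) \<or> is_cup (vertex_of s)"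

definition weave_coords :: "nat \<Rightarrow> weave \<Rightarrow> coord set" where
  "weave_coords n w =
     {ZC j k |j k. j < length (weave_words w) \<and> k < length (weave_words w ! j)} \<union>
     {UC j q r c |j q r c. j < length (weave_steps w) \<and> has_U (weave_steps w ! j) \<and>
        q \<le> length (left_word (weave_steps w ! j)) \<and> r < n \<and> c < n}"

definition z_vars :: "(coord \<Rightarrow> complex) \<Rightarrow> nat \<Rightarrow> nat \<Rightarrow> complex" where
  "z_vars x j = (\<lambda>k. x (ZC j k))"

definition U_mat :: "nat \<Rightarrow> (coord \<Rightarrow> complex) \<Rightarrow> nat \<Rightarrow> nat \<Rightarrow> complex mat" where
  "U_mat n x j q = mat n n (\<lambda>(r, c). x (UC j q r c))"

text \<open>Here \<open>z\<close>, \<open>z'\<close> are the variables above and below the step. The \<open>q\<close>-th letter of the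
  left word is \<open>left_word s ! (q - 1)\<close>, with variable \<open>z (q - 1)\<close>.\<close>

definition step_relations ::
  "nat \<Rightarrow> step \<Rightarrow> (nat \<Rightarrow> complex) \<Rightarrow> (nat \<Rightarrow> complex) \<Rightarrow> (nat \<Rightarrow> complex mat) \<Rightarrow> bool" where
  "step_relations n s z z' U \<longleftrightarrow>
    (let p = length (left_word s);
         u = vertex_source (vertex_of s);
         v = vertex_target (vertex_of s);
         B\<^sub>u = braid_mat n u (\<lambda>k. z (p + k));
         B\<^sub>v = braid_mat n v (\<lambda>k. z' (p + k))
     in (\<forall>k<length (right_word s). z (p + length u + k) = z' (p + length v + k)) \<and>
        (if has_U s then
           (\<forall>q\<le>p. upper_triangular (U q) \<and> invertible_mat (U q)) \<and>
           B\<^sub>u = U p * B\<^sub>v \<and>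
           (\<forall>q\<in>{1..p}. braid_gen_mat n (left_word s ! (q - 1)) (z (q - 1)) * U q =
              U (q - 1) * braid_gen_mat n (left_word s ! (q - 1)) (z' (q - 1)))
         else B\<^sub>u = B\<^sub>v \<and> (\<forall>k<p. z k = z' k)))"

definition correspondence :: "nat \<Rightarrow> weave \<Rightarrow> (nat \<Rightarrow> nat) \<Rightarrow> (coord \<Rightarrow> complex) set" where
  "correspondence n w \<pi> = {x \<in> affine_space (weave_coords n w).
     (\<forall>j<length (weave_steps w).
        step_relations n (weave_steps w ! j) (z_vars x j) (z_vars x (Suc j)) (U_mat n x j)) \<and>
     upper_triangular (braid_mat n (last (weave_words w)) (z_vars x (length (weave_steps w)))
       * perm_mat n \<pi>)}"

definition correspondence_image :: "nat \<Rightarrow> weave \<Rightarrow> (nat \<Rightarrow> nat) \<Rightarrow> (nat \<Rightarrow> complex) set" where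
  "correspondence_image n w \<pi> = (\<lambda>x. z_vars x 0) ` correspondence n w \<pi>"

definition decomposes :: "nat \<Rightarrow> word \<Rightarrow> weave list \<Rightarrow> bool" where
  "decomposes n \<gamma> ws \<longleftrightarrow>
     (\<forall>w\<in>set ws. simplifying_weave n w \<gamma> (half_twist n)) \<and>
     (\<forall>i<length ws. \<forall>j<length ws. i \<noteq> j \<longrightarrow>
        correspondence_image n (ws ! i) (longest_perm n) \<inter>
        correspondence_image n (ws ! j) (longest_perm n) = {}) \<and>
     (\<Union>w\<in>set ws. correspondence_image n w (longest_perm n)) = X0 n \<gamma> (longest_perm n)"

end

theory Submission
  imports Defs "Jordan_Normal_Form.Determinant" "HOL-Computational_Algebra.Polynomial"
    "HOL-Library.Function_Algebras"
begin

text \<open>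
  Consider one step of a weave, read from top to bottom. At a trivalent vertex with variables
  \<open>a, b\<close> the equation \<open>B\<^sub>i(a) B\<^sub>i(b) = U B\<^sub>i(c)\<close> has an invertible upper-triangular solution \<open>U\<close>
  exactly when \<open>a \<noteq> 0\<close>, and then \<open>c = b + 1/a\<close> and \<open>U\<close> are unique (\<open>trivalent_iff\<close>); the product
  \<open>B\<^sub>i(a) B\<^sub>i(b)\<close> is itself upper-triangular exactly when \<open>a = 0\<close>, which is the case of a cup
  (\<open>cup_iff\<close>). A triangular matrix can be moved to the left through any braid matrix in
  exactly one way (\<open>borel_slide\<close>), and 4- and 6-valent vertices are polynomial changes of
  variables. So every step is a partial function from the variety of its source to that of its
  target, defined everywhere, where \<open>a \<noteq> 0\<close>, or where \<open>a = 0\<close>. Since multiplication by a triangular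
  matrix on the left does not affect upper-triangularity of \<open>B\<^sub>\<beta> w\<^sub>0\<close>, the step pulls the variety
  of the target back to that of the source (\<open>step_related_X0\<close>).

  Existence of a decomposition follows by induction on the length of the word. Using the moves
  of 4- and 6-valent vertices, a word can be brought into a form that contains a square
  \<open>\<sigma>\<^sub>i\<sigma>\<^sub>i\<close>, or into the normal form coming from the coset representatives of \<open>S\<^sub>m\<close> in \<open>S\<^bsub>m+1\<^esub>\<close>
  (\<open>braid_word_normalise\<close>). In the first case the trivalent vertex and the cup at the square cut
  the variety into two disjoint parts, both given by shorter words (\<open>decomposes_square\<close>). In the
  second case the variety is empty, unless the word is the half twist, whose variety is the
  point 0 (\<open>X0_coset_normal\<close>). For a prescribed Demazure weave, one follows its steps and
  decomposes the complement, a cup, at each trivalent vertex; hence every other weave of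
  the collection contains a cup (\<open>demazure_decomposition_exists\<close>).

  Read from bottom to top, a trivalent vertex adds a free nonzero parameter \<open>a\<close> and a cup a free
  parameter \<open>b\<close>, and everything else is a rational function of the parameters. So the
  correspondence of a weave with \<open>t\<close> trivalent vertices and \<open>c\<close> cups is isomorphic to a product
  of \<open>t\<close> punctured lines and \<open>c\<close> lines (\<open>correspondence_param_iff\<close>, \<open>fraction_on_weave_param\<close>),
  while counting letters gives \<open>t + 2c = \<ell>(\<gamma>) - n(n-1)/2\<close>. A weave without cups thus has a torus of
  dimension \<open>\<ell>(\<gamma>) - n(n-1)/2\<close>, and one with a cup has smaller dimension \<open>t + c\<close>.

  Two facts about Krull dimension are needed, and both have elementary proofs. A rational image
  of a subset of affine \<open>N\<close>-space has dimension at most \<open>N\<close>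
  (\<open>variety_dim_rational_image\<close>): a chain of irreducible closed sets yields as many algebraically
  independent functions as it has steps, and more than \<open>N\<close> of them would have too many monomials.
  A variety parametrised by the \<open>d\<close>-dimensional torus with a polynomial inverse has dimension at
  least \<open>d\<close> (\<open>variety_dim_torus_parametrised\<close>): fix the coordinates to 1 one after the other.
\<close>

(* Entries of products with braid matrices are computed by the row and column operations below;
   by default the simplifier would replace them by scalar products. *)
declare index_mult_mat(1) [simp del]

section \<open>Braid matrices and triangular matrices\<close>

lemma braid_gen_mat_carrier [simp]: "braid_gen_mat n i z \<in> carrier_mat n n"
  by (simp add: braid_gen_mat_def)

lemma braid_gen_mat_dim [simp]:
  "dim_row (braid_gen_mat n i z) = n" "dim_col (braid_gen_mat n i z) = n"
  by (simp_all add: braid_gen_mat_def)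

lemma braid_mat_carrier [simp]: "braid_mat n \<beta> z \<in> carrier_mat n n"
  by (induction \<beta> arbitrary: z) (auto intro!: mult_carrier_mat[of _ n n])

lemma braid_mat_dim [simp]:
  "dim_row (braid_mat n \<beta> z) = n" "dim_col (braid_mat n \<beta> z) = n"
  using braid_mat_carrier[of n \<beta> z] carrier_matD by blast+

lemma sum_eq_two_terms:
  fixes f :: "nat \<Rightarrow> complex"
  assumes "finite A" "a \<in> A" "b \<in> A" "a \<noteq> b" "\<And>k. k \<in> A \<Longrightarrow> k \<noteq> a \<Longrightarrow> k \<noteq> b \<Longrightarrow> f k = 0"
  shows "sum f A = f a + f b"
proof -
  have "sum f A = sum f {a, b}"
    by (rule sum.mono_neutral_right) (use assms in auto)
  then show ?thesis using assms by simp
qed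

lemma sum_eq_one_term:
  fixes f :: "nat \<Rightarrow> complex"
  assumes "finite A" "a \<in> A" "\<And>k. k \<in> A \<Longrightarrow> k \<noteq> a \<Longrightarrow> f k = 0"
  shows "sum f A = f a"
proof -
  have "sum f A = sum f {a}"
    by (rule sum.mono_neutral_right) (use assms in auto)
  then show ?thesis by simp
qed

lemma braid_gen_mat_mult_entry:
  assumes "1 \<le> i" "i < n" "M \<in> carrier_mat n n" "r < n" "c < n"
  shows "(braid_gen_mat n i z * M) $$ (r, c) =
    (if r = i - 1 then M $$ (i, c)
     else if r = i then M $$ (i - 1, c) + z * M $$ (i, c)
     else M $$ (r, c))"
proof -
  let ?B = "braid_gen_mat n i z"
  have e: "(?B * M) $$ (r, c) = (\<Sum>k\<in>{0..<n}. ?B $$ (r, k) * M $$ (k, c))"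
    using assms by (simp add: scalar_prod_def index_mult_mat(1))
  consider "r = i - 1" | "r = i" | "r \<noteq> i - 1" "r \<noteq> i" by blast
  then show ?thesis
  proof cases
    case 1
    have "(\<Sum>k\<in>{0..<n}. ?B $$ (r, k) * M $$ (k, c)) = ?B $$ (r, i) * M $$ (i, c)"
      by (rule sum_eq_one_term) (use assms 1 in \<open>auto simp: braid_gen_mat_def\<close>)
    then show ?thesis using e assms 1 by (simp add: braid_gen_mat_def)
  next
    case 2
    have "(\<Sum>k\<in>{0..<n}. ?B $$ (r, k) * M $$ (k, c)) =
        ?B $$ (r, i - 1) * M $$ (i - 1, c) + ?B $$ (r, i) * M $$ (i, c)"
      by (rule sum_eq_two_terms) (use assms 2 in \<open>auto simp: braid_gen_mat_def\<close>)
    then show ?thesis using e assms 2 by (simp add: braid_gen_mat_def)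
  next
    case 3
    have "(\<Sum>k\<in>{0..<n}. ?B $$ (r, k) * M $$ (k, c)) = ?B $$ (r, r) * M $$ (r, c)"
      by (rule sum_eq_one_term) (use assms 3 in \<open>auto simp: braid_gen_mat_def\<close>)
    then show ?thesis using e assms 3 by (simp add: braid_gen_mat_def)
  qed
qed

lemma mult_braid_gen_mat_entry:
  assumes "1 \<le> i" "i < n" "M \<in> carrier_mat n n" "r < n" "c < n"
  shows "(M * braid_gen_mat n i z) $$ (r, c) =
    (if c = i - 1 then M $$ (r, i)
     else if c = i then M $$ (r, i - 1) + z * M $$ (r, i)
     else M $$ (r, c))"
proof -
  let ?B = "braid_gen_mat n i z"
  have e: "(M * ?B) $$ (r, c) = (\<Sum>k\<in>{0..<n}. M $$ (r, k) * ?B $$ (k, c))"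
    using assms by (simp add: scalar_prod_def index_mult_mat(1))
  consider "c = i - 1" | "c = i" | "c \<noteq> i - 1" "c \<noteq> i" by blast
  then show ?thesis
  proof cases
    case 1
    have "(\<Sum>k\<in>{0..<n}. M $$ (r, k) * ?B $$ (k, c)) = M $$ (r, i) * ?B $$ (i, c)"
      by (rule sum_eq_one_term) (use assms 1 in \<open>auto simp: braid_gen_mat_def\<close>)
    then show ?thesis using e assms 1 by (simp add: braid_gen_mat_def)
  next
    case 2
    have "(\<Sum>k\<in>{0..<n}. M $$ (r, k) * ?B $$ (k, c)) =
        M $$ (r, i - 1) * ?B $$ (i - 1, c) + M $$ (r, i) * ?B $$ (i, c)"
      by (rule sum_eq_two_terms) (use assms 2 in \<open>auto simp: braid_gen_mat_def\<close>)
    then show ?thesis using e assms 2 by (simp add: braid_gen_mat_def)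
  next
    case 3
    have "(\<Sum>k\<in>{0..<n}. M $$ (r, k) * ?B $$ (k, c)) = M $$ (r, c) * ?B $$ (c, c)"
      by (rule sum_eq_one_term) (use assms 3 in \<open>auto simp: braid_gen_mat_def\<close>)
    then show ?thesis using e assms 3 by (simp add: braid_gen_mat_def)
  qed
qed

lemma braid_mat_append:
  "braid_mat n (\<alpha> @ \<beta>) z = braid_mat n \<alpha> z * braid_mat n \<beta> (\<lambda>k. z (length \<alpha> + k))"
proof (induction \<alpha> arbitrary: z)
  case Nil
  show ?case by simp
next
  case (Cons i \<alpha>)
  show ?case
    by (simp add: Cons assoc_mult_mat[where ?n\<^sub>1 = n and ?n\<^sub>2 = n and ?n\<^sub>3 = n and ?n\<^sub>4 = n])
qed

lemma braid_mat_cong: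
  "(\<And>k. k < length \<beta> \<Longrightarrow> z k = z' k) \<Longrightarrow> braid_mat n \<beta> z = braid_mat n \<beta> z'"
proof (induction \<beta> arbitrary: z z')
  case Nil
  show ?case by simp
next
  case (Cons i \<beta>)
  have "z 0 = z' 0" using Cons.prems[of 0] by simp
  moreover have "braid_mat n \<beta> (\<lambda>k. z (Suc k)) = braid_mat n \<beta> (\<lambda>k. z' (Suc k))"
    by (rule Cons.IH) (use Cons.prems in auto)
  ultimately show ?case by simp
qed

text \<open>Right multiplication by the inverse of a braid matrix, which turns an equation
  \<open>M = U B\<^sub>i(z)\<close> into a formula for \<open>U\<close>.\<close>

definition strip_right :: "nat \<Rightarrow> nat \<Rightarrow> complex \<Rightarrow> complex mat \<Rightarrow> complex mat" where
  "strip_right n i z M = mat n n (\<lambda>(r, c).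
     if c = i then M $$ (r, i - 1)
     else if c = i - 1 then M $$ (r, i) - z * M $$ (r, i - 1)
     else M $$ (r, c))"

lemma strip_right_carrier [simp]: "strip_right n i z M \<in> carrier_mat n n"
  by (simp add: strip_right_def)

lemma strip_right_dim: "dim_row (strip_right n i z M) = n" "dim_col (strip_right n i z M) = n"
  by (simp_all add: strip_right_def)

lemma strip_right_iff:
  assumes "1 \<le> i" "i < n" "M \<in> carrier_mat n n" "U \<in> carrier_mat n n"
  shows "M = U * braid_gen_mat n i z \<longleftrightarrow> U = strip_right n i z M"
proof
  assume M: "M = U * braid_gen_mat n i z"
  show "U = strip_right n i z M"
    by (rule eq_matI) (use assms in \<open>auto simp: M strip_right_def mult_braid_gen_mat_entry\<close>)
next
  assume U: "U = strip_right n i z M"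
  show "M = U * braid_gen_mat n i z"
  proof (rule eq_matI)
    fix r c assume "r < dim_row (U * braid_gen_mat n i z)" "c < dim_col (U * braid_gen_mat n i z)"
    then have "r < n" "c < n" using assms by auto
    then show "M $$ (r, c) = (U * braid_gen_mat n i z) $$ (r, c)"
      using assms by (subst mult_braid_gen_mat_entry) (auto simp: U strip_right_def)
  qed (use assms in auto)
qed

text \<open>Invertibility of a triangular matrix is recorded on its diagonal, since the diagonal entries
  become the denominators of the parametrisation.\<close>

definition borel :: "nat \<Rightarrow> complex mat \<Rightarrow> bool" where
  "borel n U \<longleftrightarrow> U \<in> carrier_mat n n \<and> upper_triangular U \<and> (\<forall>i<n. U $$ (i, i) \<noteq> 0)"

lemma borelD:
  assumes "borel n U"
  shows "U \<in> carrier_mat n n" "dim_row U = n" "dim_col U = n" "upper_triangular U"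
    "\<And>i. i < n \<Longrightarrow> U $$ (i, i) \<noteq> 0" "\<And>r c. c < r \<Longrightarrow> r < n \<Longrightarrow> U $$ (r, c) = 0"
  using assms by (auto simp: borel_def)

lemma borel_iff_invertible:
  assumes U: "U \<in> carrier_mat n n"
  shows "borel n U \<longleftrightarrow> upper_triangular U \<and> invertible_mat U"
proof -
  have "invertible_mat U \<longleftrightarrow> det U \<noteq> 0"
  proof
    assume "invertible_mat U"
    then obtain V where V: "U * V = 1\<^sub>m n" "V * U = 1\<^sub>m (dim_row V)"
      using U by (auto simp: invertible_mat_def inverts_mat_def)
    have "dim_col V = n" using arg_cong[OF V(1), of dim_col] by simp
    moreover have "dim_row V = n" using arg_cong[OF V(2), of dim_col] U by simp
    ultimately have "V \<in> carrier_mat n n" by auto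
    then have "det U * det V = 1" using det_mult[OF U] V(1) by (metis det_one)
    then show "det U \<noteq> 0" by auto
  next
    assume "det U \<noteq> 0"
    then have "U \<in> Units (ring_mat TYPE(complex) n ())" by (rule det_non_zero_imp_unit[OF U])
    then obtain V where "V \<in> carrier_mat n n" "V * U = 1\<^sub>m n" "U * V = 1\<^sub>m n"
      by (auto simp: Units_def ring_mat_def)
    then show "invertible_mat U" using U by (auto simp: invertible_mat_def inverts_mat_def)
  qed
  moreover have "upper_triangular U \<Longrightarrow> det U = (\<Prod>i\<in>{0..<n}. U $$ (i, i))"
    using det_upper_triangular[OF _ U] U by (simp add: prod_list_diag_prod)
  ultimately show ?thesis using U by (auto simp: borel_def)
qed

text \<open>The row operations performed by a triangular matrix add multiples of lower rows to higher ones.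
  Vanishing on a set of positions that is closed under going down is therefore preserved, and
  the converse follows row by row from the bottom, dividing by the diagonal entries.\<close>

lemma borel_mult_lower_entries:
  assumes U: "borel n U" and V: "V \<in> carrier_mat n n"
    and S: "\<And>r c. (r, c) \<in> S \<Longrightarrow> r < n \<and> c < n"
      "\<And>r c r'. (r, c) \<in> S \<Longrightarrow> r \<le> r' \<Longrightarrow> r' < n \<Longrightarrow> (r', c) \<in> S"
  shows "(\<forall>(r, c)\<in>S. (U * V) $$ (r, c) = 0) \<longleftrightarrow> (\<forall>(r, c)\<in>S. V $$ (r, c) = 0)"
proof -
  have e: "(U * V) $$ (r, c) = (\<Sum>k\<in>{0..<n}. U $$ (r, k) * V $$ (k, c))" if "r < n" "c < n" for r c
    using borelD(1)[OF U] V that by (simp add: scalar_prod_def index_mult_mat(1))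
  show ?thesis
  proof
    assume 0: "\<forall>(r, c)\<in>S. V $$ (r, c) = 0"
    have "(U * V) $$ (r, c) = 0" if "(r, c) \<in> S" for r c
    proof -
      have "U $$ (r, k) * V $$ (k, c) = 0" if "k < n" for k
        using 0 S(1)[OF \<open>(r, c) \<in> S\<close>] S(2)[OF \<open>(r, c) \<in> S\<close>, of k] borelD(6)[OF U, of k r] that
        by (cases "r \<le> k") auto
      then have "(\<Sum>k\<in>{0..<n}. U $$ (r, k) * V $$ (k, c)) = 0" by (intro sum.neutral) simp
      then show ?thesis using e S(1)[OF that] by simp
    qed
    then show "\<forall>(r, c)\<in>S. (U * V) $$ (r, c) = 0" by auto
  next
    assume 0: "\<forall>(r, c)\<in>S. (U * V) $$ (r, c) = 0"
    have "V $$ (r, c) = 0" if "(r, c) \<in> S" for r c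
      using that
    proof (induction "n - r" arbitrary: r rule: less_induct)
      case less
      note rc = S(1)[OF less.prems]
      have "(U * V) $$ (r, c) = U $$ (r, r) * V $$ (r, c)"
        unfolding e[OF rc[THEN conjunct1] rc[THEN conjunct2]]
      proof (rule sum_eq_one_term)
        fix k assume k: "k \<in> {0..<n}" "k \<noteq> r"
        show "U $$ (r, k) * V $$ (k, c) = 0"
        proof (cases "k < r")
          case True
          then show ?thesis using borelD(6)[OF U, of k r] rc by simp
        next
          case False
          then have "(k, c) \<in> S" using S(2)[OF less.prems, of k] k by simp
          then show ?thesis using less.hyps[of k] False k by (simp add: diff_less_mono2)
        qed
      qed (use rc in auto)
      then show ?case using 0 less.prems borelD(5)[OF U, of r] rc by auto
    qed
    then show "\<forall>(r, c)\<in>S. V $$ (r, c) = 0" by auto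
  qed
qed

lemma upper_triangular_borel_mult:
  assumes U: "borel n U" and V: "V \<in> carrier_mat n n"
  shows "upper_triangular (U * V) \<longleftrightarrow> upper_triangular V"
proof -
  let ?S = "{(r, c). c < r \<and> r < n}"
  have "(\<forall>(r, c)\<in>?S. (U * V) $$ (r, c) = 0) \<longleftrightarrow> (\<forall>(r, c)\<in>?S. V $$ (r, c) = 0)"
    by (rule borel_mult_lower_entries[OF U V]) auto
  then show ?thesis using V borelD[OF U] by (auto simp: upper_triangular_def)
qed

text \<open>Row \<open>i\<close> of \<open>U B\<^sub>i(z)\<close> is zero before column \<open>i-1\<close>, where it is \<open>U\<^sub>i\<^sub>i\<close>, followed by \<open>z U\<^sub>i\<^sub>i\<close>; this
  reveals \<open>z\<close>. In geometric terms, \<open>z\<close> is a coordinate on the open cell of a projective line.\<close>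

lemma borel_strip_right_unique:
  assumes i: "1 \<le> i" "i < n" and "borel n U" "borel n V"
    and eq: "U * braid_gen_mat n i z = V * braid_gen_mat n i z'"
  shows "z = z'" "U = V"
proof -
  note U = borelD[OF assms(3)] and V = borelD[OF assms(4)]
  have "(U * braid_gen_mat n i z) $$ (i, i - 1) = (V * braid_gen_mat n i z') $$ (i, i - 1)"
    "(U * braid_gen_mat n i z) $$ (i, i) = (V * braid_gen_mat n i z') $$ (i, i)"
    using eq by simp_all
  moreover have "U $$ (i, i - 1) = 0" "V $$ (i, i - 1) = 0" "i \<noteq> i - 1"
    using i U(6)[of "i - 1" i] V(6)[of "i - 1" i] by auto
  ultimately have "U $$ (i, i) = V $$ (i, i)" "z * U $$ (i, i) = z' * V $$ (i, i)"
    using i U(1) V(1) by (auto simp: mult_braid_gen_mat_entry[OF i] simp del: One_nat_def)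
  then show "z = z'" using U(5)[OF i(2)] by simp
  moreover have "U * braid_gen_mat n i z \<in> carrier_mat n n"
    by (rule mult_carrier_mat[OF U(1)]) simp
  ultimately show "U = V"
    using strip_right_iff[OF i _ U(1), of "U * braid_gen_mat n i z" z]
      strip_right_iff[OF i _ V(1), of "U * braid_gen_mat n i z" z'] eq by simp
qed

text \<open>In \<open>B\<^sub>i(z) U B\<^sub>i(z')\<^sup>-\<^sup>1\<close> the two diagonal entries at \<open>i-1\<close> and \<open>i\<close> are exchanged, and \<open>(i, i-1)\<close>
  is the only position below the diagonal that can be nonzero. Its vanishing is an equation that is
  linear in \<open>z\<close> with coefficient \<open>U\<^sub>i\<^sub>i\<close> and linear in \<open>z'\<close> with coefficient \<open>-U\<^bsub>i-1,i-1\<^esub>\<close>, so either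
  variable determines the other.\<close>

lemma borel_slide:
  assumes i: "1 \<le> i" "i < n" and "borel n U"
  shows "borel n (strip_right n i z' (braid_gen_mat n i z * U)) \<longleftrightarrow>
    z * U $$ (i, i) = U $$ (i - 1, i - 1) * z' - U $$ (i - 1, i)"
proof -
  note U = borelD[OF assms(3)]
  let ?V = "strip_right n i z' (braid_gen_mat n i z * U)"
  have V: "?V $$ (r, c) = 
     (let R = (\<lambda>c. if r = i - 1 then U $$ (i, c)
          else if r = i then U $$ (i - 1, c) + z * U $$ (i, c) else U $$ (r, c))
      in if c = i then R (i - 1) else if c = i - 1 then R i - z' * R (i - 1) else R c)"
    if "r < n" "c < n" for r c
    using that i U(1) by (simp add: strip_right_def braid_gen_mat_mult_entry[OF i U(1)] Let_def)
  have z: "?V $$ (i, i - 1) = U $$ (i - 1, i) + z * U $$ (i, i) - z' * U $$ (i - 1, i - 1)"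
    using V[of i "i - 1"] i U(6)[of "i - 1" i] by auto
  have diag: "?V $$ (r, r) = (if r = i then U $$ (i - 1, i - 1)
      else if r = i - 1 then U $$ (i, i) else U $$ (r, r))" if "r < n" for r
    using V[OF that that] i U(6)[of "i - 1" i] by (auto simp: Let_def)
  have low: "?V $$ (r, c) = 0" if "c < r" "r < n" "(r, c) \<noteq> (i, i - 1)" for r c
  proof -
    have "c < i - 1 \<or> c = i - 1 \<or> c = i \<or> c > i" by auto
    moreover have "U $$ (r, i) = 0" if "i < r" using U(6)[of i r] that \<open>r < n\<close> by simp
    moreover have "U $$ (r, i - 1) = 0" if "i \<le> r" using U(6)[of "i - 1" r] that \<open>r < n\<close> i by simp
    moreover have "U $$ (r, c) = 0" using U(6) \<open>c < r\<close> \<open>r < n\<close> by simp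
    moreover have "U $$ (i, c) = 0" if "c < i" using U(6) i that by simp
    moreover have "U $$ (i - 1, c) = 0" if "c < i - 1" using U(6)[of c "i - 1"] i that by simp
    ultimately show ?thesis
      using that V[of r c] i by (auto simp: Let_def)
  qed
  have "borel n ?V \<longleftrightarrow> ?V $$ (i, i - 1) = 0"
  proof
    assume "borel n ?V"
    then show "?V $$ (i, i - 1) = 0" using borelD(6)[of n ?V "i - 1" i] i by simp
  next
    assume "?V $$ (i, i - 1) = 0"
    then have "?V $$ (r, c) = 0" if "c < r" "r < n" for r c
      using low[OF that] by (cases "(r, c) = (i, i - 1)") auto
    moreover have "?V $$ (r, r) \<noteq> 0" if "r < n" for r
      unfolding diag[OF that] using U(5) i that by auto
    ultimately show "borel n ?V" by (auto simp: borel_def strip_right_def)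
  qed
  then show ?thesis unfolding z by (auto simp: algebra_simps)
qed

section \<open>Sliding a triangular matrix through a braid word\<close>

text \<open>The relations that carry a triangular matrix from the right end of \<open>l\<close> (where it is
  \<open>U (length l)\<close>) to the left end (where it is \<open>U 0\<close>), changing the variables \<open>z\<close> into \<open>z'\<close>.\<close>

definition slides ::
  "nat \<Rightarrow> word \<Rightarrow> (nat \<Rightarrow> complex) \<Rightarrow> (nat \<Rightarrow> complex) \<Rightarrow> (nat \<Rightarrow> complex mat) \<Rightarrow> bool" where
  "slides n l z z' U \<longleftrightarrow> (\<forall>q\<le>length l. borel n (U q)) \<and>
     (\<forall>q<length l. braid_gen_mat n (l ! q) (z q) * U (Suc q) = U q * braid_gen_mat n (l ! q) (z' q))"

lemma slides_Nil [simp]: "slides n [] z z' U \<longleftrightarrow> borel n (U 0)"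
  by (simp add: slides_def)

lemma slides_Cons:
  "slides n (i # l) z z' U \<longleftrightarrow>
     borel n (U 0) \<and> braid_gen_mat n i (z 0) * U 1 = U 0 * braid_gen_mat n i (z' 0) \<and>
     slides n l (\<lambda>k. z (Suc k)) (\<lambda>k. z' (Suc k)) (\<lambda>q. U (Suc q))"
  unfolding slides_def length_Cons less_Suc_eq_le[symmetric] All_less_Suc2 by auto

lemma slides_borel: "slides n l z z' U \<Longrightarrow> q \<le> length l \<Longrightarrow> borel n (U q)"
  by (simp add: slides_def)

definition slide_var :: "nat \<Rightarrow> complex mat \<Rightarrow> complex \<Rightarrow> complex" where
  "slide_var i U z' = (U $$ (i - 1, i - 1) * z' - U $$ (i - 1, i)) / U $$ (i, i)"

definition slide_mat :: "nat \<Rightarrow> nat \<Rightarrow> complex mat \<Rightarrow> complex \<Rightarrow> complex mat" where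
  "slide_mat n i U z' = strip_right n i z' (braid_gen_mat n i (slide_var i U z') * U)"

lemma slide_step_iff:
  assumes i: "1 \<le> i" "i < n" and "borel n U"
  shows "borel n V \<and> braid_gen_mat n i z * U = V * braid_gen_mat n i z' \<longleftrightarrow>
    z = slide_var i U z' \<and> V = slide_mat n i U z'"
proof -
  note U = borelD[OF assms(3)]
  have c: "braid_gen_mat n i z * U \<in> carrier_mat n n" by (rule mult_carrier_mat[OF _ U(1)]) simp
  have "z * U $$ (i, i) = U $$ (i - 1, i - 1) * z' - U $$ (i - 1, i) \<longleftrightarrow> z = slide_var i U z'"
    using U(5)[OF i(2)] by (simp add: slide_var_def field_simps)
  moreover have "V \<in> carrier_mat n n \<Longrightarrow>
      braid_gen_mat n i z * U = V * braid_gen_mat n i z' \<longleftrightarrow>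
      V = strip_right n i z' (braid_gen_mat n i z * U)"
    by (rule strip_right_iff[OF i c])
  ultimately show ?thesis
    using borel_slide[OF i assms(3), of z' z]
    by (metis borelD(1) slide_mat_def strip_right_carrier)
qed

primrec slide_left :: "nat \<Rightarrow> word \<Rightarrow> (nat \<Rightarrow> complex) \<Rightarrow> complex mat \<Rightarrow> complex mat" where
  "slide_left n [] z' U = U"
| "slide_left n (i # l) z' U = slide_mat n i (slide_left n l (\<lambda>k. z' (Suc k)) U) (z' 0)"

lemma braid_word_Nil [simp]: "braid_word n []"
  by (simp add: braid_word_def)

lemma braid_word_Cons [simp]: "braid_word n (i # l) \<longleftrightarrow> 1 \<le> i \<and> i < n \<and> braid_word n l"
  by (auto simp: braid_word_def)

lemma braid_word_append [simp]: "braid_word n (a @ b) \<longleftrightarrow> braid_word n a \<and> braid_word n b"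
  by (auto simp: braid_word_def)

lemma braid_word_drop: "braid_word n l \<Longrightarrow> braid_word n (drop q l)"
  using set_drop_subset[of q l] by (auto simp: braid_word_def)

lemma braid_word_nth: "braid_word n l \<Longrightarrow> q < length l \<Longrightarrow> 1 \<le> l ! q \<and> l ! q < n"
  using nth_mem[of q l] unfolding braid_word_def by force

lemma borel_slide_left: "braid_word n l \<Longrightarrow> borel n U \<Longrightarrow> borel n (slide_left n l z' U)"
proof (induction l arbitrary: z')
  case Nil
  then show ?case by simp
next
  case (Cons i l)
  then have "borel n (slide_left n l (\<lambda>k. z' (Suc k)) U)" "1 \<le> i" "i < n" by auto
  then show ?case using slide_step_iff[of i n] by (metis slide_left.simps(2))
qed

text \<open>Upwards: the variables \<open>z'\<close> below and the rightmost matrix determine all other matrices and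
  the variables above.\<close>

lemma slides_iff:
  assumes "braid_word n l"
  shows "slides n l z z' U \<longleftrightarrow> borel n (U (length l)) \<and>
    (\<forall>q\<le>length l. U q = slide_left n (drop q l) (\<lambda>k. z' (q + k)) (U (length l))) \<and>
    (\<forall>q<length l. z q =
       slide_var (l ! q) (slide_left n (drop (Suc q) l) (\<lambda>k. z' (Suc q + k)) (U (length l))) (z' q))"
  using assms
proof (induction l arbitrary: z z' U)
  case Nil
  show ?case by simp
next
  case (Cons i l)
  let ?p = "length (i # l)"
  let ?W = "slide_left n l (\<lambda>k. z' (Suc k)) (U ?p)"
  have i: "1 \<le> i" "i < n" and l: "braid_word n l" using Cons.prems by auto
  note IH = Cons.IH[OF l, of "\<lambda>k. z (Suc k)" "\<lambda>k. z' (Suc k)" "\<lambda>q. U (Suc q)"]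
  have "slides n (i # l) z z' U \<longleftrightarrow>
      slides n l (\<lambda>k. z (Suc k)) (\<lambda>k. z' (Suc k)) (\<lambda>q. U (Suc q)) \<and>
      borel n (U 0) \<and> braid_gen_mat n i (z 0) * U 1 = U 0 * braid_gen_mat n i (z' 0)"
    by (auto simp: slides_Cons)
  also have "\<dots> \<longleftrightarrow> slides n l (\<lambda>k. z (Suc k)) (\<lambda>k. z' (Suc k)) (\<lambda>q. U (Suc q)) \<and>
      z 0 = slide_var i ?W (z' 0) \<and> U 0 = slide_mat n i ?W (z' 0)"
  proof (rule conj_cong[OF refl])
    assume s: "slides n l (\<lambda>k. z (Suc k)) (\<lambda>k. z' (Suc k)) (\<lambda>q. U (Suc q))"
    then have U1: "borel n (U 1)" by (auto dest: slides_borel[where q = 0])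
    have "U 1 = ?W"
      using conjunct1[OF conjunct2[OF s[unfolded IH]], rule_format, of 0] by simp
    then show "borel n (U 0) \<and> braid_gen_mat n i (z 0) * U 1 = U 0 * braid_gen_mat n i (z' 0) \<longleftrightarrow>
        z 0 = slide_var i ?W (z' 0) \<and> U 0 = slide_mat n i ?W (z' 0)"
      using slide_step_iff[OF i U1] by simp
  qed
  also have "\<dots> \<longleftrightarrow> borel n (U ?p) \<and>
    (\<forall>q<Suc ?p. U q = slide_left n (drop q (i # l)) (\<lambda>k. z' (q + k)) (U ?p)) \<and>
    (\<forall>q<?p. z q =
       slide_var ((i # l) ! q) (slide_left n (drop (Suc q) (i # l)) (\<lambda>k. z' (Suc q + k)) (U ?p)) (z' q))"
    unfolding IH length_Cons All_less_Suc2[of "Suc _"] All_less_Suc2[of "length l"]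
      less_Suc_eq_le[symmetric]
    by auto
  finally show ?case unfolding less_Suc_eq_le .
qed

text \<open>Downwards: the variables \<open>z\<close> above and the rightmost matrix determine the variables below. The
  matrix arrives at the first letter only after passing all the others, so the induction has to
  keep track of \<open>U 0\<close>.\<close>

lemma slides_down_unique:
  assumes "braid_word n l" "slides n l z z' U" "slides n l z z'' V" "U (length l) = V (length l)"
  shows "(\<forall>q<length l. z' q = z'' q) \<and> U 0 = V 0"
  using assms
proof (induction l arbitrary: z z' z'' U V)
  case Nil
  then show ?case by simp
next
  case (Cons i l)
  have i: "1 \<le> i" "i < n" using Cons.prems(1) by auto
  note U = Cons.prems(2)[unfolded slides_Cons] and V = Cons.prems(3)[unfolded slides_Cons]
  have IH: "(\<forall>q<length l. z' (Suc q) = z'' (Suc q)) \<and> U (Suc 0) = V (Suc 0)"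
    using Cons.IH[of "\<lambda>k. z (Suc k)" "\<lambda>k. z' (Suc k)" "\<lambda>q. U (Suc q)"
        "\<lambda>k. z'' (Suc k)" "\<lambda>q. V (Suc q)"] Cons.prems U V by simp
  then have "U 0 * braid_gen_mat n i (z' 0) = V 0 * braid_gen_mat n i (z'' 0)"
    using U V by simp
  then have "z' 0 = z'' 0" "U 0 = V 0"
    using borel_strip_right_unique[OF i] U V by blast+
  then show ?case using IH by (auto simp: All_less_Suc2)
qed

lemma slides_down_exists:
  assumes "braid_word n l" "borel n C"
  shows "\<exists>z' U. slides n l z z' U \<and> U (length l) = C"
  using assms(1)
proof (induction l arbitrary: z)
  case Nil
  show ?case by (rule exI, rule exI[of _ "\<lambda>_. C"]) (use assms in simp)
next
  case (Cons i l)
  have i: "1 \<le> i" "i < n" using Cons.prems by auto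
  obtain z' U where IH: "slides n l (\<lambda>k. z (Suc k)) z' U" "U (length l) = C"
    using Cons.IH[of "\<lambda>k. z (Suc k)"] Cons.prems by auto
  have U0: "borel n (U 0)" using slides_borel[OF IH(1), of 0] by simp
  let ?c = "(z 0 * U 0 $$ (i, i) + U 0 $$ (i - 1, i)) / U 0 $$ (i - 1, i - 1)"
  let ?V = "slide_mat n i (U 0) ?c"
  have "U 0 $$ (i - 1, i - 1) \<noteq> 0" "U 0 $$ (i, i) \<noteq> 0"
    using borelD(5)[OF U0, of "i - 1"] borelD(5)[OF U0, of i] i by auto
  then have "z 0 = slide_var i (U 0) ?c" by (simp add: slide_var_def)
  then have "borel n ?V \<and> braid_gen_mat n i (z 0) * U 0 = ?V * braid_gen_mat n i ?c"
    using slide_step_iff[OF i U0, of ?V "z 0" ?c] by blast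
  then have "slides n (i # l) z (case_nat ?c z') (case_nat ?V U)"
    using IH by (simp add: slides_Cons)
  moreover have "case_nat ?V U (length (i # l)) = C" using IH(2) by simp
  ultimately show ?case by blast
qed

lemma slides_product:
  assumes "braid_word n l" "slides n l z z' U"
  shows "braid_mat n l z * U (length l) = U 0 * braid_mat n l z'"
  using assms
proof (induction l arbitrary: z z' U)
  case Nil
  then have "U 0 \<in> carrier_mat n n" by (simp add: borelD(1))
  then show ?case by simp
next
  case (Cons i l)
  note S = Cons.prems(2)[unfolded slides_Cons]
  let ?P = "braid_mat n l (\<lambda>k. z (Suc k))" and ?P' = "braid_mat n l (\<lambda>k. z' (Suc k))"
  let ?B = "braid_gen_mat n i (z 0)" and ?B' = "braid_gen_mat n i (z' 0)"
  have c: "U 0 \<in> carrier_mat n n" "U (Suc (length l)) \<in> carrier_mat n n" "U 1 \<in> carrier_mat n n"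
    using S slides_borel[OF Cons.prems(2), of "Suc (length l)"]
      slides_borel[OF Cons.prems(2), of 1] borelD(1) by auto
  have IH: "?P * U (Suc (length l)) = U 1 * ?P'"
    using Cons.IH[of "\<lambda>k. z (Suc k)" "\<lambda>k. z' (Suc k)" "\<lambda>q. U (Suc q)"] Cons.prems S by simp
  have "?B * ?P * U (Suc (length l)) = ?B * (?P * U (Suc (length l)))"
    by (rule assoc_mult_mat[of _ n n _ n _ n]) (use c in auto)
  also have "\<dots> = ?B * U 1 * ?P'"
    unfolding IH by (rule assoc_mult_mat[of _ n n _ n _ n, symmetric]) (use c in auto)
  also have "\<dots> = U 0 * ?B' * ?P'" using S by simp
  also have "\<dots> = U 0 * (?B' * ?P')"
    by (rule assoc_mult_mat[of _ n n _ n _ n]) (use c in auto)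
  finally show ?case by simp
qed

section \<open>The relations at a single vertex\<close>

lemma braid_gen_mat_prod_entry:
  assumes "1 \<le> i" "i < n" "r < n" "c < n"
  shows "(braid_gen_mat n i a * braid_gen_mat n i b) $$ (r, c) =
    (if r = i - 1 \<and> c = i - 1 then 1
     else if r = i - 1 \<and> c = i then b
     else if r = i \<and> c = i - 1 then a
     else if r = i \<and> c = i then 1 + a * b
     else if r = c then 1 else 0)"
  using assms by (subst braid_gen_mat_mult_entry) (auto simp: braid_gen_mat_def)

text \<open>On the rows and columns \<open>i-1, i\<close>, the matrix \<open>B\<^sub>i(a) B\<^sub>i(b) B\<^sub>i(c)\<^sup>-\<^sup>1\<close> has the rows \<open>(b - c, 1)\<close> and
  \<open>(1 + ab - ca, a)\<close>. It is triangular when \<open>a (c - b) = 1\<close>.\<close>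

lemma trivalent_iff:
  assumes i: "1 \<le> i" "i < n"
  shows "borel n U \<and> braid_gen_mat n i a * braid_gen_mat n i b = U * braid_gen_mat n i c \<longleftrightarrow>
    a \<noteq> 0 \<and> b = c - 1 / a \<and> U = strip_right n i c (braid_gen_mat n i a * braid_gen_mat n i b)"
proof -
  obtain m where m: "i = Suc m" using i by (cases i) auto
  let ?M = "braid_gen_mat n i a * braid_gen_mat n i b"
  let ?V = "strip_right n i c ?M"
  have M: "?M \<in> carrier_mat n n" by (rule mult_carrier_mat) auto
  have V: "?V $$ (r, s) =
    (if r = m \<and> s = m then b - c
     else if r = m \<and> s = i then 1
     else if r = i \<and> s = m then 1 + a * b - c * a
     else if r = i \<and> s = i then a
     else if r = s then 1 else 0)" if "r < n" "s < n" for r s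
    using that i by (auto simp: m strip_right_def braid_gen_mat_prod_entry)
  have "borel n ?V \<longleftrightarrow> b \<noteq> c \<and> a \<noteq> 0 \<and> 1 + a * b - c * a = 0"
  proof
    assume "borel n ?V"
    note b = borelD[OF this]
    show "b \<noteq> c \<and> a \<noteq> 0 \<and> 1 + a * b - c * a = 0"
      using b(5)[of i] b(5)[of m] b(6)[of m i] V[of i i] V[of m m] V[of i m] i m by auto
  next
    assume a: "b \<noteq> c \<and> a \<noteq> 0 \<and> 1 + a * b - c * a = 0"
    then show "borel n ?V"
      unfolding borel_def upper_triangular_def
      using V i m by (auto simp: strip_right_dim)
  qed
  also have "\<dots> \<longleftrightarrow> a \<noteq> 0 \<and> b = c - 1 / a"
    by (auto simp: field_simps)
  finally show ?thesis
    using strip_right_iff[OF i M, of U c] by (metis borelD(1) strip_right_carrier)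
qed

lemma cup_iff:
  assumes i: "1 \<le> i" "i < n"
  shows "borel n (braid_gen_mat n i a * braid_gen_mat n i b) \<longleftrightarrow> a = 0"
proof
  assume "borel n (braid_gen_mat n i a * braid_gen_mat n i b)"
  from borelD(6)[OF this, of "i - 1" i] show "a = 0"
    using i by (auto simp: braid_gen_mat_prod_entry split: if_splits)
next
  assume "a = 0"
  then show "borel n (braid_gen_mat n i a * braid_gen_mat n i b)"
    using i by (auto simp: borel_def upper_triangular_def braid_gen_mat_prod_entry
        intro!: mult_carrier_mat[of _ n n])
qed

text \<open>Both sides have the rows \<open>(0, 0, 1)\<close>, \<open>(0, 1, \<cdot>)\<close>, \<open>(1, \<cdot>, \<cdot>)\<close> on the three indices
  involved, and the three remaining entries are \<open>x, w, y\<close> on the left and \<open>w', x', y' + x'w'\<close> on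
  the right.\<close>

lemma hexavalent_iff:
  assumes i: "1 \<le> i" "Suc i < n"
  shows "braid_gen_mat n i x * (braid_gen_mat n (Suc i) y * braid_gen_mat n i w) =
      braid_gen_mat n (Suc i) x' * (braid_gen_mat n i y' * braid_gen_mat n (Suc i) w') \<longleftrightarrow>
    x' = w \<and> w' = x \<and> y = y' + x' * w'" (is "?L = ?R \<longleftrightarrow> _")
proof -
  obtain m where m: "i = Suc m" using i by (cases i) auto
  have c: "braid_gen_mat n j a * braid_gen_mat n k b \<in> carrier_mat n n" for j k a b
    by (rule mult_carrier_mat) auto
  have L: "?L $$ (r, s) =
    (if r = m then (if s = Suc i then 1 else 0)
     else if r = i then (if s = i then 1 else if s = Suc i then x else 0)
     else if r = Suc i then (if s = m then 1 else if s = i then w else if s = Suc i then y else 0)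
     else if r = s then 1 else 0)" if "r < n" "s < n" for r s
  proof -
    consider "r = m" | "r = Suc m" | "r = Suc (Suc m)"
      | "r \<noteq> m" "r \<noteq> Suc m" "r \<noteq> Suc (Suc m)" by blast
    then show ?thesis using i that m
      by cases (simp_all add: braid_gen_mat_mult_entry c, simp_all add: braid_gen_mat_def)
  qed
  have R: "?R $$ (r, s) =
    (if r = m then (if s = Suc i then 1 else 0)
     else if r = i then (if s = i then 1 else if s = Suc i then w' else 0)
     else if r = Suc i then (if s = m then 1 else if s = i then x'
        else if s = Suc i then y' + x' * w' else 0)
     else if r = s then 1 else 0)" if "r < n" "s < n" for r s
  proof -
    consider "r = m" | "r = Suc m" | "r = Suc (Suc m)"
      | "r \<noteq> m" "r \<noteq> Suc m" "r \<noteq> Suc (Suc m)" by blast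
    then show ?thesis using i that m
      by cases (simp_all add: braid_gen_mat_mult_entry c, simp_all add: braid_gen_mat_def)
  qed
  show ?thesis
  proof
    assume eq: "?L = ?R"
    then have e: "?L $$ (r, s) = ?R $$ (r, s)" for r s by simp
    have nd: "i \<noteq> m" "Suc i \<noteq> m" "m < n" using m i by auto
    have "x = w'" using e[of i "Suc i"] nd i by (simp add: L R)
    moreover have "w = x'" using e[of "Suc i" i] nd i by (simp add: L R)
    moreover have "y = y' + x' * w'" using e[of "Suc i" "Suc i"] nd i by (simp add: L R)
    ultimately show "x' = w \<and> w' = x \<and> y = y' + x' * w'" by simp
  next
    assume a: "x' = w \<and> w' = x \<and> y = y' + x' * w'"
    show "?L = ?R"
    proof (rule eq_matI)
      fix r s assume "r < dim_row ?R" "s < dim_col ?R"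
      then have rs: "r < n" "s < n" by simp_all
      show "?L $$ (r, s) = ?R $$ (r, s)"
        unfolding L[OF rs] R[OF rs] using a by simp
    qed simp_all
  qed
qed

lemma tetravalent_iff:
  assumes i: "1 \<le> i" "i < n" "1 \<le> j" "j < n" and ij: "Suc i < j \<or> Suc j < i"
  shows "braid_gen_mat n i x * braid_gen_mat n j y = braid_gen_mat n j x' * braid_gen_mat n i y' \<longleftrightarrow>
    x' = y \<and> y' = x" (is "?L = ?R \<longleftrightarrow> _")
proof -
  obtain m where m: "i = Suc m" using i by (cases i) auto
  obtain k where k: "j = Suc k" using i by (cases j) auto
  have nd: "k \<noteq> m" "k \<noteq> Suc m" "m \<noteq> k" "m \<noteq> Suc k" "Suc k \<noteq> m" "Suc m \<noteq> k" "Suc m < n" "Suc k < n"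
    using i ij m k by auto
  have L: "?L $$ (r, s) =
    (if r = m then (if s = i then 1 else 0)
     else if r = i then (if s = m then 1 else if s = i then x else 0)
     else if r = k then (if s = j then 1 else 0)
     else if r = j then (if s = k then 1 else if s = j then y else 0)
     else if r = s then 1 else 0)" if "r < n" "s < n" for r s
  proof -
    consider "r = m" | "r = Suc m" | "r = k" | "r = Suc k"
      | "r \<noteq> m" "r \<noteq> Suc m" "r \<noteq> k" "r \<noteq> Suc k" by blast
    then show ?thesis using nd that unfolding m k
      by cases (simp_all add: braid_gen_mat_mult_entry, simp_all add: braid_gen_mat_def)
  qed
  have R: "?R $$ (r, s) =
    (if r = m then (if s = i then 1 else 0)
     else if r = i then (if s = m then 1 else if s = i then y' else 0)
     else if r = k then (if s = j then 1 else 0)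
     else if r = j then (if s = k then 1 else if s = j then x' else 0)
     else if r = s then 1 else 0)" if "r < n" "s < n" for r s
  proof -
    consider "r = m" | "r = Suc m" | "r = k" | "r = Suc k"
      | "r \<noteq> m" "r \<noteq> Suc m" "r \<noteq> k" "r \<noteq> Suc k" by blast
    then show ?thesis using nd that unfolding m k
      by cases (simp_all add: braid_gen_mat_mult_entry, simp_all add: braid_gen_mat_def)
  qed
  show ?thesis
  proof
    assume eq: "?L = ?R"
    then have e: "?L $$ (r, s) = ?R $$ (r, s)" for r s by simp
    have nd': "i \<noteq> m" "i \<noteq> k" "j \<noteq> m" "j \<noteq> k" "i \<noteq> j" using m k ij by auto
    have "x = y'" using e[of i i] nd' i by (simp add: L R)
    moreover have "y = x'" using e[of j j] nd' i by (simp add: L R)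
    ultimately show "x' = y \<and> y' = x" by simp
  next
    assume a: "x' = y \<and> y' = x"
    show "?L = ?R"
    proof (rule eq_matI)
      fix r s assume "r < dim_row ?R" "s < dim_col ?R"
      then have rs: "r < n" "s < n" by simp_all
      show "?L $$ (r, s) = ?R $$ (r, s)"
        unfolding L[OF rs] R[OF rs] using a by simp
    qed simp_all
  qed
qed

section \<open>Solving the relations of a step for the variables above it\<close>

text \<open>Read upwards, a step with matrices \<open>U\<^sub>q\<close> has one free parameter \<open>t\<close>: the variable \<open>a\<close> of the
  first of the two merging letters at a trivalent vertex, and the variable of the second letter
  at a cup, where the first one is forced to be 0. The parameter and the variables below
  determine the innermost matrix \<open>U\<^sub>p\<close>, called the corner here, and through it everything
  above. Vertices without matrices have the identity as default.\<close>

definition vertex_corner :: "nat \<Rightarrow> vertex \<Rightarrow> complex \<Rightarrow> complex \<Rightarrow> complex mat" where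
  "vertex_corner n v t c = (case v of
     Trivalent i \<Rightarrow> strip_right n i c (braid_gen_mat n i t * braid_gen_mat n i (c - 1 / t))
   | Cup i \<Rightarrow> braid_gen_mat n i 0 * braid_gen_mat n i t
   | _ \<Rightarrow> 1\<^sub>m n)"

definition step_corner :: "nat \<Rightarrow> step \<Rightarrow> complex \<Rightarrow> (nat \<Rightarrow> complex) \<Rightarrow> complex mat" where
  "step_corner n s t z' = vertex_corner n (vertex_of s) t (z' (length (left_word s)))"

definition lift_mats :: "nat \<Rightarrow> step \<Rightarrow> complex \<Rightarrow> (nat \<Rightarrow> complex) \<Rightarrow> nat \<Rightarrow> complex mat" where
  "lift_mats n s t z' q =
     slide_left n (drop q (left_word s)) (\<lambda>m. z' (q + m)) (step_corner n s t z')"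

definition lift_left :: "nat \<Rightarrow> step \<Rightarrow> complex \<Rightarrow> (nat \<Rightarrow> complex) \<Rightarrow> nat \<Rightarrow> complex" where
  "lift_left n s t z' k = slide_var (left_word s ! k) (lift_mats n s t z' (Suc k)) (z' k)"

definition lift_vars :: "nat \<Rightarrow> step \<Rightarrow> complex \<Rightarrow> (nat \<Rightarrow> complex) \<Rightarrow> nat \<Rightarrow> complex" where
  "lift_vars n s t z' k = (let p = length (left_word s) in case vertex_of s of
     Trivalent i \<Rightarrow> if k < p then lift_left n s t z' k else if k = p then t
       else if k = Suc p then z' p - 1 / t else z' (k - 1)
   | Cup i \<Rightarrow> if k < p then lift_left n s t z' k else if k = p then 0
       else if k = Suc p then t else z' (k - 2)
   | Hexavalent i j \<Rightarrow> if k = p then z' (p + 2)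
       else if k = p + 1 then
         (if i < j then z' (p + 1) + z' p * z' (p + 2) else z' (p + 1) - z' p * z' (p + 2))
       else if k = p + 2 then z' p else z' k
   | Tetravalent i j \<Rightarrow> if k = p then z' (p + 1) else if k = p + 1 then z' p else z' k)"

text \<open>The position of the parameter among the variables above the step, with a default for the 4- and
  6-valent vertices, which have no parameter.\<close>

definition step_param_index :: "step \<Rightarrow> nat" where
  "step_param_index s =
     (if is_cup (vertex_of s) then Suc (length (left_word s)) else length (left_word s))"

definition generic :: "step \<Rightarrow> complex \<Rightarrow> bool" where
  "generic s t \<longleftrightarrow> (is_trivalent (vertex_of s) \<longrightarrow> t \<noteq> 0)"

lemma has_U_vertex [simp]:
  "vertex_of s = Trivalent i \<Longrightarrow> has_U s" "vertex_of s = Cup i \<Longrightarrow> has_U s"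
  "vertex_of s = Hexavalent i j \<Longrightarrow> \<not> has_U s" "vertex_of s = Tetravalent i j \<Longrightarrow> \<not> has_U s"
  by (simp_all add: has_U_def)

lemma step_relations_has_U:
  assumes "has_U s" and U: "\<And>q. q \<le> length (left_word s) \<Longrightarrow> U q \<in> carrier_mat n n"
  shows "step_relations n s z z' U \<longleftrightarrow>
    (let p = length (left_word s); u = vertex_source (vertex_of s); v = vertex_target (vertex_of s)
     in (\<forall>k<length (right_word s). z (p + length u + k) = z' (p + length v + k)) \<and>
       slides n (left_word s) z z' U \<and>
       braid_mat n u (\<lambda>k. z (p + k)) = U p * braid_mat n v (\<lambda>k. z' (p + k)))"
proof -
  let ?l = "left_word s"
  have b: "(\<forall>q\<le>length ?l. upper_triangular (U q) \<and> invertible_mat (U q)) \<longleftrightarrow>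
      (\<forall>q\<le>length ?l. borel n (U q))"
    using borel_iff_invertible[OF U] by blast
  have "(\<forall>q\<in>{1..p}. P (q - 1) q) \<longleftrightarrow> (\<forall>q<p. P q (Suc q))" for p and P :: "nat \<Rightarrow> nat \<Rightarrow> bool"
  proof
    assume a: "\<forall>q\<in>{1..p}. P (q - 1) q"
    show "\<forall>q<p. P q (Suc q)"
    proof (intro allI impI)
      fix q assume "q < p"
      then show "P q (Suc q)" using bspec[OF a, of "Suc q"] by simp
    qed
  next
    assume a: "\<forall>q<p. P q (Suc q)"
    show "\<forall>q\<in>{1..p}. P (q - 1) q"
    proof
      fix q assume "q \<in> {1..p}"
      then obtain r where "q = Suc r" "r < p" by (cases q) auto
      then show "P (q - 1) q" using a by simp
    qed
  qed
  note c = this[of "length ?l" "\<lambda>r q. braid_gen_mat n (?l ! r) (z r) * U q =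
     U r * braid_gen_mat n (?l ! r) (z' r)"]
  show ?thesis
    unfolding step_relations_def Let_def slides_def b c using assms(1) by auto
qed

lemma braid_mat_pair: "braid_mat n [i, j] z = braid_gen_mat n i (z 0) * braid_gen_mat n j (z 1)"
  by simp

lemma braid_mat_triple: "braid_mat n [i, j, k] z =
    braid_gen_mat n i (z 0) * (braid_gen_mat n j (z 1) * braid_gen_mat n k (z 2))"
  by (simp add: numeral_2_eq_2)

lemma affine_eq_iff:
  assumes "z \<in> affine_space {..<m}" "z' \<in> affine_space {..<m}"
  shows "z = z' \<longleftrightarrow> (\<forall>k<m. z k = z' k)"
  using assms by (auto simp: affine_space_def fun_eq_iff) (metis lessThan_iff)

lemma lift_vars_affine:
  assumes "z' \<in> affine_space {..<length (step_target s)}"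
  shows "lift_vars n s t z' \<in> affine_space {..<length (step_source s)}"
  using assms
  by (cases "vertex_of s")
    (auto simp: affine_space_def lift_vars_def Let_def step_source_def step_target_def)

lemma lift_vars_param: "has_U s \<Longrightarrow> lift_vars n s t z' (step_param_index s) = t"
  by (cases "vertex_of s") (auto simp: has_U_def lift_vars_def step_param_index_def Let_def)

text \<open>All relations of a step together say that the variables above and the matrices are the lifts
  computed from the variables below and the parameter; the only condition left is that the
  parameter of a trivalent vertex is nonzero.\<close>

lemma step_lift_iff:
  assumes s: "braid_word n (step_source s)" "valid_vertex (vertex_of s)"
    and z: "z \<in> affine_space {..<length (step_source s)}"
    and z': "z' \<in> affine_space {..<length (step_target s)}"
    and U: "\<And>q. q \<le> length (left_word s) \<Longrightarrow> U q \<in> carrier_mat n n"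
  shows "step_relations n s z z' U \<longleftrightarrow>
    (let t = z (step_param_index s) in generic s t \<and> z = lift_vars n s t z' \<and>
       (has_U s \<longrightarrow> (\<forall>q\<le>length (left_word s). U q = lift_mats n s t z' q)))"
proof -
  let ?l = "left_word s" and ?r = "right_word s"
  let ?p = "length ?l"
  let ?t = "z (step_param_index s)"
  have l: "braid_word n ?l" and src: "braid_word n (vertex_source (vertex_of s))"
    using s by (auto simp: step_source_def)
  have lifted: "z = lift_vars n s ?t z' \<longleftrightarrow>
     (\<forall>k<length (step_source s). z k = lift_vars n s ?t z' k)"
    by (rule affine_eq_iff[OF z lift_vars_affine[OF z']])
  have less: "(\<forall>k<p + (m + r). P k) \<longleftrightarrow> (\<forall>k<p. P k) \<and> (\<forall>k<m. P (p + k)) \<and> (\<forall>k<r. P (p + m + k))"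
    for p m r and P :: "nat \<Rightarrow> bool"
  proof (intro iffI conjI allI impI)
    fix k assume a: "(\<forall>k<p. P k) \<and> (\<forall>k<m. P (p + k)) \<and> (\<forall>k<r. P (p + m + k))" and k: "k < p + (m + r)"
    consider "k < p" | "p \<le> k" "k < p + m" | "p + m \<le> k" by linarith
    then show "P k"
    proof cases
      case 2
      then show ?thesis using a[THEN conjunct2, THEN conjunct1, rule_format, of "k - p"] k by simp
    next
      case 3
      then show ?thesis using a[THEN conjunct2, THEN conjunct2, rule_format, of "k - (p + m)"] k by simp
    qed (use a in auto)
  qed auto
  have slide: "slides n ?l z z' U \<longleftrightarrow> (\<forall>q\<le>?p. U q = lift_mats n s ?t z' q) \<and>
      (\<forall>k<?p. z k = lift_left n s ?t z' k)"
    if "U ?p = step_corner n s ?t z'" "borel n (U ?p)"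
    unfolding slides_iff[OF l] lift_left_def lift_mats_def that(1)[symmetric] using that(2) by auto
  have corner: "lift_mats n s ?t z' ?p = step_corner n s ?t z'" by (simp add: lift_mats_def)
  have all2: "(\<forall>k<2. P k) \<longleftrightarrow> P 0 \<and> P (Suc 0)" and all3: "(\<forall>k<3. P k) \<longleftrightarrow> P 0 \<and> P (Suc 0) \<and> P 2"
    for P :: "nat \<Rightarrow> bool"
    by (auto simp: less_Suc_eq numeral_2_eq_2 numeral_3_eq_3)
  show ?thesis
  proof (cases "vertex_of s")
    case (Trivalent i)
    have i: "1 \<le> i" "i < n" using src Trivalent by auto
    have t: "?t = z ?p" by (simp add: step_param_index_def Trivalent)
    let ?T = "z ?p \<noteq> 0 \<and> z (Suc ?p) = z' ?p - 1 / z ?p \<and> U ?p = step_corner n s (z ?p) z'"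
    have T: "borel n (U ?p) \<and> braid_gen_mat n i (z ?p) * braid_gen_mat n i (z (Suc ?p)) =
        U ?p * braid_gen_mat n i (z' ?p) \<longleftrightarrow> ?T"
      using trivalent_iff[OF i, of "U ?p" "z ?p" "z (Suc ?p)" "z' ?p"]
      by (auto simp: step_corner_def vertex_corner_def Trivalent)
    have "step_relations n s z z' U \<longleftrightarrow>
        (\<forall>k<length ?r. z (?p + 2 + k) = z' (?p + 1 + k)) \<and> slides n ?l z z' U \<and>
        borel n (U ?p) \<and> braid_gen_mat n i (z ?p) * braid_gen_mat n i (z (Suc ?p)) =
          U ?p * braid_gen_mat n i (z' ?p)"
      by (subst step_relations_has_U[OF _ U])
        (auto simp: Trivalent Let_def braid_mat_pair[simplified] dest: slides_borel)
    also have "\<dots> \<longleftrightarrow> (\<forall>k<length ?r. z (?p + 2 + k) = z' (?p + 1 + k)) \<and>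
        (\<forall>q\<le>?p. U q = lift_mats n s ?t z' q) \<and> (\<forall>k<?p. z k = lift_left n s ?t z' k) \<and> ?T"
      unfolding T using T slide t by auto
    also have "\<dots> \<longleftrightarrow> (\<forall>k<length ?r. z (?p + 2 + k) = z' (?p + 1 + k)) \<and>
        (\<forall>q\<le>?p. U q = lift_mats n s ?t z' q) \<and> (\<forall>k<?p. z k = lift_left n s ?t z' k) \<and>
        z ?p \<noteq> 0 \<and> z (Suc ?p) = z' ?p - 1 / z ?p"
      using corner t by auto
    also have "\<dots> \<longleftrightarrow> z ?p \<noteq> 0 \<and> z = lift_vars n s ?t z' \<and> (\<forall>q\<le>?p. U q = lift_mats n s ?t z' q)"
      unfolding lifted
      by (auto simp: step_source_def Trivalent less[where m = 2, simplified] all2 lift_vars_def Let_def t)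
    finally show ?thesis using t by (simp add: Let_def generic_def Trivalent)
  next
    case (Cup i)
    have i: "1 \<le> i" "i < n" using src Cup by auto
    have t: "?t = z (Suc ?p)" by (simp add: step_param_index_def Cup)
    let ?T = "z ?p = 0 \<and> U ?p = step_corner n s (z (Suc ?p)) z'"
    have T: "borel n (U ?p) \<and> braid_gen_mat n i (z ?p) * braid_gen_mat n i (z (Suc ?p)) = U ?p \<longleftrightarrow> ?T"
      using cup_iff[OF i, of "z ?p" "z (Suc ?p)"]
      by (auto simp: step_corner_def vertex_corner_def Cup)
    have "step_relations n s z z' U \<longleftrightarrow>
        (\<forall>k<length ?r. z (?p + 2 + k) = z' (?p + k)) \<and> slides n ?l z z' U \<and>
        borel n (U ?p) \<and> braid_gen_mat n i (z ?p) * braid_gen_mat n i (z (Suc ?p)) = U ?p"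
      using U[of ?p]
      by (subst step_relations_has_U[OF _ U])
        (auto simp: Cup Let_def braid_mat_pair[simplified] dest: slides_borel)
    also have "\<dots> \<longleftrightarrow> (\<forall>k<length ?r. z (?p + 2 + k) = z' (?p + k)) \<and>
        (\<forall>q\<le>?p. U q = lift_mats n s ?t z' q) \<and> (\<forall>k<?p. z k = lift_left n s ?t z' k) \<and> ?T"
      unfolding T using T slide t by auto
    also have "\<dots> \<longleftrightarrow> (\<forall>k<length ?r. z (?p + 2 + k) = z' (?p + k)) \<and>
        (\<forall>q\<le>?p. U q = lift_mats n s ?t z' q) \<and> (\<forall>k<?p. z k = lift_left n s ?t z' k) \<and> z ?p = 0"
      using corner t by auto
    also have "\<dots> \<longleftrightarrow> z = lift_vars n s ?t z' \<and> (\<forall>q\<le>?p. U q = lift_mats n s ?t z' q)"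
      unfolding lifted
      by (auto simp: step_source_def Cup less[where m = 2, simplified] all2 lift_vars_def Let_def t)
    finally show ?thesis by (simp add: Let_def generic_def Cup)
  next
    case (Hexavalent i j)
    have ij: "1 \<le> i" "i < n" "1 \<le> j" "j < n" "j = i + 1 \<or> i = j + 1"
      using src s Hexavalent by auto
    let ?T = "z ?p = z' (?p + 2) \<and> z (?p + 2) = z' ?p \<and> z (?p + 1) =
      (if i < j then z' (?p + 1) + z' ?p * z' (?p + 2) else z' (?p + 1) - z' ?p * z' (?p + 2))"
    (* For i = j + 1 the roles of the two sides are exchanged, hence the other sign in ?T. *)
    have T: "braid_mat n [i, j, i] (\<lambda>k. z (?p + k)) = braid_mat n [j, i, j] (\<lambda>k. z' (?p + k)) \<longleftrightarrow> ?T"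
    proof (cases "i < j")
      case True
      then have j: "j = Suc i" using ij by simp
      show ?thesis unfolding j braid_mat_triple
        by (subst hexavalent_iff) (use ij j in auto)
    next
      case False
      then have j: "i = Suc j" using ij by simp
      show ?thesis unfolding j braid_mat_triple
        by (subst eq_commute, subst hexavalent_iff) (use ij j in auto)
    qed
    have "step_relations n s z z' U \<longleftrightarrow> (\<forall>k<length ?r. z (?p + 3 + k) = z' (?p + 3 + k)) \<and>
        ?T \<and> (\<forall>k<?p. z k = z' k)"
      unfolding step_relations_def Let_def T[symmetric]
      using Hexavalent by (simp add: numeral_3_eq_3)
    also have "\<dots> \<longleftrightarrow> z = lift_vars n s ?t z'"
    proof -
      have len: "length (step_source s) = ?p + (3 + length ?r)"
        by (simp add: step_source_def Hexavalent)
      have v: "lift_vars n s ?t z' ?p = z' (?p + 2)"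
        "lift_vars n s ?t z' (?p + 1) =
          (if i < j then z' (?p + 1) + z' ?p * z' (?p + 2) else z' (?p + 1) - z' ?p * z' (?p + 2))"
        "lift_vars n s ?t z' (?p + 2) = z' ?p" "\<And>k. lift_vars n s ?t z' (?p + 3 + k) = z' (?p + 3 + k)"
        by (simp_all add: lift_vars_def Hexavalent Let_def)
      have "lift_vars n s ?t z' k = z' k" if "k < ?p" for k
        using that by (simp add: lift_vars_def Hexavalent)
      then have v': "(\<forall>k<?p. z k = lift_vars n s ?t z' k) \<longleftrightarrow> (\<forall>k<?p. z k = z' k)"
        by simp
      show ?thesis unfolding lifted len less all3 v v' add_0_right Suc_eq_plus1 add_0_left
        by (intro iffI conjI; elim conjE; assumption)
    qed
    finally show ?thesis by (simp add: Let_def generic_def Hexavalent)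
  next
    case (Tetravalent i j)
    have ij: "1 \<le> i" "i < n" "1 \<le> j" "j < n" "Suc i < j \<or> Suc j < i"
      using src s Tetravalent by auto
    let ?T = "z ?p = z' (?p + 1) \<and> z (?p + 1) = z' ?p"
    have T: "braid_mat n [i, j] (\<lambda>k. z (?p + k)) = braid_mat n [j, i] (\<lambda>k. z' (?p + k)) \<longleftrightarrow> ?T"
      unfolding braid_mat_pair tetravalent_iff[OF ij] by auto
    have "step_relations n s z z' U \<longleftrightarrow> (\<forall>k<length ?r. z (?p + 2 + k) = z' (?p + 2 + k)) \<and>
        ?T \<and> (\<forall>k<?p. z k = z' k)"
      unfolding step_relations_def Let_def T[symmetric]
      using Tetravalent by (simp add: numeral_2_eq_2)
    also have "\<dots> \<longleftrightarrow> z = lift_vars n s ?t z'"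
    proof -
      have len: "length (step_source s) = ?p + (2 + length ?r)"
        by (simp add: step_source_def Tetravalent)
      have v: "lift_vars n s ?t z' ?p = z' (?p + 1)" "lift_vars n s ?t z' (?p + 1) = z' ?p"
        "\<And>k. lift_vars n s ?t z' (?p + 2 + k) = z' (?p + 2 + k)"
        by (simp_all add: lift_vars_def Tetravalent Let_def)
      have "lift_vars n s ?t z' k = z' k" if "k < ?p" for k
        using that by (simp add: lift_vars_def Tetravalent)
      then have v': "(\<forall>k<?p. z k = lift_vars n s ?t z' k) \<longleftrightarrow> (\<forall>k<?p. z k = z' k)"
        by simp
      show ?thesis unfolding lifted len less all2 v v' add_0_right Suc_eq_plus1 add_0_left
        by (intro iffI conjI; elim conjE; assumption)
    qed
    finally show ?thesis by (simp add: Let_def generic_def Tetravalent)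
  qed
qed

section \<open>The correspondence of a single step\<close>

text \<open>The relation between the variables above and below a step, with its matrices eliminated.\<close>

definition step_related :: "nat \<Rightarrow> step \<Rightarrow> (nat \<Rightarrow> complex) \<Rightarrow> (nat \<Rightarrow> complex) \<Rightarrow> bool" where
  "step_related n s z z' \<longleftrightarrow> z \<in> affine_space {..<length (step_source s)} \<and>
     z' \<in> affine_space {..<length (step_target s)} \<and>
     (\<exists>U. (\<forall>q. U q \<in> carrier_mat n n) \<and> step_relations n s z z' U)"

definition valid_step :: "nat \<Rightarrow> step \<Rightarrow> bool" where
  "valid_step n s \<longleftrightarrow> valid_vertex (vertex_of s) \<and> braid_word n (step_source s)"

lemma valid_step_target: "valid_step n s \<Longrightarrow> braid_word n (step_target s)"
  by (cases "vertex_of s") (auto simp: valid_step_def step_source_def step_target_def)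

text \<open>The part of the variety of the source on which a step is defined, see \<open>step_related_locus\<close> and
  \<open>step_related_exists\<close>.\<close>

definition step_locus :: "step \<Rightarrow> (nat \<Rightarrow> complex) \<Rightarrow> bool" where
  "step_locus s z \<longleftrightarrow> (is_trivalent (vertex_of s) \<longrightarrow> z (length (left_word s)) \<noteq> 0) \<and>
     (is_cup (vertex_of s) \<longrightarrow> z (length (left_word s)) = 0)"

lemma step_related_locus:
  assumes "valid_step n s" "step_related n s z z'"
  shows "step_locus s z"
proof -
  obtain U where U: "\<forall>q. U q \<in> carrier_mat n n" "step_relations n s z z' U"
    and z: "z \<in> affine_space {..<length (step_source s)}"
      "z' \<in> affine_space {..<length (step_target s)}"
    using assms(2) by (auto simp: step_related_def)
  let ?t = "z (step_param_index s)"
  have "step_relations n s z z' U \<longleftrightarrow>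
    (let t = ?t in generic s t \<and> z = lift_vars n s t z' \<and>
       (has_U s \<longrightarrow> (\<forall>q\<le>length (left_word s). U q = lift_mats n s t z' q)))"
    by (rule step_lift_iff) (use assms(1) z U(1) in \<open>auto simp: valid_step_def\<close>)
  then have g: "generic s ?t" "z = lift_vars n s ?t z'" using U(2) by (simp_all add: Let_def)
  show ?thesis
  proof (cases "vertex_of s")
    case (Trivalent i)
    then show ?thesis using g(1) by (simp add: step_locus_def generic_def step_param_index_def)
  next
    case (Cup i)
    have "lift_vars n s ?t z' (length (left_word s)) = 0" by (simp add: lift_vars_def Cup Let_def)
    then show ?thesis using g(2) Cup by (simp add: step_locus_def)
  qed (simp_all add: step_locus_def)
qed

lemma braid_mat_split:
  "braid_mat n (l @ u @ r) z = braid_mat n l z * (braid_mat n u (\<lambda>k. z (length l + k)) *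
     braid_mat n r (\<lambda>k. z (length l + length u + k)))"
  by (simp add: braid_mat_append add.assoc)

lemma mult_assoc5:
  fixes A :: "complex mat"
  assumes "A \<in> carrier_mat n n" "B \<in> carrier_mat n n" "C \<in> carrier_mat n n" "D \<in> carrier_mat n n"
  shows "A * (B * C * D) = (A * B) * (C * D)"
proof -
  have BC: "B * C \<in> carrier_mat n n" "C * D \<in> carrier_mat n n" using assms by (auto intro: mult_carrier_mat)
  have "A * (B * C * D) = A * (B * (C * D))"
    by (subst assoc_mult_mat[OF assms(2,3,4)]) simp
  also have "\<dots> = (A * B) * (C * D)"
    by (rule assoc_mult_mat[OF assms(1,2) BC(2), symmetric])
  finally show ?thesis .
qed

text \<open>Write the source as \<open>l u r\<close>. Then \<open>B\<^sub>l B\<^sub>u B\<^sub>r = B\<^sub>l U\<^sub>p B\<^sub>v B\<^sub>r\<close>, and sliding \<open>U\<^sub>p\<close> through \<open>l\<close> turns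
  \<open>B\<^sub>l(z) U\<^sub>p\<close> into \<open>U\<^sub>0 B\<^sub>l(z')\<close>.\<close>

lemma step_related_braid_mat:
  assumes "valid_step n s" "step_related n s z z'"
  shows "\<exists>C. borel n C \<and> braid_mat n (step_source s) z = C * braid_mat n (step_target s) z'"
proof -
  let ?l = "left_word s" and ?r = "right_word s"
  let ?u = "vertex_source (vertex_of s)" and ?v = "vertex_target (vertex_of s)"
  let ?p = "length ?l"
  let ?Bl = "braid_mat n ?l" and ?R = "braid_mat n ?r (\<lambda>k. z' (?p + length ?v + k))"
  let ?Bu = "braid_mat n ?u (\<lambda>k. z (?p + k))" and ?Bv = "braid_mat n ?v (\<lambda>k. z' (?p + k))"
  obtain U where U: "\<forall>q. U q \<in> carrier_mat n n" "step_relations n s z z' U"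
    using assms(2) by (auto simp: step_related_def)
  have l: "braid_word n ?l" using assms(1) by (simp add: valid_step_def step_source_def)
  have "\<forall>k<length ?r. z (?p + length ?u + k) = z' (?p + length ?v + k)"
    using U(2) by (simp add: step_relations_def Let_def)
  then have "braid_mat n ?r (\<lambda>k. z (?p + length ?u + k)) = ?R"
    by (intro braid_mat_cong) simp
  then have src: "braid_mat n (step_source s) z = ?Bl z * (?Bu * ?R)"
    by (simp add: step_source_def braid_mat_split)
  have tgt: "braid_mat n (step_target s) z' = ?Bl z' * (?Bv * ?R)"
    by (simp add: step_target_def braid_mat_split)
  show ?thesis
  proof (cases "has_U s")
    case True
    have "(let p = ?p; u = ?u; v = ?v
      in (\<forall>k<length ?r. z (p + length u + k) = z' (p + length v + k)) \<and>
       slides n ?l z z' U \<and>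
       braid_mat n u (\<lambda>k. z (p + k)) = U p * braid_mat n v (\<lambda>k. z' (p + k)))"
      using step_relations_has_U[OF True, of U n z z'] U by blast
    then have S: "slides n ?l z z' U" "?Bu = U ?p * ?Bv" by (simp_all add: Let_def)
    note c = U(1)[rule_format]
    have "?Bl z * (?Bu * ?R) = ?Bl z * (U ?p * ?Bv * ?R)" using S(2) by simp
    also have "\<dots> = (?Bl z * U ?p) * (?Bv * ?R)" by (rule mult_assoc5) (use c in auto)
    also have "\<dots> = (U 0 * ?Bl z') * (?Bv * ?R)" using slides_product[OF l S(1)] by simp
    also have "\<dots> = U 0 * (?Bl z' * (?Bv * ?R))"
      by (rule assoc_mult_mat[of _ n n _ n _ n]) (use c in \<open>auto intro: mult_carrier_mat\<close>)
    finally have "braid_mat n (step_source s) z = U 0 * braid_mat n (step_target s) z'"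
      unfolding src tgt .
    then show ?thesis using slides_borel[OF S(1), of 0] by blast
  next
    case False
    then have "?Bu = ?Bv" "\<forall>k<?p. z k = z' k" using U(2) by (simp_all add: step_relations_def Let_def)
    moreover from this(2) have "?Bl z = ?Bl z'" by (intro braid_mat_cong) simp
    ultimately have "braid_mat n (step_source s) z = 1\<^sub>m n * braid_mat n (step_target s) z'"
      unfolding src tgt using left_mult_one_mat[OF braid_mat_carrier[of n "step_target s" z']]
      unfolding tgt by simp
    moreover have "borel n (1\<^sub>m n)" by (auto simp: borel_def)
    ultimately show ?thesis by blast
  qed
qed

lemma step_related_X0:
  assumes "valid_step n s" "step_related n s z z'"
  shows "z \<in> X0 n (step_source s) \<pi> \<longleftrightarrow> z' \<in> X0 n (step_target s) \<pi>"
proof -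
  let ?S = "braid_mat n (step_source s) z" and ?T = "braid_mat n (step_target s) z'"
  let ?P = "perm_mat n \<pi>"
  obtain C where C: "borel n C" "?S = C * ?T"
    using step_related_braid_mat[OF assms] by blast
  have P: "?P \<in> carrier_mat n n" by (simp add: perm_mat_def)
  have "?S * ?P = C * (?T * ?P)"
    unfolding C(2) by (rule assoc_mult_mat[OF borelD(1)[OF C(1)] braid_mat_carrier P])
  then have "upper_triangular (?S * ?P) \<longleftrightarrow> upper_triangular (?T * ?P)"
    using upper_triangular_borel_mult[OF C(1) mult_carrier_mat[OF braid_mat_carrier P]] by simp
  then show ?thesis using assms(2) by (simp add: X0_def step_related_def)
qed

lemma step_related_unique:
  assumes s: "valid_step n s" and r: "step_related n s z z'" "step_related n s z z''"
  shows "z' = z''"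
proof -
  let ?l = "left_word s" and ?r = "right_word s"
  let ?u = "vertex_source (vertex_of s)" and ?v = "vertex_target (vertex_of s)"
  let ?p = "length ?l"
  have l: "braid_word n ?l" and u: "braid_word n ?u"
    using s by (simp_all add: valid_step_def step_source_def)
  obtain U where U: "\<forall>q. U q \<in> carrier_mat n n" "step_relations n s z z' U"
    using r(1) by (auto simp: step_related_def)
  obtain V where V: "\<forall>q. V q \<in> carrier_mat n n" "step_relations n s z z'' V"
    using r(2) by (auto simp: step_related_def)
  have right: "z' (?p + length ?v + k) = z'' (?p + length ?v + k)" if "k < length ?r" for k
    using U(2) V(2) that by (simp add: step_relations_def Let_def)
  have main: "(\<forall>k<?p. z' k = z'' k) \<and> (\<forall>k<length ?v. z' (?p + k) = z'' (?p + k))"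
  proof (cases "has_U s")
    case True
    have US: "slides n ?l z z' U"
      "braid_mat n ?u (\<lambda>k. z (?p + k)) = U ?p * braid_mat n ?v (\<lambda>k. z' (?p + k))"
      using step_relations_has_U[OF True, of U n z z'] U by (auto simp: Let_def)
    have VS: "slides n ?l z z'' V"
      "braid_mat n ?u (\<lambda>k. z (?p + k)) = V ?p * braid_mat n ?v (\<lambda>k. z'' (?p + k))"
      using step_relations_has_U[OF True, of V n z z''] V by (auto simp: Let_def)
    have b: "borel n (U ?p)" "borel n (V ?p)" using US VS slides_borel by auto
    have "U ?p = V ?p \<and> (\<forall>k<length ?v. z' (?p + k) = z'' (?p + k))"
    proof (cases "vertex_of s")
      case (Trivalent i)
      have i: "1 \<le> i" "i < n" using u Trivalent by auto
      have "U ?p * braid_gen_mat n i (z' ?p) = V ?p * braid_gen_mat n i (z'' ?p)"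
        using US(2) VS(2) Trivalent by simp
      then show ?thesis using borel_strip_right_unique[OF i b] Trivalent by simp
    next
      case (Cup i)
      have "U ?p * 1\<^sub>m n = V ?p * 1\<^sub>m n" using US(2) VS(2) Cup by simp
      then show ?thesis using borelD(1)[OF b(1)] borelD(1)[OF b(2)] Cup by simp
    qed (use True in \<open>simp_all add: has_U_def\<close>)
    then show ?thesis using slides_down_unique[OF l US(1) VS(1)] by blast
  next
    case False
    have lift: "z = lift_vars n s (z (step_param_index s)) w"
      if "step_related n s z w" for w
    proof -
      obtain W where W: "\<forall>q. W q \<in> carrier_mat n n" "step_relations n s z w W"
        and z: "z \<in> affine_space {..<length (step_source s)}"
          "w \<in> affine_space {..<length (step_target s)}"
        using \<open>step_related n s z w\<close> by (auto simp: step_related_def)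
      have "step_relations n s z w W \<longleftrightarrow>
        (let t = z (step_param_index s) in generic s t \<and> z = lift_vars n s t w \<and>
           (has_U s \<longrightarrow> (\<forall>q\<le>length (left_word s). W q = lift_mats n s t w q)))"
        by (rule step_lift_iff) (use s z W(1) in \<open>auto simp: valid_step_def\<close>)
      then show ?thesis using W(2) by (simp add: Let_def)
    qed
    let ?L = "lift_vars n s (z (step_param_index s))"
    have e: "?L z' k = ?L z'' k" for k using lift[OF r(1)] lift[OF r(2)] by simp
    have left: "z' k = z'' k" if "k < ?p" for k
      using e[of k] that False
      by (cases "vertex_of s") (simp_all add: lift_vars_def Let_def)
    have "\<forall>k<length ?v. z' (?p + k) = z'' (?p + k)"
    proof (cases "vertex_of s")
      case (Hexavalent i j)
      have "z' (?p + 2) = z'' (?p + 2)" "z' ?p = z'' ?p"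
        using e[of ?p] e[of "?p + 2"] by (simp_all add: lift_vars_def Hexavalent Let_def)
      moreover from this have "z' (?p + 1) = z'' (?p + 1)"
        using e[of "?p + 1"] by (simp add: lift_vars_def Hexavalent Let_def split: if_splits)
      ultimately show ?thesis by (simp add: Hexavalent numeral_2_eq_2 All_less_Suc2)
    next
      case (Tetravalent i j)
      have "z' ?p = z'' ?p" "z' (?p + 1) = z'' (?p + 1)"
        using e[of ?p] e[of "?p + 1"] by (simp_all add: lift_vars_def Tetravalent Let_def)
      then show ?thesis by (simp add: Tetravalent All_less_Suc2)
    qed (use False in simp_all)
    then show ?thesis using left by blast
  qed
  have "z' k = z'' k" if "k < length (step_target s)" for k
  proof -
    consider "k < ?p" | "?p \<le> k" "k < ?p + length ?v" | "?p + length ?v \<le> k" by linarith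
    then show ?thesis
    proof cases
      case 2
      then show ?thesis using conjunct2[OF main, rule_format, of "k - ?p"] by simp
    next
      case 3
      then show ?thesis using right[of "k - (?p + length ?v)"] that by (simp add: step_target_def)
    qed (use main in simp)
  qed
  then show ?thesis
    using affine_eq_iff[of z' "length (step_target s)" z''] r by (auto simp: step_related_def)
qed

lemma slides_cong:
  assumes "\<And>k. k < length l \<Longrightarrow> z' k = z'' k" "\<And>q. q \<le> length l \<Longrightarrow> U q = V q"
  shows "slides n l z z' U \<longleftrightarrow> slides n l z z'' V"
  using assms by (simp add: slides_def)

lemma step_related_extend:
  assumes s: "valid_step n s" "has_U s" and z: "z \<in> affine_space {..<length (step_source s)}"
    and C: "borel n C" and eq: "braid_mat n (vertex_source (vertex_of s)) (\<lambda>k. z (length (left_word s) + k)) =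
      C * braid_mat n (vertex_target (vertex_of s)) w"
  shows "\<exists>z'. step_related n s z z'"
proof -
  let ?l = "left_word s" and ?r = "right_word s"
  let ?u = "vertex_source (vertex_of s)" and ?v = "vertex_target (vertex_of s)"
  let ?p = "length ?l"
  have l: "braid_word n ?l" using s(1) by (simp add: valid_step_def step_source_def)
  obtain zl U where U: "slides n ?l z zl U" "U ?p = C" using slides_down_exists[OF l C] by blast
  define z' where "z' k = (if k < ?p then zl k else if k < ?p + length ?v then w (k - ?p)
    else z (k - length ?v + length ?u))" for k
  define V where "V q = (if q \<le> ?p then U q else 1\<^sub>m n)" for q
  have V: "V q \<in> carrier_mat n n" for q
    using slides_borel[OF U(1), of q] borelD(1) by (auto simp: V_def)
  have "slides n ?l z z' V"
    using U(1) slides_cong[of ?l z' zl V U n z] by (simp add: z'_def V_def)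
  moreover have "braid_mat n ?v (\<lambda>k. z' (?p + k)) = braid_mat n ?v w"
    by (rule braid_mat_cong) (simp add: z'_def)
  moreover have "z (?p + length ?u + k) = z' (?p + length ?v + k)" for k
    by (simp add: z'_def add.commute add.left_commute)
  ultimately have "step_relations n s z z' V"
    unfolding step_relations_has_U[OF s(2) V] Let_def using eq U(2) by (simp add: V_def)
  moreover have "z' \<in> affine_space {..<length (step_target s)}"
    using z by (auto simp: affine_space_def z'_def step_source_def step_target_def)
  ultimately show ?thesis using z V unfolding step_related_def by blast
qed

text \<open>Vertices without matrices act by a polynomial change of variables whose inverse is the change
  of variables of the reversed vertex.\<close>

lemma lift_vars_reverse:
  assumes "\<not> has_U s"
  shows "\<exists>z'. z = lift_vars n s t z' \<and>
    (z \<in> affine_space {..<length (step_source s)} \<longrightarrow> z' \<in> affine_space {..<length (step_target s)})"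
proof (cases "vertex_of s")
  case (Hexavalent i j)
  let ?p = "length (left_word s)"
  let ?z = "\<lambda>k. if k = ?p then z (?p + 2)
       else if k = ?p + 1 then
         (if i < j then z (?p + 1) - z ?p * z (?p + 2) else z (?p + 1) + z ?p * z (?p + 2))
       else if k = ?p + 2 then z ?p else z k"
  show ?thesis
    by (rule exI[of _ ?z]) (auto simp: fun_eq_iff lift_vars_def Hexavalent Let_def affine_space_def
        step_source_def step_target_def)
next
  case (Tetravalent i j)
  let ?p = "length (left_word s)"
  let ?z = "\<lambda>k. if k = ?p then z (?p + 1) else if k = ?p + 1 then z ?p else z k"
  show ?thesis
    by (rule exI[of _ ?z]) (auto simp: fun_eq_iff lift_vars_def Tetravalent Let_def affine_space_def
        step_source_def step_target_def)
qed (use assms in simp_all)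

lemma step_related_exists:
  assumes s: "valid_step n s" and z: "z \<in> affine_space {..<length (step_source s)}"
    and locus: "step_locus s z"
  shows "\<exists>z'. step_related n s z z'"
proof (cases "has_U s")
  case True
  let ?p = "length (left_word s)"
  have u: "braid_word n (vertex_source (vertex_of s))"
    using s by (simp add: valid_step_def step_source_def)
  show ?thesis
  proof (cases "vertex_of s")
    case (Trivalent i)
    have i: "1 \<le> i" "i < n" using u Trivalent by auto
    let ?a = "z ?p" and ?b = "z (Suc ?p)"
    let ?M = "braid_gen_mat n i ?a * braid_gen_mat n i ?b"
    let ?c = "?b + 1 / ?a"
    let ?C = "strip_right n i ?c ?M"
    have "?a \<noteq> 0" using locus Trivalent by (simp add: step_locus_def)
    then have "borel n ?C" "?M = ?C * braid_gen_mat n i ?c"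
      using trivalent_iff[OF i, of ?C ?a ?b ?c] by auto
    then show ?thesis
      by (intro step_related_extend[OF s True z, of ?C "\<lambda>_. ?c"]) (simp_all add: Trivalent)
  next
    case (Cup i)
    have i: "1 \<le> i" "i < n" using u Cup by auto
    let ?M = "braid_gen_mat n i (z ?p) * braid_gen_mat n i (z (Suc ?p))"
    have b: "borel n ?M" using cup_iff[OF i] locus Cup by (simp add: step_locus_def)
    show ?thesis
      by (rule step_related_extend[OF s True z b, of "\<lambda>_. 0"])
        (use borelD(1)[OF b] in \<open>simp add: Cup\<close>)
  qed (use True in \<open>simp_all add: has_U_def\<close>)
next
  case False
  let ?t = "z (step_param_index s)"
  obtain z' where z': "z = lift_vars n s ?t z'" "z' \<in> affine_space {..<length (step_target s)}"
    using lift_vars_reverse[OF False, of z n ?t] z by blast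
  have "step_relations n s z z' (\<lambda>_. 1\<^sub>m n) \<longleftrightarrow>
    (let t = ?t in generic s t \<and> z = lift_vars n s t z' \<and>
       (has_U s \<longrightarrow> (\<forall>q\<le>length (left_word s). 1\<^sub>m n = lift_mats n s t z' q)))"
    by (rule step_lift_iff) (use s z z' in \<open>auto simp: valid_step_def\<close>)
  moreover have "generic s ?t" using False by (simp add: generic_def has_U_def)
  ultimately have "step_relations n s z z' (\<lambda>_. 1\<^sub>m n)" using z'(1) False by (simp add: Let_def)
  then show ?thesis using z z'(2) unfolding step_related_def
    by (intro exI[of _ z'] conjI exI[of _ "\<lambda>_. 1\<^sub>m n"]) auto
qed

section \<open>Normal forms of braid words\<close>

definition braid_move :: "word \<Rightarrow> word \<Rightarrow> bool" where
  "braid_move u v \<longleftrightarrow>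
     (\<exists>s. valid_vertex (vertex_of s) \<and> \<not> has_U s \<and> step_source s = u \<and> step_target s = v)"

lemma braid_move_context: "braid_move u v \<Longrightarrow> braid_move (a @ u @ b) (a @ v @ b)"
proof -
  assume "braid_move u v"
  then obtain s where s: "valid_vertex (vertex_of s)" "\<not> has_U s" "step_source s = u" "step_target s = v"
    by (auto simp: braid_move_def)
  then show ?thesis unfolding braid_move_def
    by (intro exI[of _ "Step (a @ left_word s) (vertex_of s) (right_word s @ b)"])
      (auto simp: has_U_def step_source_def step_target_def)
qed

lemma braid_moves_context: "braid_move\<^sup>*\<^sup>* u v \<Longrightarrow> braid_move\<^sup>*\<^sup>* (a @ u @ b) (a @ v @ b)"
proof (induction rule: rtranclp_induct)
  case base
  show ?case by simp
next
  case (step v w)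
  then show ?case using braid_move_context[of v w a b] by (meson rtranclp.rtrancl_into_rtrancl)
qed

lemma braid_moves_Cons: "braid_move\<^sup>*\<^sup>* u v \<Longrightarrow> braid_move\<^sup>*\<^sup>* (j # u) (j # v)"
  using braid_moves_context[of u v "[j]" "[]"] by simp

lemma braid_moves_append: "braid_move\<^sup>*\<^sup>* u v \<Longrightarrow> braid_move\<^sup>*\<^sup>* (u @ b) (v @ b)"
  using braid_moves_context[of u v "[]" b] by simp

lemma braid_move_commute: "Suc i < j \<or> Suc j < i \<Longrightarrow> braid_move [i, j] [j, i]"
  unfolding braid_move_def
  by (intro exI[of _ "Step [] (Tetravalent i j) []"]) (auto simp: step_source_def step_target_def)

lemma braid_move_braid: "j = Suc i \<or> i = Suc j \<Longrightarrow> braid_move [i, j, i] [j, i, j]"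
  unfolding braid_move_def
  by (intro exI[of _ "Step [] (Hexavalent i j) []"]) (auto simp: step_source_def step_target_def)

lemma braid_moves_commute_past:
  "(\<And>x. x \<in> set l \<Longrightarrow> Suc j < x \<or> Suc x < j) \<Longrightarrow> braid_move\<^sup>*\<^sup>* (j # l) (l @ [j])"
proof (induction l)
  case Nil
  show ?case by simp
next
  case (Cons x l)
  have "braid_move (j # x # l) (x # j # l)"
    using braid_move_context[OF braid_move_commute[of j x], of "[]" l] Cons.prems by simp
  moreover have "braid_move\<^sup>*\<^sup>* (x # j # l) (x # l @ [j])"
    using braid_moves_Cons[OF Cons.IH] Cons.prems by simp
  ultimately show ?case by simp
qed

text \<open>For \<open>k < j \<le> m\<close> one has \<open>\<sigma>\<^sub>j (\<sigma>\<^sub>k \<cdots> \<sigma>\<^sub>m) = (\<sigma>\<^sub>k \<cdots> \<sigma>\<^sub>m) \<sigma>\<^bsub>j-1\<^esub>\<close>: the letter \<open>j\<close> commutes past \<open>k, \<dots>, j-2\<close>,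
  the braid relation turns \<open>j, j-1, j\<close> into \<open>j-1, j, j-1\<close>, and the last letter commutes past
  \<open>j+1, \<dots>, m\<close>.\<close>

lemma braid_moves_through_run:
  assumes "k < j" "j \<le> m"
  shows "braid_move\<^sup>*\<^sup>* (j # [k..<Suc m]) ([k..<Suc m] @ [j - 1])"
proof -
  obtain i where i: "j = Suc i" using assms by (cases j) auto
  let ?a = "[k..<i]" and ?b = "[Suc j..<Suc m]"
  have run: "[k..<Suc m] = ?a @ [i, j] @ ?b"
  proof -
    have "[k..<Suc m] = [k..<i] @ [i..<Suc m]"
      using upt_add_eq_append[of k i "Suc m - i"] assms i by simp
    also have "[i..<Suc m] = i # j # ?b" using assms i by (simp add: upt_conv_Cons del: upt_Suc)
    finally show ?thesis by simp
  qed
  have "braid_move\<^sup>*\<^sup>* (j # ?a) (?a @ [j])"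
    by (rule braid_moves_commute_past) (use i in auto)
  then have "braid_move\<^sup>*\<^sup>* (j # [k..<Suc m]) (?a @ [j, i, j] @ ?b)"
    using braid_moves_append[of "j # ?a" "?a @ [j]" "[i, j] @ ?b"] unfolding run by simp
  also have "braid_move (?a @ [j, i, j] @ ?b) (?a @ [i, j, i] @ ?b)"
    by (rule braid_move_context) (use braid_move_braid i in blast)
  also have "braid_move\<^sup>*\<^sup>* (?a @ [i, j, i] @ ?b) ((?a @ [i, j]) @ (?b @ [i]))"
  proof -
    have "braid_move\<^sup>*\<^sup>* (i # ?b) (?b @ [i])"
      by (rule braid_moves_commute_past) (use i in auto)
    then show ?thesis using braid_moves_context[of "i # ?b" "?b @ [i]" "?a @ [i, j]" "[]"] by simp
  qed
  also have "(?a @ [i, j]) @ (?b @ [i]) = [k..<Suc m] @ [j - 1]" unfolding run using i by simp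
  finally show ?thesis .
qed

definition has_square :: "word \<Rightarrow> bool" where
  "has_square u \<longleftrightarrow> (\<exists>l i r. u = l @ [i, i] @ r)"

lemma has_square_context: "has_square u \<Longrightarrow> has_square (a @ u @ b)"
  unfolding has_square_def by (metis append.assoc)

text \<open>The runs \<open>\<sigma>\<^sub>k \<cdots> \<sigma>\<^sub>m\<close> represent the cosets of \<open>S\<^sub>m\<close> in \<open>S\<^bsub>m+1\<^esub>\<close>. Multiplying a run by a
  further letter on the left either keeps it and moves a letter to its right end
  (\<open>j < k - 1\<close> or \<open>j > k\<close>), or lengthens it (\<open>j = k - 1\<close>), or creates a square (\<open>j = k\<close>).\<close>

lemma peel_run:
  assumes "braid_word (Suc m) u"
  shows "\<exists>u'. braid_move\<^sup>*\<^sup>* u u' \<and>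
    (has_square u' \<or> (\<exists>k v. 1 \<le> k \<and> k \<le> Suc m \<and> braid_word m v \<and> u' = [k..<Suc m] @ v))"
  using assms
proof (induction u)
  case Nil
  have "[] = [Suc m..<Suc m] @ ([] :: nat list)" by simp
  then show ?case
    by (intro exI[of _ "[]"] conjI disjI2 exI[of _ "Suc m"] exI[of _ "[]"]) auto
next
  case (Cons j u)
  have j: "1 \<le> j" "j \<le> m" using Cons.prems by auto
  obtain u' where u': "braid_move\<^sup>*\<^sup>* (j # u) (j # u')" and
    alt: "has_square u' \<or> (\<exists>k v. 1 \<le> k \<and> k \<le> Suc m \<and> braid_word m v \<and> u' = [k..<Suc m] @ v)"
    using Cons.IH Cons.prems braid_moves_Cons by auto
  show ?case
  proof (cases "has_square u'")
    case True
    then have "has_square (j # u')" using has_square_context[of u' "[j]" "[]"] by simp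
    then show ?thesis using u' by blast
  next
    case False
    then obtain k v where k: "1 \<le> k" "k \<le> Suc m" and v: "braid_word m v" "u' = [k..<Suc m] @ v"
      using alt by blast
    have reached: ?thesis if "braid_move\<^sup>*\<^sup>* (j # u') ([k'..<Suc m] @ v')"
      "1 \<le> k'" "k' \<le> Suc m" "braid_word m v'" for k' v'
      using rtranclp_trans[OF u' that(1)] that(2-4) by blast
    consider "Suc j < k" | "Suc j = k" | "j = k" | "k < j" by linarith
    then show ?thesis
    proof cases
      case 1
      have "braid_move\<^sup>*\<^sup>* (j # [k..<Suc m]) ([k..<Suc m] @ [j])"
        by (rule braid_moves_commute_past) (use 1 in auto)
      from braid_moves_append[OF this, of v]
      have "braid_move\<^sup>*\<^sup>* (j # u') ([k..<Suc m] @ (j # v))" using v by simp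
      then show ?thesis by (rule reached) (use v j 1 k in auto)
    next
      case 2
      then have "j # u' = [j..<Suc m] @ v" using v j by (simp add: upt_conv_Cons del: upt_Suc)
      then have "braid_move\<^sup>*\<^sup>* (j # u') ([j..<Suc m] @ v)"
        by (simp only: rtranclp.rtrancl_refl)
      then show ?thesis by (rule reached) (use j v in auto)
    next
      case 3
      then have "j # u' = [] @ [j, j] @ ([Suc k..<Suc m] @ v)"
        using v j by (simp add: upt_conv_Cons del: upt_Suc)
      then have "has_square (j # u')" unfolding has_square_def by blast
      then show ?thesis using u' by blast
    next
      case 4
      have "braid_move\<^sup>*\<^sup>* (j # u') ([k..<Suc m] @ ((j - 1) # v))"
        using braid_moves_append[OF braid_moves_through_run[of k j m], of v] 4 j v by simp
      then show ?thesis by (rule reached) (use v j 4 k in auto)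
    qed
  qed
qed

text \<open>The normal form of a reduced word: a run for each of the inclusions
  \<open>S\<^sub>1 \<subset> S\<^sub>2 \<subset> \<cdots> \<subset> S\<^sub>m\<close>, the longest first. The half twist consists of the runs with \<open>k = 1\<close>.\<close>

inductive coset_normal :: "nat \<Rightarrow> word \<Rightarrow> bool" where
  zero: "coset_normal 0 []"
| run: "coset_normal m v \<Longrightarrow> 1 \<le> k \<Longrightarrow> k \<le> Suc m \<Longrightarrow> coset_normal (Suc m) ([k..<Suc m] @ v)"

lemma coset_normal_braid_word: "coset_normal m u \<Longrightarrow> braid_word m u"
  by (induction rule: coset_normal.induct) (auto simp: braid_word_def)

lemma coset_normal_half_twist: "coset_normal m (half_twist m)"
  by (induction m) (auto intro: coset_normal.intros simp del: upt_Suc)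

lemma braid_word_normalise:
  assumes "braid_word m u"
  shows "\<exists>u'. braid_move\<^sup>*\<^sup>* u u' \<and> (has_square u' \<or> coset_normal m u')"
  using assms
proof (induction m arbitrary: u)
  case 0
  then have "u = []" by (auto simp: braid_word_def)
  then show ?case using coset_normal.zero by blast
next
  case (Suc m)
  obtain u' where u': "braid_move\<^sup>*\<^sup>* u u'" and alt: "has_square u' \<or>
      (\<exists>k v. 1 \<le> k \<and> k \<le> Suc m \<and> braid_word m v \<and> u' = [k..<Suc m] @ v)"
    using peel_run[OF Suc.prems] by blast
  show ?case
  proof (cases "has_square u'")
    case True
    then show ?thesis using u' by blast
  next
    case False
    then obtain k v where k: "1 \<le> k" "k \<le> Suc m" and v: "braid_word m v" "u' = [k..<Suc m] @ v"
      using alt by blast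
    obtain v' where v': "braid_move\<^sup>*\<^sup>* v v'" "has_square v' \<or> coset_normal m v'"
      using Suc.IH[OF v(1)] by blast
    have "braid_move\<^sup>*\<^sup>* u' ([k..<Suc m] @ v')"
      using braid_moves_context[OF v'(1), of "[k..<Suc m]" "[]"] v(2) by simp
    then have "braid_move\<^sup>*\<^sup>* u ([k..<Suc m] @ v')" using u' by (rule rtranclp_trans[rotated])
    moreover have "has_square ([k..<Suc m] @ v') \<or> coset_normal (Suc m) ([k..<Suc m] @ v')"
      using v'(2) has_square_context[of v' "[k..<Suc m]" "[]"] coset_normal.run[of m v' k] k by auto
    ultimately show ?thesis by blast
  qed
qed

section \<open>The variety of a normal form\<close>

lemma braid_mat_unit_entry:
  assumes "braid_word m v" "m \<le> n" "r < n" "c < n" "m \<le> r \<or> m \<le> c"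
  shows "braid_mat n v z $$ (r, c) = (if r = c then 1 else 0)"
  using assms
proof (induction v arbitrary: z r)
  case Nil
  then show ?case by simp
next
  case (Cons i v)
  then have i: "1 \<le> i" "i < m" "i < n" by auto
  show ?case
    unfolding braid_mat.simps braid_gen_mat_mult_entry[OF i(1,3) braid_mat_carrier Cons.prems(3,4)]
    using Cons i by auto
qed

text \<open>The matrix of the run \<open>\<sigma>\<^sub>k \<cdots> \<sigma>\<^sub>m\<close> moves row \<open>m\<close> to the place \<open>k-1\<close>, shifts the rows in between down
  by one and adds a multiple of row \<open>m\<close> to each of them (rows are counted from 0).\<close>

lemma braid_mat_run_mult_entry:
  assumes "1 \<le> k" "k \<le> Suc m" "Suc m \<le> n" "V \<in> carrier_mat n n" "r < n" "c < n"
  shows "(braid_mat n [k..<Suc m] z * V) $$ (r, c) =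
    (if r = k - 1 then V $$ (m, c)
     else if k \<le> r \<and> r \<le> m then V $$ (r - 1, c) + z (r - k) * V $$ (m, c)
     else V $$ (r, c))"
  using assms(2,1,3-)
proof (induction k arbitrary: z r rule: inc_induct)
  case base
  then show ?case by auto
next
  case (step k)
  let ?P = "braid_mat n [Suc k..<Suc m] (\<lambda>i. z (Suc i))"
  have PV: "?P * V \<in> carrier_mat n n" using step.prems by (auto intro: mult_carrier_mat)
  have "braid_mat n [k..<Suc m] z * V = braid_gen_mat n k (z 0) * ?P * V"
    using step.hyps by (simp add: upt_conv_Cons del: upt_Suc)
  also have "\<dots> = braid_gen_mat n k (z 0) * (?P * V)"
    by (rule assoc_mult_mat[of _ n n _ n _ n]) (use step.prems in auto)
  finally have e: "(braid_mat n [k..<Suc m] z * V) $$ (r, c) =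
    (if r = k - 1 then (?P * V) $$ (k, c)
     else if r = k then (?P * V) $$ (k - 1, c) + z 0 * (?P * V) $$ (k, c)
     else (?P * V) $$ (r, c))"
    using braid_gen_mat_mult_entry[of k n "?P * V" r c "z 0"] PV step.hyps step.prems by simp
  have IH: "(?P * V) $$ (r, c) = 
    (if r = k then V $$ (m, c)
     else if Suc k \<le> r \<and> r \<le> m then V $$ (r - 1, c) + z (Suc (r - Suc k)) * V $$ (m, c)
     else V $$ (r, c))" if "r < n" for r
    using step.IH[of r "\<lambda>i. z (Suc i)"] step.prems that by simp
  have "k < n" "k - 1 < n" using step.hyps step.prems by auto
  then show ?case
    unfolding e IH[OF \<open>k < n\<close>] IH[OF \<open>k - 1 < n\<close>] IH[OF \<open>r < n\<close>]
    using step.hyps step.prems by (auto simp: Suc_diff_Suc)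
qed

text \<open>Multiplication by \<open>w\<^sub>0\<close> on the right reverses the columns, so that \<open>M w\<^sub>0\<close> is upper-triangular
  when \<open>M\<close> vanishes below the antidiagonal. The size \<open>m\<close> of the upper left block under
  consideration is separate from the size of \<open>M\<close>, for inductions along \<open>S\<^sub>1 \<subset> S\<^sub>2 \<subset> \<cdots>\<close> with
  matrices of fixed size.\<close>

definition below_antidiagonal_zero :: "nat \<Rightarrow> complex mat \<Rightarrow> bool" where
  "below_antidiagonal_zero m M \<longleftrightarrow> (\<forall>r<m. \<forall>c<m. m \<le> r + c \<longrightarrow> M $$ (r, c) = 0)"

text \<open>Since \<open>v\<close> does not involve the index \<open>m\<close>, column \<open>m\<close> of the matrix of \<open>\<sigma>\<^sub>k \<cdots> \<sigma>\<^sub>m v\<close> has a 1 in row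
  \<open>k-1\<close> and the variables of the run below it. All entries of this column except the
  topmost one must vanish, so \<open>k = 1\<close> and the run has variables 0. What is left of
  the matrix is the one of \<open>v\<close>, shifted down by one row.\<close>

lemma below_antidiagonal_zero_run:
  assumes k: "1 \<le> k" "k \<le> Suc m" and n: "Suc m \<le> n" and v: "braid_word m v"
  shows "below_antidiagonal_zero (Suc m) (braid_mat n ([k..<Suc m] @ v) z) \<longleftrightarrow>
    k = 1 \<and> (\<forall>r<m. z r = 0) \<and> below_antidiagonal_zero m (braid_mat n v (\<lambda>i. z (m + i)))"
proof -
  let ?V = "braid_mat n v (\<lambda>i. z (length [k..<Suc m] + i))"
  have M: "braid_mat n ([k..<Suc m] @ v) z $$ (r, c) =
    (if r = k - 1 then ?V $$ (m, c)
     else if k \<le> r \<and> r \<le> m then ?V $$ (r - 1, c) + z (r - k) * ?V $$ (m, c)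
     else ?V $$ (r, c))" if "r < n" "c < n" for r c
    unfolding braid_mat_append by (rule braid_mat_run_mult_entry) (use k n that in auto)
  have V: "?V $$ (r, m) = (if r = m then 1 else 0)" "?V $$ (m, r) = (if r = m then 1 else 0)"
    if "r < n" for r
    using braid_mat_unit_entry[OF v] n that by auto
  show ?thesis
  proof (intro iffI conjI)
    assume a: "below_antidiagonal_zero (Suc m) (braid_mat n ([k..<Suc m] @ v) z)"
    show k1: "k = 1"
    proof (rule ccontr)
      assume "k \<noteq> 1"
      then have "braid_mat n ([k..<Suc m] @ v) z $$ (k - 1, m) = 0"
        using a k unfolding below_antidiagonal_zero_def by auto
      then show False using M[of "k - 1" m] V(1)[of m] k n by simp
    qed
    have z0: "z r = 0" if "r < m" for r
    proof -
      have "braid_mat n ([k..<Suc m] @ v) z $$ (Suc r, m) = 0"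
        using a that unfolding below_antidiagonal_zero_def by auto
      then show ?thesis using M[of "Suc r" m] V(1)[of m] V(1)[of r] that n k1 by simp
    qed
    then show "\<forall>r<m. z r = 0" by blast
    show "below_antidiagonal_zero m (braid_mat n v (\<lambda>i. z (m + i)))"
      unfolding below_antidiagonal_zero_def
    proof (intro allI impI)
      fix r c assume rc: "r < m" "c < m" "m \<le> r + c"
      then have "braid_mat n ([k..<Suc m] @ v) z $$ (Suc r, c) = 0"
        using a unfolding below_antidiagonal_zero_def by auto
      then show "braid_mat n v (\<lambda>i. z (m + i)) $$ (r, c) = 0"
        using M[of "Suc r" c] z0[OF rc(1)] rc n k1 by (simp del: upt_Suc)
    qed
  next
    assume a: "k = 1 \<and> (\<forall>r<m. z r = 0) \<and>
        below_antidiagonal_zero m (braid_mat n v (\<lambda>i. z (m + i)))"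
    show "below_antidiagonal_zero (Suc m) (braid_mat n ([k..<Suc m] @ v) z)"
      unfolding below_antidiagonal_zero_def
    proof (intro allI impI)
      fix r c assume rc: "r < Suc m" "c < Suc m" "Suc m \<le> r + c"
      then have r: "1 \<le> r" "r \<le> m" by auto
      have "?V $$ (r - 1, c) = 0"
      proof (cases "c = m")
        case True
        then show ?thesis using V(1)[of "r - 1"] r n by auto
      next
        case False
        have "?V = braid_mat n v (\<lambda>i. z (m + i))" using a by (simp del: upt_Suc)
        moreover have "r - 1 < m" "c < m" "m \<le> (r - 1) + c" using r rc False by auto
        ultimately show ?thesis using a unfolding below_antidiagonal_zero_def by simp
      qed
      moreover have "z (r - k) = 0" using a r by simp
      ultimately show "braid_mat n ([k..<Suc m] @ v) z $$ (r, c) = 0"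
        using M[of r c] r rc n a by simp
    qed
  qed
qed

lemma coset_normal_below_antidiagonal:
  assumes "coset_normal m u" "m \<le> n" "below_antidiagonal_zero m (braid_mat n u z)"
  shows "u = half_twist m \<and> (\<forall>k<length u. z k = 0)"
  using assms
proof (induction arbitrary: z rule: coset_normal.induct)
  case zero
  show ?case by simp
next
  case (run m v k)
  have "k = 1" and z0: "\<forall>r<m. z r = 0"
    and "below_antidiagonal_zero m (braid_mat n v (\<lambda>i. z (m + i)))"
    using below_antidiagonal_zero_run[OF run.hyps(2,3), of n v z] run.prems
      coset_normal_braid_word[OF run.hyps(1)] by auto
  then have "v = half_twist m" and zv: "\<forall>i<length v. z (m + i) = 0"
    using run.IH[of "\<lambda>i. z (m + i)"] run.prems by auto
  have "z i = 0" if "i < m + length v" for i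
    using z0 zv[rule_format, of "i - m"] that by (cases "i < m") auto
  then show ?case using \<open>k = 1\<close> \<open>v = half_twist m\<close> by simp
qed

lemma half_twist_below_antidiagonal:
  "m \<le> n \<Longrightarrow> (\<And>k. z k = 0) \<Longrightarrow> below_antidiagonal_zero m (braid_mat n (half_twist m) z)"
proof (induction m arbitrary: z)
  case 0
  show ?case by (simp add: below_antidiagonal_zero_def)
next
  case (Suc m)
  have "braid_word m (half_twist m)"
    by (rule coset_normal_braid_word[OF coset_normal_half_twist])
  then have "below_antidiagonal_zero (Suc m) (braid_mat n ([1..<Suc m] @ half_twist m) z)"
    using below_antidiagonal_zero_run[of 1 m n "half_twist m" z] Suc.prems
      Suc.IH[of "\<lambda>i. z (m + i)"] by (simp del: upt_Suc)
  then show ?case by (simp only: half_twist.simps)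
qed

lemma upper_triangular_longest_perm:
  assumes M: "M \<in> carrier_mat n n"
  shows "upper_triangular (M * perm_mat n (longest_perm n)) \<longleftrightarrow> below_antidiagonal_zero n M"
proof -
  have P: "perm_mat n (longest_perm n) \<in> carrier_mat n n" by (simp add: perm_mat_def)
  have e: "(M * perm_mat n (longest_perm n)) $$ (r, c) = M $$ (r, n - 1 - c)"
    if "r < n" "c < n" for r c
  proof -
    have "(M * perm_mat n (longest_perm n)) $$ (r, c) =
        (\<Sum>k\<in>{0..<n}. M $$ (r, k) * perm_mat n (longest_perm n) $$ (k, c))"
      using M P that by (simp add: scalar_prod_def index_mult_mat(1))
    also have "\<dots> = M $$ (r, n - 1 - c) * perm_mat n (longest_perm n) $$ (n - 1 - c, c)"
      by (rule sum_eq_one_term) (use that in \<open>auto simp: perm_mat_def longest_perm_def\<close>)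
    also have "\<dots> = M $$ (r, n - 1 - c)"
      using that by (auto simp: perm_mat_def longest_perm_def)
    finally show ?thesis .
  qed
  have "upper_triangular (M * perm_mat n (longest_perm n)) \<longleftrightarrow>
      (\<forall>r<n. \<forall>c<r. M $$ (r, n - 1 - c) = 0)"
    using M e by (auto simp: upper_triangular_def)
  also have "\<dots> \<longleftrightarrow> below_antidiagonal_zero n M"
    unfolding below_antidiagonal_zero_def
  proof (intro iffI allI impI)
    fix r c assume a: "\<forall>r<n. \<forall>c<r. M $$ (r, n - 1 - c) = 0" "r < n" "c < n" "n \<le> r + c"
    have "n - 1 - c < r" "n - 1 - (n - 1 - c) = c" using a by auto
    then show "M $$ (r, c) = 0" using a(1)[rule_format, of r "n - 1 - c"] a(2) by simp
  next
    fix r c assume a: "\<forall>r<n. \<forall>c<n. n \<le> r + c \<longrightarrow> M $$ (r, c) = 0" "r < n" "c < r"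
    have "n - 1 - c < n" "n \<le> r + (n - 1 - c)" using a by auto
    then show "M $$ (r, n - 1 - c) = 0" using a by blast
  qed
  finally show ?thesis .
qed

lemma X0_coset_normal:
  assumes "coset_normal n u"
  shows "X0 n u (longest_perm n) = (if u = half_twist n then {\<lambda>_. 0} else {})"
proof -
  have "X0 n u (longest_perm n) =
      {z \<in> affine_space {..<length u}. below_antidiagonal_zero n (braid_mat n u z)}"
    by (simp add: X0_def upper_triangular_longest_perm)
  also have "\<dots> = (if u = half_twist n then {\<lambda>_. 0} else {})"
  proof -
    have "u = half_twist n \<and> z = (\<lambda>_. 0)"
      if "z \<in> affine_space {..<length u}" "below_antidiagonal_zero n (braid_mat n u z)" for z
    proof -
      have "u = half_twist n" "\<forall>k<length u. z k = 0"
        using coset_normal_below_antidiagonal[OF assms order_refl that(2)] by auto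
      moreover have "z k = 0" if "\<not> k < length u" for k
        using \<open>z \<in> affine_space _\<close> that by (simp add: affine_space_def)
      ultimately show ?thesis by blast
    qed
    moreover have "below_antidiagonal_zero n (braid_mat n (half_twist n) (\<lambda>_. 0))"
      by (rule half_twist_below_antidiagonal) auto
    moreover have "(\<lambda>_. 0) \<in> affine_space {..<length u}" by (simp add: affine_space_def)
    ultimately show ?thesis by auto
  qed
  finally show ?thesis .
qed

section \<open>The correspondence of a weave, step by step\<close>

text \<open>A point of the correspondence of a weave consists of the variables and matrices at its first
  step and a point of the correspondence of the remaining weave, whose steps are numbered anew
  from 0.\<close>

fun raise_coord :: "coord \<Rightarrow> coord" where
  "raise_coord (ZC j k) = ZC (Suc j) k"
| "raise_coord (UC j q r c) = UC (Suc j) q r c"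

definition tail_coords :: "(coord \<Rightarrow> complex) \<Rightarrow> coord \<Rightarrow> complex" where
  "tail_coords x = (\<lambda>i. x (raise_coord i))"

fun cons_coords ::
  "(nat \<Rightarrow> complex) \<Rightarrow> (nat \<Rightarrow> nat \<Rightarrow> nat \<Rightarrow> complex) \<Rightarrow> (coord \<Rightarrow> complex) \<Rightarrow> coord \<Rightarrow> complex" where
  "cons_coords z U x (ZC 0 k) = z k"
| "cons_coords z U x (ZC (Suc j) k) = x (ZC j k)"
| "cons_coords z U x (UC 0 q r c) = U q r c"
| "cons_coords z U x (UC (Suc j) q r c) = x (UC j q r c)"

lemma tail_cons_coords [simp]: "tail_coords (cons_coords z U x) = x"
proof
  fix i show "tail_coords (cons_coords z U x) i = x i" by (cases i) (auto simp: tail_coords_def)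
qed

lemma z_vars_cons [simp]:
  "z_vars (cons_coords z U x) 0 = z" "z_vars (cons_coords z U x) (Suc j) = z_vars x j"
  by (simp_all add: z_vars_def)

lemma U_mat_cons [simp]:
  "U_mat n (cons_coords z U x) 0 q = mat n n (\<lambda>(r, c). U q r c)"
  "U_mat n (cons_coords z U x) (Suc j) = U_mat n x j"
  by (simp_all add: U_mat_def fun_eq_iff)

lemma tail_coords_vars:
  "z_vars (tail_coords x) j = z_vars x (Suc j)" "U_mat n (tail_coords x) j = U_mat n x (Suc j)"
  by (simp_all add: z_vars_def U_mat_def tail_coords_def fun_eq_iff)

lemma cons_coords_eq_iff:
  "x = cons_coords z U x' \<longleftrightarrow>
     z_vars x 0 = z \<and> (\<forall>q r c. x (UC 0 q r c) = U q r c) \<and> tail_coords x = x'"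
proof (intro iffI)
  assume a: "z_vars x 0 = z \<and> (\<forall>q r c. x (UC 0 q r c) = U q r c) \<and> tail_coords x = x'"
  show "x = cons_coords z U x'"
  proof
    fix i show "x i = cons_coords z U x' i"
      using a by (cases "(z, U, x', i)" rule: cons_coords.cases)
        (auto simp: z_vars_def tail_coords_def)
  qed
qed (auto simp: z_vars_def)

lemma weave_words_Nil [simp]: "weave_words (Weave \<beta> []) = [\<beta>]"
  by (simp add: weave_words_def)

lemma weave_words_Cons [simp]:
  "weave_words (Weave \<beta> (s # ss)) = \<beta> # weave_words (Weave (step_target s) ss)"
  by (simp add: weave_words_def)

lemma weave_words_nonempty [simp]: "weave_words w \<noteq> []"
  by (simp add: weave_words_def)

lemma simplifying_weave_Nil:
  "simplifying_weave n (Weave \<beta> []) \<gamma> \<delta> \<longleftrightarrow> \<beta> = \<gamma> \<and> \<gamma> = \<delta> \<and> braid_word n \<gamma>"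
  by (auto simp: simplifying_weave_def)

lemma simplifying_weave_Cons:
  "simplifying_weave n (Weave \<beta> (s # ss)) \<gamma> \<delta> \<longleftrightarrow>
     \<beta> = \<gamma> \<and> valid_step n s \<and> step_source s = \<gamma> \<and>
     simplifying_weave n (Weave (step_target s) ss) (step_target s) \<delta>"
proof -
  have "(\<forall>j<length (s # ss). P ((s # ss) ! j) ((\<beta> # ws) ! j)) \<longleftrightarrow>
      P s \<beta> \<and> (\<forall>j<length ss. P (ss ! j) (ws ! j))" for P :: "step \<Rightarrow> word \<Rightarrow> bool" and ws
    by (simp add: All_less_Suc2)
  from this[of "\<lambda>s w. valid_vertex (vertex_of s) \<and> step_source s = w"
      "weave_words (Weave (step_target s) ss)"]
  show ?thesis unfolding simplifying_weave_def valid_step_def by auto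
qed

lemma demazure_weave_Cons:
  "demazure_weave n (Weave \<beta> (s # ss)) \<gamma> \<delta> \<longleftrightarrow>
     \<beta> = \<gamma> \<and> valid_step n s \<and> step_source s = \<gamma> \<and> \<not> is_cup (vertex_of s) \<and>
     demazure_weave n (Weave (step_target s) ss) (step_target s) \<delta>"
  by (auto simp: demazure_weave_def simplifying_weave_Cons)

lemma correspondence_Nil:
  "x \<in> correspondence n (Weave \<beta> []) \<pi> \<longleftrightarrow>
     x \<in> affine_space {ZC 0 k |k. k < length \<beta>} \<and> z_vars x 0 \<in> X0 n \<beta> \<pi>"
  by (auto simp: correspondence_def X0_def weave_coords_def affine_space_def z_vars_def)

lemma affine_weave_coords_Cons:
  "x \<in> affine_space (weave_coords n (Weave \<beta> (s # ss))) \<longleftrightarrow>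
     z_vars x 0 \<in> affine_space {..<length \<beta>} \<and>
     (\<forall>q r c. \<not> (has_U s \<and> q \<le> length (left_word s) \<and> r < n \<and> c < n) \<longrightarrow> x (UC 0 q r c) = 0) \<and>
     tail_coords x \<in> affine_space (weave_coords n (Weave (step_target s) ss))"
  (is "?L \<longleftrightarrow> ?R")
proof -
  let ?W = "weave_coords n (Weave \<beta> (s # ss))" and ?W' = "weave_coords n (Weave (step_target s) ss)"
  have m: "ZC 0 k \<in> ?W \<longleftrightarrow> k < length \<beta>"
    "UC 0 q r c \<in> ?W \<longleftrightarrow> has_U s \<and> q \<le> length (left_word s) \<and> r < n \<and> c < n"
    for k q r c
    by (auto simp: weave_coords_def)
  have t: "raise_coord i \<in> ?W \<longleftrightarrow> i \<in> ?W'" for i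
    by (cases i) (auto simp: weave_coords_def)
  have all: "(\<forall>i. P i) \<longleftrightarrow> (\<forall>k. P (ZC 0 k)) \<and> (\<forall>q r c. P (UC 0 q r c)) \<and> (\<forall>i. P (raise_coord i))"
    for P
  proof (intro iffI conjI allI)
    fix i assume a: "(\<forall>k. P (ZC 0 k)) \<and> (\<forall>q r c. P (UC 0 q r c)) \<and> (\<forall>i. P (raise_coord i))"
    show "P i"
    proof (cases i)
      case (ZC j k)
      then show ?thesis
        using a conjunct2[OF conjunct2[OF a], rule_format, of "ZC (j - 1) k"] by (cases j) auto
    next
      case (UC j q r c)
      then show ?thesis
        using a conjunct2[OF conjunct2[OF a], rule_format, of "UC (j - 1) q r c"] by (cases j) auto
    qed
  qed auto
  have "?L \<longleftrightarrow> (\<forall>i. i \<notin> ?W \<longrightarrow> x i = 0)" by (simp add: affine_space_def)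
  also have "\<dots> \<longleftrightarrow> ?R"
    unfolding all[of "\<lambda>i. i \<notin> ?W \<longrightarrow> x i = 0"] m t
    by (auto simp: affine_space_def z_vars_def tail_coords_def)
  finally show ?thesis .
qed

lemma correspondence_Cons:
  "x \<in> correspondence n (Weave \<beta> (s # ss)) \<pi> \<longleftrightarrow>
     tail_coords x \<in> correspondence n (Weave (step_target s) ss) \<pi> \<and>
     z_vars x 0 \<in> affine_space {..<length \<beta>} \<and>
     (\<forall>q r c. \<not> (has_U s \<and> q \<le> length (left_word s) \<and> r < n \<and> c < n) \<longrightarrow> x (UC 0 q r c) = 0) \<and>
     step_relations n s (z_vars x 0) (z_vars x (Suc 0)) (U_mat n x 0)"
  unfolding correspondence_def mem_Collect_eq affine_weave_coords_Cons
  by (auto simp: All_less_Suc2 tail_coords_vars)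

lemma correspondence_affine:
  assumes "x \<in> correspondence n (Weave \<beta> ss) \<pi>"
  shows "z_vars x 0 \<in> affine_space {..<length \<beta>}"
proof (cases ss)
  case Nil
  then show ?thesis using assms correspondence_Nil by (simp add: X0_def)
next
  case (Cons s ss')
  then show ?thesis using assms correspondence_Cons by simp
qed

text \<open>Points of the correspondence have coordinate 0 where a step has no matrix, whereas
  \<open>step_related\<close> allows arbitrary matrices there; the relations do not see the difference.\<close>

lemma step_relations_U_cong:
  assumes "\<And>q. q \<le> length (left_word s) \<Longrightarrow> has_U s \<Longrightarrow> U q = V q"
  shows "step_relations n s z z' U \<longleftrightarrow> step_relations n s z z' V"
proof (cases "has_U s")
  case True
  then have "U q = V q" if "q \<le> length (left_word s)" for q using assms that by blast
  then show ?thesis unfolding step_relations_def Let_def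
    by (intro conj_cong refl if_cong all_cong ball_cong imp_cong) auto
next
  case False
  then show ?thesis by (simp add: step_relations_def Let_def)
qed

lemma correspondence_image_Nil: "correspondence_image n (Weave \<beta> []) \<pi> = X0 n \<beta> \<pi>"
proof
  show "correspondence_image n (Weave \<beta> []) \<pi> \<subseteq> X0 n \<beta> \<pi>"
    by (auto simp: correspondence_image_def correspondence_Nil)
  show "X0 n \<beta> \<pi> \<subseteq> correspondence_image n (Weave \<beta> []) \<pi>"
  proof
    fix z assume z: "z \<in> X0 n \<beta> \<pi>"
    let ?x = "\<lambda>i. case i of ZC j k \<Rightarrow> if j = 0 then z k else 0 | UC j q r c \<Rightarrow> 0"
    have v: "z_vars ?x 0 = z" by (simp add: z_vars_def)
    have "?x i = 0" if "i \<notin> {ZC 0 k |k. k < length \<beta>}" for i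
      using z that by (cases i) (auto simp: X0_def affine_space_def)
    then have "?x \<in> affine_space {ZC 0 k |k. k < length \<beta>}" unfolding affine_space_def by blast
    then have x: "?x \<in> correspondence n (Weave \<beta> []) \<pi>" using z v by (simp add: correspondence_Nil)
    show "z \<in> correspondence_image n (Weave \<beta> []) \<pi>"
      unfolding correspondence_image_def by (rule image_eqI[where x = ?x], rule v[symmetric], rule x)
  qed
qed

lemma correspondence_image_Cons:
  "correspondence_image n (Weave (step_source s) (s # ss)) \<pi> =
     {z. \<exists>z'\<in>correspondence_image n (Weave (step_target s) ss) \<pi>. step_related n s z z'}"
proof (intro equalityI subsetI)
  fix z assume "z \<in> correspondence_image n (Weave (step_source s) (s # ss)) \<pi>"
  then obtain x where x: "x \<in> correspondence n (Weave (step_source s) (s # ss)) \<pi>" "z = z_vars x 0"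
    by (auto simp: correspondence_image_def)
  note c = x(1)[unfolded correspondence_Cons]
  have "z_vars x (Suc 0) \<in> affine_space {..<length (step_target s)}"
    unfolding tail_coords_vars(1)[symmetric] by (rule correspondence_affine[OF conjunct1[OF c]])
  moreover have "\<forall>q. U_mat n x 0 q \<in> carrier_mat n n" by (simp add: U_mat_def)
  ultimately have "step_related n s z (z_vars x (Suc 0))"
    unfolding step_related_def using c x(2) by blast
  moreover have "z_vars x (Suc 0) \<in> correspondence_image n (Weave (step_target s) ss) \<pi>"
    unfolding correspondence_image_def tail_coords_vars(1)[symmetric]
    by (rule imageI) (rule conjunct1[OF c])
  ultimately show "z \<in> {z. \<exists>z'\<in>correspondence_image n (Weave (step_target s) ss) \<pi>. step_related n s z z'}"
    by blast
next
  fix z assume "z \<in> {z. \<exists>z'\<in>correspondence_image n (Weave (step_target s) ss) \<pi>. step_related n s z z'}"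
  then obtain x' where x': "x' \<in> correspondence n (Weave (step_target s) ss) \<pi>"
    and "step_related n s z (z_vars x' 0)"
    by (auto simp: correspondence_image_def)
  then obtain U where U: "\<And>q. U q \<in> carrier_mat n n" "step_relations n s z (z_vars x' 0) U"
    and z: "z \<in> affine_space {..<length (step_source s)}"
    by (auto simp: step_related_def)
  let ?u = "\<lambda>q r c. if has_U s \<and> q \<le> length (left_word s) \<and> r < n \<and> c < n then U q $$ (r, c) else 0"
  let ?x = "cons_coords z ?u x'"
  have "U_mat n ?x 0 q = U q" if "q \<le> length (left_word s)" "has_U s" for q
    by (rule eq_matI) (use U(1)[of q] that in auto)
  then have "step_relations n s z (z_vars x' 0) (U_mat n ?x 0)"
    using step_relations_U_cong[of s "U_mat n ?x 0" U n] U(2) by blast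
  then have x: "?x \<in> correspondence n (Weave (step_source s) (s # ss)) \<pi>"
    unfolding correspondence_Cons using x' z by simp
  show "z \<in> correspondence_image n (Weave (step_source s) (s # ss)) \<pi>"
    unfolding correspondence_image_def by (rule image_eqI[where x = ?x], rule z_vars_cons(1)[symmetric], rule x)
qed

section \<open>Decompositions\<close>

definition prepend_step :: "step \<Rightarrow> weave list \<Rightarrow> weave list" where
  "prepend_step s ws = map (\<lambda>w. Weave (step_source s) (s # weave_steps w)) ws"

abbreviation piece :: "nat \<Rightarrow> weave \<Rightarrow> (nat \<Rightarrow> complex) set" where
  "piece n w \<equiv> correspondence_image n w (longest_perm n)"

text \<open>The notion of \<open>decomposes\<close>, for an arbitrary subset of the variety in place of the whole.\<close>

definition partial_decomposition :: "nat \<Rightarrow> word \<Rightarrow> weave list \<Rightarrow> (nat \<Rightarrow> complex) set \<Rightarrow> bool" where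
  "partial_decomposition n \<gamma> ws S \<longleftrightarrow>
     (\<forall>w\<in>set ws. simplifying_weave n w \<gamma> (half_twist n)) \<and>
     (\<forall>i<length ws. \<forall>j<length ws. i \<noteq> j \<longrightarrow> piece n (ws ! i) \<inter> piece n (ws ! j) = {}) \<and>
     (\<Union>w\<in>set ws. piece n w) = S"

lemma decomposes_iff_partial:
  "decomposes n \<gamma> ws \<longleftrightarrow> partial_decomposition n \<gamma> ws (X0 n \<gamma> (longest_perm n))"
  by (simp add: decomposes_def partial_decomposition_def)

lemma simplifying_weave_top: "simplifying_weave n w \<gamma> \<delta> \<Longrightarrow> w = Weave \<gamma> (weave_steps w)"
  by (cases w) (simp add: simplifying_weave_def)

text \<open>The piece of a prolonged weave is the preimage of the piece of the old weave under the partial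
  function given by the new step, and preimages under a partial function of disjoint sets are
  disjoint.\<close>

lemma prepend_step_decomposition:
  assumes s: "valid_step n s" and d: "decomposes n (step_target s) ws"
  shows "partial_decomposition n (step_source s) (prepend_step s ws)
    {z \<in> X0 n (step_source s) (longest_perm n). step_locus s z}"
proof -
  let ?f = "\<lambda>w. Weave (step_source s) (s # weave_steps w)"
  have simp: "simplifying_weave n w (step_target s) (half_twist n)" if "w \<in> set ws" for w
    using d that by (auto simp: decomposes_def)
  have piece: "piece n (?f w) = {z. \<exists>z'\<in>piece n w. step_related n s z z'}" if "w \<in> set ws" for w
    using simplifying_weave_top[OF simp[OF that]] correspondence_image_Cons[of n s "weave_steps w"]
    by metis
  show ?thesis unfolding partial_decomposition_def
  proof (intro conjI ballI allI impI)
    fix w assume "w \<in> set (prepend_step s ws)"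
    then obtain v where v: "v \<in> set ws" "w = ?f v" by (auto simp: prepend_step_def)
    show "simplifying_weave n w (step_source s) (half_twist n)"
      unfolding v(2) simplifying_weave_Cons
      using simp[OF v(1)] simplifying_weave_top[OF simp[OF v(1)]] s by metis
  next
    fix i j assume ij: "i < length (prepend_step s ws)" "j < length (prepend_step s ws)" "i \<noteq> j"
    then have ij': "i < length ws" "j < length ws" by (auto simp: prepend_step_def)
    then have p: "piece n (prepend_step s ws ! k) = {z. \<exists>z'\<in>piece n (ws ! k). step_related n s z z'}"
      if "k \<in> {i, j}" for k
      using piece[of "ws ! k"] that by (auto simp: prepend_step_def)
    have "\<forall>i<length ws. \<forall>j<length ws. i \<noteq> j \<longrightarrow> piece n (ws ! i) \<inter> piece n (ws ! j) = {}"
      using d unfolding decomposes_def by (elim conjE)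
    then have disj: "piece n (ws ! i) \<inter> piece n (ws ! j) = {}" using ij' ij(3) by simp
    show "piece n (prepend_step s ws ! i) \<inter> piece n (prepend_step s ws ! j) = {}"
    proof (rule equals0I)
      fix z assume "z \<in> piece n (prepend_step s ws ! i) \<inter> piece n (prepend_step s ws ! j)"
      then obtain z' z'' where "z' \<in> piece n (ws ! i)" "step_related n s z z'"
        "z'' \<in> piece n (ws ! j)" "step_related n s z z''"
        using p[of i] p[of j] by auto
      then show False using step_related_unique[OF s, of z z' z''] disj by auto
    qed
  next
    have "(\<Union>w\<in>set (prepend_step s ws). piece n w) =
        {z. \<exists>z'\<in>(\<Union>w\<in>set ws. piece n w). step_related n s z z'}"
      using piece by (auto simp: prepend_step_def)
    also have "(\<Union>w\<in>set ws. piece n w) = X0 n (step_target s) (longest_perm n)"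
      using d by (simp add: decomposes_def)
    also have "{z. \<exists>z'\<in>X0 n (step_target s) (longest_perm n). step_related n s z z'} =
        {z \<in> X0 n (step_source s) (longest_perm n). step_locus s z}"
    proof (intro equalityI subsetI)
      fix z assume "z \<in> {z. \<exists>z'\<in>X0 n (step_target s) (longest_perm n). step_related n s z z'}"
      then show "z \<in> {z \<in> X0 n (step_source s) (longest_perm n). step_locus s z}"
        using step_related_X0[OF s] step_related_locus[OF s] by blast
    next
      fix z assume z: "z \<in> {z \<in> X0 n (step_source s) (longest_perm n). step_locus s z}"
      then obtain z' where "step_related n s z z'"
        using step_related_exists[OF s, of z] by (auto simp: X0_def)
      then show "z \<in> {z. \<exists>z'\<in>X0 n (step_target s) (longest_perm n). step_related n s z z'}"
        using step_related_X0[OF s] z by blast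
    qed
    finally show "(\<Union>w\<in>set (prepend_step s ws). piece n w) =
        {z \<in> X0 n (step_source s) (longest_perm n). step_locus s z}" .
  qed
qed

lemma partial_decomposition_append:
  assumes "partial_decomposition n \<gamma> ws S" "partial_decomposition n \<gamma> ws' S'" "S \<inter> S' = {}"
  shows "partial_decomposition n \<gamma> (ws @ ws') (S \<union> S')"
proof -
  have sub: "piece n (ws ! i) \<subseteq> S" if "i < length ws" for i
    using assms(1) nth_mem[OF that] unfolding partial_decomposition_def by blast
  have sub': "piece n (ws' ! i) \<subseteq> S'" if "i < length ws'" for i
    using assms(2) nth_mem[OF that] unfolding partial_decomposition_def by blast
  have dj: "\<forall>i<length ws. \<forall>j<length ws. i \<noteq> j \<longrightarrow> piece n (ws ! i) \<inter> piece n (ws ! j) = {}"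
    using assms(1) unfolding partial_decomposition_def by (elim conjE)
  have dj': "\<forall>i<length ws'. \<forall>j<length ws'. i \<noteq> j \<longrightarrow> piece n (ws' ! i) \<inter> piece n (ws' ! j) = {}"
    using assms(2) unfolding partial_decomposition_def by (elim conjE)
  have cross: "piece n (ws ! i) \<inter> piece n (ws' ! j) = {}" if "i < length ws" "j < length ws'" for i j
    using sub[OF that(1)] sub'[OF that(2)] assms(3) by blast
  have disj: "piece n ((ws @ ws') ! i) \<inter> piece n ((ws @ ws') ! j) = {}"
    if "i < length (ws @ ws')" "j < length (ws @ ws')" "i \<noteq> j" for i j
  proof (cases "i < length ws")
    case i: True
    show ?thesis
    proof (cases "j < length ws")
      case True
      then show ?thesis using dj i that(3) by (simp add: nth_append)
    next
      case False
      then have "j - length ws < length ws'" using that by auto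
      then show ?thesis using cross[OF i] i False by (simp add: nth_append)
    qed
  next
    case i: False
    then have i': "i - length ws < length ws'" using that by auto
    show ?thesis
    proof (cases "j < length ws")
      case True
      then show ?thesis using cross[OF True i'] i by (simp add: nth_append Int_commute)
    next
      case False
      then have "j - length ws < length ws'" "i - length ws \<noteq> j - length ws" using that i by auto
      then show ?thesis using dj' i i' False by (simp add: nth_append)
    qed
  qed
  have "\<forall>w\<in>set (ws @ ws'). simplifying_weave n w \<gamma> (half_twist n)"
    using assms(1,2) unfolding partial_decomposition_def by (simp add: ball_Un)
  moreover have "(\<Union>w\<in>set (ws @ ws'). piece n w) = S \<union> S'"
    using assms(1,2) unfolding partial_decomposition_def by (simp only: set_append UN_Un)
  ultimately show ?thesis using disj unfolding partial_decomposition_def by blast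
qed

lemma decomposes_prepend_no_U:
  assumes "valid_step n s" "\<not> has_U s" "decomposes n (step_target s) ws"
  shows "decomposes n (step_source s) (prepend_step s ws)"
proof -
  have "step_locus s z" for z using assms(2) by (simp add: step_locus_def has_U_def)
  then show ?thesis
    using prepend_step_decomposition[OF assms(1,3)] by (simp add: decomposes_iff_partial)
qed

lemma decomposes_square:
  assumes "braid_word n (l @ [i, i] @ r)"
    and "decomposes n (l @ [i] @ r) ws" and "decomposes n (l @ r) ws'"
  shows "decomposes n (l @ [i, i] @ r)
    (prepend_step (Step l (Trivalent i) r) ws @ prepend_step (Step l (Cup i) r) ws')"
proof -
  let ?s = "Step l (Trivalent i) r" and ?s' = "Step l (Cup i) r"
  have v: "valid_step n ?s" "valid_step n ?s'"
    using assms(1) by (simp_all add: valid_step_def step_source_def)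
  have "partial_decomposition n (l @ [i, i] @ r) (prepend_step ?s ws)
      {z \<in> X0 n (l @ [i, i] @ r) (longest_perm n). z (length l) \<noteq> 0}"
    using prepend_step_decomposition[OF v(1), of ws] assms(2)
    by (simp add: step_source_def step_target_def step_locus_def)
  moreover have "partial_decomposition n (l @ [i, i] @ r) (prepend_step ?s' ws')
      {z \<in> X0 n (l @ [i, i] @ r) (longest_perm n). z (length l) = 0}"
    using prepend_step_decomposition[OF v(2), of ws'] assms(3)
    by (simp add: step_source_def step_target_def step_locus_def)
  ultimately have "partial_decomposition n (l @ [i, i] @ r)
      (prepend_step ?s ws @ prepend_step ?s' ws')
      ({z \<in> X0 n (l @ [i, i] @ r) (longest_perm n). z (length l) \<noteq> 0} \<union>
       {z \<in> X0 n (l @ [i, i] @ r) (longest_perm n). z (length l) = 0})"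
    by (rule partial_decomposition_append) auto
  moreover have "{z \<in> X. z (length l) \<noteq> 0} \<union> {z \<in> X. z (length l) = 0} = X"
    for X :: "(nat \<Rightarrow> complex) set"
    by auto
  ultimately show ?thesis unfolding decomposes_iff_partial by (simp only:)
qed

lemma braid_move_braid_word: "braid_move u v \<Longrightarrow> braid_word n u \<Longrightarrow> braid_word n v"
  unfolding braid_move_def by (metis valid_step_def valid_step_target)

lemma decomposes_braid_move:
  assumes "braid_move u v" "braid_word n u" "\<exists>ws. decomposes n v ws"
  shows "\<exists>ws. decomposes n u ws"
proof -
  obtain s where "valid_vertex (vertex_of s)" "\<not> has_U s" "step_source s = u" "step_target s = v"
    using assms(1) by (auto simp: braid_move_def)
  then show ?thesis
    using assms decomposes_prepend_no_U[of n s] by (auto simp: valid_step_def)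
qed

lemma decomposes_braid_moves:
  assumes "braid_move\<^sup>*\<^sup>* u v" "braid_word n u" "\<exists>ws. decomposes n v ws"
  shows "\<exists>ws. decomposes n u ws"
  using assms
  by (induction rule: converse_rtranclp_induct)
    (auto dest: braid_move_braid_word intro: decomposes_braid_move)

lemma braid_moves_braid_word: "braid_move\<^sup>*\<^sup>* u v \<Longrightarrow> braid_word n u \<Longrightarrow> braid_word n v"
  by (induction rule: rtranclp_induct) (auto dest: braid_move_braid_word)

lemma braid_move_length: "braid_move u v \<Longrightarrow> length u = length v"
proof -
  assume "braid_move u v"
  then obtain s where "\<not> has_U s" "step_source s = u" "step_target s = v"
    by (auto simp: braid_move_def)
  then show ?thesis
    by (cases "vertex_of s") (auto simp: step_source_def step_target_def)
qed

lemma braid_moves_length: "braid_move\<^sup>*\<^sup>* u v \<Longrightarrow> length u = length v"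
  by (induction rule: rtranclp_induct) (auto dest: braid_move_length)

lemma half_twist_braid_word: "braid_word n (half_twist n)"
  by (rule coset_normal_braid_word[OF coset_normal_half_twist])

lemma decomposes_half_twist: "decomposes n (half_twist n) [Weave (half_twist n) []]"
  by (simp add: decomposes_def simplifying_weave_Nil half_twist_braid_word correspondence_image_Nil)

lemma decomposition_exists:
  assumes "braid_word n \<gamma>"
  shows "\<exists>ws. decomposes n \<gamma> ws"
  using assms
proof (induction "length \<gamma>" arbitrary: \<gamma> rule: less_induct)
  case less
  obtain u where u: "braid_move\<^sup>*\<^sup>* \<gamma> u" "has_square u \<or> coset_normal n u"
    using braid_word_normalise[OF less.prems] by blast
  note word = braid_moves_braid_word[OF u(1) less.prems]
  have "\<exists>ws. decomposes n u ws"
  proof (cases "has_square u")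
    case True
    then obtain l i r where lir: "u = l @ [i, i] @ r" by (auto simp: has_square_def)
    have "length \<gamma> = length u" by (rule braid_moves_length[OF u(1)])
    then obtain ws ws' where "decomposes n (l @ [i] @ r) ws" "decomposes n (l @ r) ws'"
      using less.hyps[of "l @ [i] @ r"] less.hyps[of "l @ r"] word lir by auto
    then show ?thesis using decomposes_square word lir by blast
  next
    case False
    then have c: "coset_normal n u" using u(2) by simp
    show ?thesis
    proof (cases "u = half_twist n")
      case True
      then show ?thesis using decomposes_half_twist by blast
    next
      case False
      then have "decomposes n u []" using X0_coset_normal[OF c] by (simp add: decomposes_def)
      then show ?thesis by blast
    qed
  qed
  then show ?case by (rule decomposes_braid_moves[OF u(1) less.prems])
qed

definition has_cup :: "weave \<Rightarrow> bool" where
  "has_cup w \<longleftrightarrow> (\<exists>s\<in>set (weave_steps w). is_cup (vertex_of s))"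

text \<open>The decomposition is built along the given weave, from the bottom upwards. At a trivalent
  vertex, the part of the variety that it misses is covered by weaves starting with a cup.\<close>

lemma demazure_decomposition_exists:
  assumes "demazure_weave n (Weave \<gamma> ss) \<gamma> (half_twist n)"
  shows "\<exists>ws. decomposes n \<gamma> (Weave \<gamma> ss # ws) \<and> (\<forall>w\<in>set ws. has_cup w)"
  using assms
proof (induction ss arbitrary: \<gamma>)
  case Nil
  then have "\<gamma> = half_twist n" by (simp add: demazure_weave_def simplifying_weave_Nil)
  then show ?case using decomposes_half_twist by (intro exI[of _ "[]"]) simp
next
  case (Cons s ss)
  note d = Cons.prems[unfolded demazure_weave_Cons]
  obtain ws where ws: "decomposes n (step_target s) (Weave (step_target s) ss # ws)"
    "\<forall>w\<in>set ws. has_cup w"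
    using Cons.IH[of "step_target s"] d by blast
  have src: "step_source s = \<gamma>" using d by blast
  have pre: "prepend_step s (Weave (step_target s) ss # ws) = Weave \<gamma> (s # ss) # prepend_step s ws"
    using src by (simp add: prepend_step_def)
  have cup: "\<forall>w\<in>set (prepend_step s ws). has_cup w"
    using ws(2) by (auto simp: prepend_step_def has_cup_def)
  show ?case
  proof (cases "has_U s")
    case False
    then have "decomposes n \<gamma> (Weave \<gamma> (s # ss) # prepend_step s ws)"
      using decomposes_prepend_no_U[of n s] ws(1) d pre by metis
    then show ?thesis using cup by blast
  next
    case True
    then obtain i where i: "vertex_of s = Trivalent i"
      using d by (cases "vertex_of s") (auto simp: has_U_def)
    let ?l = "left_word s" and ?r = "right_word s"
    have s: "s = Step ?l (Trivalent i) ?r" using i by (cases s) simp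
    have \<gamma>: "\<gamma> = ?l @ [i, i] @ ?r" using src i by (simp add: step_source_def)
    have word: "braid_word n \<gamma>" using d unfolding valid_step_def by blast
    then obtain ws' where ws': "decomposes n (?l @ ?r) ws'"
      using decomposition_exists[of n "?l @ ?r"] \<gamma> by auto
    have "decomposes n (?l @ [i] @ ?r) (Weave (step_target s) ss # ws)"
      using ws(1) i by (simp add: step_target_def)
    then have "decomposes n \<gamma> (prepend_step s (Weave (step_target s) ss # ws) @
        prepend_step (Step ?l (Cup i) ?r) ws')"
      using decomposes_square[of n ?l i ?r] ws' word \<gamma> s by metis
    moreover have "\<forall>w\<in>set (prepend_step (Step ?l (Cup i) ?r) ws'). has_cup w"
      by (auto simp: prepend_step_def has_cup_def)
    ultimately show ?thesis using cup unfolding pre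
      by (intro exI[of _ "prepend_step s ws @ prepend_step (Step ?l (Cup i) ?r) ws'"]) auto
  qed
qed

section \<open>Polynomial functions and fractions\<close>

lemma polyfun_sum: "finite A \<Longrightarrow> (\<And>a. a \<in> A \<Longrightarrow> polyfun (p a)) \<Longrightarrow> polyfun (\<lambda>x. \<Sum>a\<in>A. p a x)"
  by (induction A rule: finite_induct) (auto intro: polyfun.intros)

lemma polyfun_power: "polyfun p \<Longrightarrow> polyfun (\<lambda>x. p x ^ k)"
  by (induction k) (auto intro: polyfun.intros)

lemma polyfun_reindex: "polyfun p \<Longrightarrow> polyfun (\<lambda>x. p (\<lambda>i. x (h i)))"
  by (induction rule: polyfun.induct) (auto intro: polyfun.intros)

text \<open>Regular functions that are given by a single quotient of polynomials. All functions occurring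
  in the parametrisations are of this kind, and unlike regular functions they have a
  common denominator.\<close>

definition fraction_on :: "('i \<Rightarrow> complex) set \<Rightarrow> (('i \<Rightarrow> complex) \<Rightarrow> complex) \<Rightarrow> bool" where
  "fraction_on Y f \<longleftrightarrow>
     (\<exists>p q. polyfun p \<and> polyfun q \<and> (\<forall>y\<in>Y. q y \<noteq> 0 \<and> f y = p y / q y))"

lemma fraction_on_polyfun: "polyfun p \<Longrightarrow> fraction_on Y p"
  unfolding fraction_on_def using polyfun.const[of 1] by (intro exI[of _ p] exI[of _ "\<lambda>_. 1"]) auto

lemma fraction_on_const: "fraction_on Y (\<lambda>_. c)"
  by (rule fraction_on_polyfun) (rule polyfun.const)

lemma fraction_on_add:
  assumes "fraction_on Y f" "fraction_on Y g"
  shows "fraction_on Y (\<lambda>y. f y + g y)"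
proof -
  obtain p q p' q' where "polyfun p" "polyfun q" "\<forall>y\<in>Y. q y \<noteq> 0 \<and> f y = p y / q y"
    "polyfun p'" "polyfun q'" "\<forall>y\<in>Y. q' y \<noteq> 0 \<and> g y = p' y / q' y"
    using assms by (auto simp: fraction_on_def)
  then show ?thesis unfolding fraction_on_def
    by (intro exI[of _ "\<lambda>y. p y * q' y + p' y * q y"] exI[of _ "\<lambda>y. q y * q' y"])
      (auto intro!: polyfun.add polyfun.mult simp: add_frac_eq)
qed

lemma fraction_on_mult:
  assumes "fraction_on Y f" "fraction_on Y g"
  shows "fraction_on Y (\<lambda>y. f y * g y)"
proof -
  obtain p q p' q' where "polyfun p" "polyfun q" "\<forall>y\<in>Y. q y \<noteq> 0 \<and> f y = p y / q y"
    "polyfun p'" "polyfun q'" "\<forall>y\<in>Y. q' y \<noteq> 0 \<and> g y = p' y / q' y"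
    using assms by (auto simp: fraction_on_def)
  then show ?thesis unfolding fraction_on_def
    by (intro exI[of _ "\<lambda>y. p y * p' y"] exI[of _ "\<lambda>y. q y * q' y"])
      (auto intro!: polyfun.mult)
qed

lemma fraction_on_divide:
  assumes "fraction_on Y f" "fraction_on Y g" "\<And>y. y \<in> Y \<Longrightarrow> g y \<noteq> 0"
  shows "fraction_on Y (\<lambda>y. f y / g y)"
proof -
  obtain p q p' q' where "polyfun p" "polyfun q" "\<forall>y\<in>Y. q y \<noteq> 0 \<and> f y = p y / q y"
    "polyfun p'" "polyfun q'" "\<forall>y\<in>Y. q' y \<noteq> 0 \<and> g y = p' y / q' y"
    using assms(1,2) by (auto simp: fraction_on_def)
  then show ?thesis using assms(3) unfolding fraction_on_def
    by (intro exI[of _ "\<lambda>y. p y * q' y"] exI[of _ "\<lambda>y. q y * p' y"])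
      (auto intro!: polyfun.mult)
qed

lemma fraction_on_uminus: "fraction_on Y f \<Longrightarrow> fraction_on Y (\<lambda>y. - f y)"
  using fraction_on_mult[OF fraction_on_const[of Y "-1"]] by simp

lemma fraction_on_diff: "fraction_on Y f \<Longrightarrow> fraction_on Y g \<Longrightarrow> fraction_on Y (\<lambda>y. f y - g y)"
  using fraction_on_add[OF _ fraction_on_uminus, of Y f g] by simp

lemma fraction_on_compose_polyfun:
  assumes "polyfun p" and "\<And>i. fraction_on Y (\<lambda>y. g y i)"
  shows "fraction_on Y (\<lambda>y. p (g y))"
  using assms(1)
  by (induction rule: polyfun.induct)
    (auto intro: fraction_on_const fraction_on_add fraction_on_mult assms(2))

lemma fraction_on_imp_regular_on:
  assumes "fraction_on Y f"
  shows "regular_on Y f"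
proof -
  have "openin (subtopology zariski Y) Y" by (simp add: openin_subtopology_refl)
  then show ?thesis using assms unfolding regular_on_def fraction_on_def by blast
qed

lemma fraction_on_common_denominator:
  fixes f :: "nat \<Rightarrow> ('i \<Rightarrow> complex) \<Rightarrow> complex"
  assumes "\<And>i. i < k \<Longrightarrow> fraction_on Y (f i)"
  shows "\<exists>p q. (\<forall>i<k. polyfun (p i)) \<and> polyfun q \<and> (\<forall>y\<in>Y. q y \<noteq> 0 \<and> (\<forall>i<k. f i y = p i y / q y))"
  using assms
proof (induction k)
  case 0
  show ?case using polyfun.const[of 1] by (intro exI[of _ "\<lambda>_ _. 0"] exI[of _ "\<lambda>_. 1"]) simp
next
  case (Suc k)
  then obtain p q where pq: "\<forall>i<k. polyfun (p i)" "polyfun q"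
    "\<forall>y\<in>Y. q y \<noteq> 0 \<and> (\<forall>i<k. f i y = p i y / q y)" by fastforce
  obtain p' q' where p': "polyfun p'" "polyfun q'" "\<forall>y\<in>Y. q' y \<noteq> 0 \<and> f k y = p' y / q' y"
    using Suc.prems[of k] by (auto simp: fraction_on_def)
  let ?p = "\<lambda>i y. if i < k then p i y * q' y else p' y * q y"
  have "polyfun (?p i)" if "i < Suc k" for i
    using that pq p' by (cases "i < k") (auto intro: polyfun.mult)
  moreover have "f i y = ?p i y / (q y * q' y)" if "i < Suc k" "y \<in> Y" for i y
    using that pq(3) p'(3) by (cases "i < k") (auto simp: less_Suc_eq)
  ultimately show ?case using pq p'
    by (intro exI[of _ ?p] exI[of _ "\<lambda>y. q y * q' y"]) (auto intro: polyfun.mult)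
qed

section \<open>An upper bound for the dimension\<close>

definition bounded_monomials :: "nat \<Rightarrow> nat \<Rightarrow> ((nat \<Rightarrow> complex) \<Rightarrow> complex) set" where
  "bounded_monomials N E = (\<lambda>a x. \<Prod>i<N. x i ^ a i) ` ({..<N} \<rightarrow>\<^sub>E {..E})"

text \<open>Scalar multiplication of functions, which makes the dimension theory of vector spaces
  applicable to them.\<close>

definition fun_scale :: "complex \<Rightarrow> ('a \<Rightarrow> complex) \<Rightarrow> 'a \<Rightarrow> complex" where
  "fun_scale c f = (\<lambda>x. c * f x)"

lemma fun_scale_apply: "fun_scale c f x = c * f x"
  by (simp add: fun_scale_def)

interpretation fun_space: vector_space "fun_scale :: complex \<Rightarrow> ('a \<Rightarrow> complex) \<Rightarrow> 'a \<Rightarrow> complex"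
  by unfold_locales (auto simp: fun_scale_def fun_eq_iff algebra_simps)

lemma finite_bounded_monomials: "finite (bounded_monomials N E)"
  by (auto simp: bounded_monomials_def intro: finite_PiE)

lemma card_bounded_monomials: "card (bounded_monomials N E) \<le> (E + 1) ^ N"
proof -
  have "card (bounded_monomials N E) \<le> card ({..<N} \<rightarrow>\<^sub>E {..E})"
    unfolding bounded_monomials_def by (rule card_image_le) (auto intro: finite_PiE)
  then show ?thesis by (simp add: card_PiE)
qed

lemma bounded_monomials_mult:
  assumes "f \<in> bounded_monomials N E" "g \<in> bounded_monomials N E'"
  shows "(\<lambda>x. f x * g x) \<in> bounded_monomials N (E + E')"
proof -
  obtain a b where a: "a \<in> {..<N} \<rightarrow>\<^sub>E {..E}" "f = (\<lambda>x. \<Prod>i<N. x i ^ a i)"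
    and b: "b \<in> {..<N} \<rightarrow>\<^sub>E {..E'}" "g = (\<lambda>x. \<Prod>i<N. x i ^ b i)"
    using assms by (auto simp: bounded_monomials_def)
  let ?c = "\<lambda>i\<in>{..<N}. a i + b i"
  have "(\<lambda>x. f x * g x) = (\<lambda>x. \<Prod>i<N. x i ^ ?c i)"
    by (simp add: a b fun_eq_iff prod.distrib[symmetric] power_add)
  moreover have "a i \<le> E" "b i \<le> E'" if "i < N" for i
    using PiE_mem[OF a(1), of i] PiE_mem[OF b(1), of i] that by auto
  then have "?c \<in> {..<N} \<rightarrow>\<^sub>E {..E + E'}" by (auto intro: add_mono)
  ultimately show ?thesis unfolding bounded_monomials_def by blast
qed

abbreviation poly_space :: "nat \<Rightarrow> nat \<Rightarrow> ((nat \<Rightarrow> complex) \<Rightarrow> complex) set" where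
  "poly_space N E \<equiv> fun_space.span (bounded_monomials N E)"

lemma poly_space_add: "f \<in> poly_space N E \<Longrightarrow> g \<in> poly_space N E \<Longrightarrow> (\<lambda>x. f x + g x) \<in> poly_space N E"
  using fun_space.span_add[of f _ g] by (simp add: plus_fun_def)

lemma poly_space_scale: "f \<in> poly_space N E \<Longrightarrow> (\<lambda>x. c * f x) \<in> poly_space N E"
  using fun_space.span_scale[of f _ c] by (simp add: fun_scale_def)

lemma poly_space_zero: "(\<lambda>x. 0) \<in> poly_space N E"
  using fun_space.span_zero by (simp add: zero_fun_def)

lemma poly_space_mult:
  assumes "f \<in> poly_space N E" "g \<in> poly_space N E'"
  shows "(\<lambda>x. f x * g x) \<in> poly_space N (E + E')"
  using assms(1)
proof (induction rule: fun_space.span_induct_alt)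
  case base
  show ?case by (simp add: poly_space_zero)
next
  case (step c m f)
  have "(\<lambda>x. m x * g x) \<in> poly_space N (E + E')"
    using assms(2)
  proof (induction rule: fun_space.span_induct_alt)
    case base
    show ?case by (simp add: poly_space_zero)
  next
    case (step d m' g)
    have "(\<lambda>x. m x * m' x) \<in> poly_space N (E + E')"
      by (rule fun_space.span_base) (rule bounded_monomials_mult[OF \<open>m \<in> _\<close> \<open>m' \<in> _\<close>])
    then have "(\<lambda>x. d * (m x * m' x) + m x * g x) \<in> poly_space N (E + E')"
      by (intro poly_space_add poly_space_scale step.IH)
    moreover have "(\<lambda>x. m x * (fun_scale d m' + g) x) = (\<lambda>x. d * (m x * m' x) + m x * g x)"
      by (simp add: fun_eq_iff fun_scale_apply algebra_simps)
    ultimately show ?case by (simp only:)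
  qed
  then have "(\<lambda>x. c * (m x * g x) + f x * g x) \<in> poly_space N (E + E')"
    by (intro poly_space_add poly_space_scale step.IH)
  moreover have "(\<lambda>x. (fun_scale c m + f) x * g x) = (\<lambda>x. c * (m x * g x) + f x * g x)"
    by (simp add: fun_eq_iff fun_scale_apply algebra_simps)
  ultimately show ?case by (simp only:)
qed

lemma one_in_poly_space: "(\<lambda>x. 1) \<in> poly_space N E"
proof -
  have "(\<lambda>x. \<Prod>i<N. x i ^ (\<lambda>i\<in>{..<N}. 0) i) \<in> bounded_monomials N E"
    unfolding bounded_monomials_def by (rule imageI) (auto split: if_splits)
  then show ?thesis using fun_space.span_base by fastforce
qed

lemma const_in_poly_space: "(\<lambda>x. c) \<in> poly_space N E"
  using poly_space_scale[OF one_in_poly_space, of c N E] by simp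

lemma poly_space_mono:
  assumes "E \<le> E'"
  shows "poly_space N E \<subseteq> poly_space N E'"
proof (rule fun_space.span_mono)
  show "bounded_monomials N E \<subseteq> bounded_monomials N E'"
    unfolding bounded_monomials_def
    by (intro image_mono PiE_mono) (use assms in auto)
qed

lemma poly_space_power: "f \<in> poly_space N E \<Longrightarrow> (\<lambda>x. f x ^ k) \<in> poly_space N (k * E)"
proof (induction k)
  case 0
  show ?case by (simp add: one_in_poly_space)
next
  case (Suc k)
  then show ?case using poly_space_mult[of f N E "\<lambda>x. f x ^ k" "k * E"] by simp
qed

text \<open>Polynomials may involve any of the infinitely many coordinates of the ambient function space;
  those with index \<open>N\<close> or larger are replaced by 0.\<close>

lemma polyfun_in_poly_space:
  assumes "polyfun p"
  shows "\<exists>E. (\<lambda>x. p (\<lambda>i. if i < N then x i else 0)) \<in> poly_space N E"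
  using assms
proof (induction rule: polyfun.induct)
  case (const c)
  show ?case by (rule exI) (rule const_in_poly_space)
next
  case (coord i)
  show ?case
  proof (cases "i < N")
    case True
    let ?a = "\<lambda>j\<in>{..<N}. if j = i then 1 else (0::nat)"
    have "(\<lambda>x. \<Prod>j<N. x j ^ ?a j) \<in> bounded_monomials N 1"
      unfolding bounded_monomials_def by (rule imageI) (auto split: if_splits)
    moreover have "(\<Prod>j<N. x j ^ ?a j) = x i" for x :: "nat \<Rightarrow> complex"
    proof -
      have "(\<Prod>j<N. x j ^ ?a j) = (\<Prod>j<N. if j = i then x j else 1)"
        by (rule prod.cong) auto
      then show ?thesis using True by simp
    qed
    ultimately have "(\<lambda>x. x i) \<in> poly_space N 1" using fun_space.span_base by fastforce
    then show ?thesis using True by auto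
  next
    case False
    then show ?thesis using poly_space_zero by auto
  qed
next
  case (add p q)
  then obtain E E' where "(\<lambda>x. p (\<lambda>i. if i < N then x i else 0)) \<in> poly_space N E"
    "(\<lambda>x. q (\<lambda>i. if i < N then x i else 0)) \<in> poly_space N E'" by blast
  then have "(\<lambda>x. p (\<lambda>i. if i < N then x i else 0)) \<in> poly_space N (max E E')"
    "(\<lambda>x. q (\<lambda>i. if i < N then x i else 0)) \<in> poly_space N (max E E')"
    using poly_space_mono[of E "max E E'" N] poly_space_mono[of E' "max E E'" N] by auto
  then show ?case by (intro exI[of _ "max E E'"] poly_space_add)
next
  case (mult p q)
  then obtain E E' where "(\<lambda>x. p (\<lambda>i. if i < N then x i else 0)) \<in> poly_space N E"
    "(\<lambda>x. q (\<lambda>i. if i < N then x i else 0)) \<in> poly_space N E'" by blast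
  then show ?case by (intro exI[of _ "E + E'"] poly_space_mult)
qed

text \<open>Exponent vectors are lists; the entry of \<open>t # \<alpha>\<close> in front belongs to the function
  with index \<open>length \<alpha>\<close>.\<close>

fun power_prod :: "(nat \<Rightarrow> 'a \<Rightarrow> complex) \<Rightarrow> nat list \<Rightarrow> 'a \<Rightarrow> complex" where
  "power_prod g [] x = 1"
| "power_prod g (t # \<alpha>) x = g (length \<alpha>) x ^ t * power_prod g \<alpha> x"

definition exponents :: "nat \<Rightarrow> nat \<Rightarrow> nat list set" where
  "exponents k D = {\<alpha>. set \<alpha> \<subseteq> {..D} \<and> length \<alpha> = k}"

lemma finite_exponents: "finite (exponents k D)"
  unfolding exponents_def by (rule finite_lists_length_eq) simp

lemma card_exponents: "card (exponents k D) = (D + 1) ^ k"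
  unfolding exponents_def by (subst card_lists_length_eq) auto

lemma sum_exponents_Suc:
  "(\<Sum>\<alpha>\<in>exponents (Suc k) D. F \<alpha>) = (\<Sum>t\<le>D. \<Sum>\<alpha>\<in>exponents k D. F (t # \<alpha>))"
    (is "_ = ?R")
proof -
  have "exponents (Suc k) D = (\<lambda>(t, \<alpha>). t # \<alpha>) ` ({..D} \<times> exponents k D)"
    unfolding exponents_def
  proof (intro equalityI subsetI)
    fix \<alpha> assume "\<alpha> \<in> {\<alpha>. set \<alpha> \<subseteq> {..D} \<and> length \<alpha> = Suc k}"
    then show "\<alpha> \<in> (\<lambda>(t, \<alpha>). t # \<alpha>) ` ({..D} \<times> {\<alpha>. set \<alpha> \<subseteq> {..D} \<and> length \<alpha> = k})"
      by (cases \<alpha>) auto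
  qed auto
  then have "(\<Sum>\<alpha>\<in>exponents (Suc k) D. F \<alpha>) = (\<Sum>(t, \<alpha>)\<in>{..D} \<times> exponents k D. F (t # \<alpha>))"
    by (simp add: sum.reindex inj_on_def split_def)
  then show ?thesis by (simp add: sum.cartesian_product)
qed

lemma power_prod_cong:
  "(\<And>i. i < length \<alpha> \<Longrightarrow> g i x = h i x) \<Longrightarrow> power_prod g \<alpha> x = power_prod h \<alpha> x"
  by (induction \<alpha>) auto

lemma polyfun_power_prod:
  "(\<And>i. i < length \<alpha> \<Longrightarrow> polyfun (g i)) \<Longrightarrow> polyfun (power_prod g \<alpha>)"
proof (induction \<alpha>)
  case Nil
  have "power_prod g [] = (\<lambda>_. 1)" by auto
  then show ?case using polyfun.const[of 1] by simp
next
  case (Cons t \<alpha>)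
  have "power_prod g (t # \<alpha>) = (\<lambda>x. g (length \<alpha>) x ^ t * power_prod g \<alpha> x)" by auto
  moreover have "polyfun (g (length \<alpha>))" "polyfun (power_prod g \<alpha>)" using Cons by auto
  ultimately show ?case by (simp add: polyfun.mult polyfun_power)
qed

lemma irreducible_zariski_mult:
  assumes Z: "irreducible_in (subtopology zariski X) Z"
    and "polyfun p" "polyfun q" and 0: "\<And>x. x \<in> Z \<Longrightarrow> p x * q x = 0"
  shows "(\<forall>x\<in>Z. p x = 0) \<or> (\<forall>x\<in>Z. q x = 0)"
proof -
  have cl: "closedin (subtopology zariski X) (X \<inter> {x. f x = 0})" if "polyfun f" for f
  proof -
    have "zariski_closed {x. f x = 0}"
      unfolding zariski_closed_def zero_locus_def using that by (intro exI[of _ "{f}"]) auto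
    then show ?thesis by (auto simp: closedin_subtopology closedin_zariski)
  qed
  have "Z \<subseteq> X" using Z by (simp add: irreducible_in_def)
  then have "Z \<subseteq> (X \<inter> {x. p x = 0}) \<union> (X \<inter> {x. q x = 0})" using 0 by auto
  then have "Z \<subseteq> X \<inter> {x. p x = 0} \<or> Z \<subseteq> X \<inter> {x. q x = 0}"
    using Z cl[OF assms(2)] cl[OF assms(3)] unfolding irreducible_in_def by blast
  then show ?thesis by auto
qed

lemma closedin_separating_polyfun:
  assumes "closedin (subtopology zariski X) A" "B \<subseteq> X" "\<not> B \<subseteq> A"
  shows "\<exists>p. polyfun p \<and> (\<forall>x\<in>A. p x = 0) \<and> (\<exists>x\<in>B. p x \<noteq> 0)"
proof -
  obtain C where "zariski_closed C" "A = C \<inter> X"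
    using assms(1) by (auto simp: closedin_subtopology closedin_zariski)
  then obtain P where P: "\<forall>p\<in>P. polyfun p" "A = zero_locus P \<inter> X"
    by (auto simp: zariski_closed_def)
  obtain x where "x \<in> B" "x \<notin> A" using assms(3) by auto
  then obtain p where "p \<in> P" "p x \<noteq> 0" using P(2) assms(2) by (auto simp: zero_locus_def)
  then show ?thesis using P \<open>x \<in> B\<close> by (auto simp: zero_locus_def)
qed

text \<open>Functions \<open>g i\<close> separating the successive members of a chain of irreducible closed
  sets are algebraically independent: in a relation \<open>\<Sum>\<^sub>t g\<^sub>k\<^sup>t h\<^sub>t = 0\<close> on the largest set, the
  lowest power of \<open>g\<^sub>k\<close> can be cancelled by irreducibility, and restricting to the next
  smaller set, where \<open>g\<^sub>k\<close> vanishes, leaves a relation among the remaining functions.\<close>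

lemma chain_algebraically_independent:
  fixes Z :: "nat \<Rightarrow> ('i \<Rightarrow> complex) set" and c :: "nat list \<Rightarrow> complex"
  assumes irr: "\<And>i. i \<le> k \<Longrightarrow> irreducible_in (subtopology zariski X) (Z i)"
    and sub: "\<And>i. i < k \<Longrightarrow> Z i \<subseteq> Z (Suc i)"
    and g: "\<And>i. i < k \<Longrightarrow> polyfun (g i)" "\<And>i x. i < k \<Longrightarrow> x \<in> Z i \<Longrightarrow> g i x = 0"
      "\<And>i. i < k \<Longrightarrow> \<exists>x\<in>Z (Suc i). g i x \<noteq> 0"
    and rel: "\<And>x. x \<in> Z k \<Longrightarrow> (\<Sum>\<alpha>\<in>exponents k D. c \<alpha> * power_prod g \<alpha> x) = 0"
    and \<alpha>: "\<alpha> \<in> exponents k D"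
  shows "c \<alpha> = 0"
  using assms
proof (induction k arbitrary: c \<alpha>)
  case 0
  have "Z 0 \<noteq> {}" using "0.prems"(1)[of 0] by (auto simp: irreducible_in_def)
  then obtain x where x: "x \<in> Z 0" by auto
  have e: "exponents 0 D = {[]}" by (auto simp: exponents_def)
  then show ?case using "0.prems"(6)[OF x] "0.prems"(7) by simp
next
  case (Suc k)
  define h where "h = (\<lambda>t x. \<Sum>\<alpha>\<in>exponents k D. c (t # \<alpha>) * power_prod g \<alpha> x)"
  have poly_h: "polyfun (h t)" for t
    unfolding h_def
  proof (rule polyfun_sum[OF finite_exponents])
    fix \<alpha> assume "\<alpha> \<in> exponents k D"
    then have "polyfun (power_prod g \<alpha>)"
      using Suc.prems(3) by (intro polyfun_power_prod) (auto simp: exponents_def)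
    then show "polyfun (\<lambda>x. c (t # \<alpha>) * power_prod g \<alpha> x)"
      by (intro polyfun.mult polyfun.const)
  qed
  have rel: "(\<Sum>t\<le>D. g k x ^ t * h t x) = 0" if "x \<in> Z (Suc k)" for x
  proof -
    have "(\<Sum>\<alpha>\<in>exponents (Suc k) D. c \<alpha> * power_prod g \<alpha> x) =
        (\<Sum>t\<le>D. \<Sum>\<alpha>\<in>exponents k D. c (t # \<alpha>) * power_prod g (t # \<alpha>) x)"
      by (rule sum_exponents_Suc)
    also have "\<dots> = (\<Sum>t\<le>D. g k x ^ t * h t x)"
      unfolding h_def sum_distrib_left
      by (intro sum.cong refl) (auto simp: exponents_def algebra_simps)
    finally show ?thesis using Suc.prems(6)[OF that] by simp
  qed
  have "\<forall>\<alpha>\<in>exponents k D. c (t # \<alpha>) = 0" if "t \<le> D" for t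
    using that
  proof (induction t rule: less_induct)
    case (less t)
    have h0: "h s x = 0" if "s < t" for s x
      using less.IH[OF that] less.prems that by (simp add: h_def)
    define r where "r = (\<lambda>x. \<Sum>s\<in>{t<..D}. g k x ^ (s - Suc t) * h s x)"
    have poly_r: "polyfun r"
      unfolding r_def using Suc.prems(3)[of k] poly_h
      by (intro polyfun_sum polyfun.mult polyfun_power) auto
    have split: "(\<Sum>s\<le>D. g k x ^ s * h s x) = g k x ^ t * (h t x + g k x * r x)" for x
    proof -
      have "(\<Sum>s\<le>D. g k x ^ s * h s x) = (\<Sum>s\<in>insert t {t<..D}. g k x ^ s * h s x)"
        by (rule sum.mono_neutral_right) (use less.prems h0 in \<open>auto simp: not_less_iff_gr_or_eq\<close>)
      also have "\<dots> = g k x ^ t * h t x + (\<Sum>s\<in>{t<..D}. g k x ^ s * h s x)"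
        by simp
      also have "(\<Sum>s\<in>{t<..D}. g k x ^ s * h s x) = g k x ^ t * (g k x * r x)"
        unfolding r_def sum_distrib_left
      proof (rule sum.cong)
        fix s assume "s \<in> {t<..D}"
        then have "s = t + Suc (s - Suc t)" by simp
        then have "g k x ^ s = g k x ^ t * (g k x * g k x ^ (s - Suc t))"
          by (metis power_add power_Suc)
        then show "g k x ^ s * h s x = g k x ^ t * (g k x * (g k x ^ (s - Suc t) * h s x))"
          by simp
      qed simp
      finally show ?thesis by (simp add: algebra_simps)
    qed
    have "(\<forall>x\<in>Z (Suc k). g k x ^ t = 0) \<or> (\<forall>x\<in>Z (Suc k). h t x + g k x * r x = 0)"
      by (rule irreducible_zariski_mult[OF Suc.prems(1)])
        (use Suc.prems(3)[of k] poly_h poly_r rel split in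
          \<open>auto intro: polyfun.add polyfun.mult polyfun_power\<close>)
    moreover have "\<not> (\<forall>x\<in>Z (Suc k). g k x ^ t = 0)"
      using Suc.prems(5)[of k] by auto
    ultimately have top: "\<forall>x\<in>Z (Suc k). h t x + g k x * r x = 0" by blast
    have hk: "h t x = 0" if "x \<in> Z k" for x
    proof -
      have "x \<in> Z (Suc k)" using that Suc.prems(2)[of k] by auto
      then show ?thesis using bspec[OF top, of x] Suc.prems(4)[of k x] that by simp
    qed
    show "\<forall>\<alpha>\<in>exponents k D. c (t # \<alpha>) = 0"
    proof
      fix \<beta> assume \<beta>: "\<beta> \<in> exponents k D"
      show "c (t # \<beta>) = 0"
      proof (rule Suc.IH[of "\<lambda>\<alpha>. c (t # \<alpha>)" \<beta>])
        show "(\<Sum>\<alpha>\<in>exponents k D. c (t # \<alpha>) * power_prod g \<alpha> x) = 0" if "x \<in> Z k" for x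
          using hk[OF that] by (simp add: h_def)
      qed (use Suc.prems \<beta> in simp_all)
    qed
  qed
  moreover obtain t \<beta> where "\<alpha> = t # \<beta>" "t \<le> D" "\<beta> \<in> exponents k D"
    using Suc.prems(7) by (cases \<alpha>) (auto simp: exponents_def)
  ultimately show ?case by auto
qed

text \<open>Clearing denominators uniformly: the exponent \<open>k * D\<close> works for all products with \<open>k\<close>
  factors of exponent at most \<open>D\<close>.\<close>

lemma power_prod_quotient:
  assumes "\<And>i. i < length \<alpha> \<Longrightarrow> f i x = p i x / q x" "q x \<noteq> 0" "\<alpha> \<in> exponents k D"
  shows "power_prod f \<alpha> x * q x ^ (k * D) = power_prod p \<alpha> x * q x ^ (k * D - sum_list \<alpha>)"
    and "sum_list \<alpha> \<le> k * D"
proof -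
  have "power_prod f \<alpha> x * q x ^ sum_list \<alpha> = power_prod p \<alpha> x"
    using assms(1)
  proof (induction \<alpha>)
    case Nil
    show ?case by simp
  next
    case (Cons t \<alpha>)
    have "f (length \<alpha>) x * q x = p (length \<alpha>) x" using Cons.prems[of "length \<alpha>"] assms(2) by simp
    then have "(f (length \<alpha>) x) ^ t * q x ^ t = p (length \<alpha>) x ^ t"
      by (metis power_mult_distrib)
    moreover have "power_prod f \<alpha> x * q x ^ sum_list \<alpha> = power_prod p \<alpha> x"
      using Cons by auto
    moreover have "power_prod f (t # \<alpha>) x * q x ^ sum_list (t # \<alpha>) =
        ((f (length \<alpha>) x) ^ t * q x ^ t) * (power_prod f \<alpha> x * q x ^ sum_list \<alpha>)"
      by (simp add: power_add)
    ultimately show ?case by simp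
  qed
  moreover show "sum_list \<alpha> \<le> k * D"
    using assms(3) sum_list_mono[of \<alpha> "\<lambda>x. x" "\<lambda>_. D"] 
    by (auto simp: exponents_def sum_list_triv mult.commute)
  ultimately show "power_prod f \<alpha> x * q x ^ (k * D) = power_prod p \<alpha> x * q x ^ (k * D - sum_list \<alpha>)"
    by (metis (no_types, lifting) le_add_diff_inverse mult.assoc power_add)
qed

lemma power_prod_in_poly_space:
  assumes "\<And>i. i < length \<alpha> \<Longrightarrow> p i \<in> poly_space N E"
  shows "power_prod p \<alpha> \<in> poly_space N (sum_list \<alpha> * E)"
  using assms
proof (induction \<alpha>)
  case Nil
  have "power_prod p [] = (\<lambda>_. 1)" by auto
  then show ?case using one_in_poly_space by simp
next
  case (Cons t \<alpha>)
  have "(\<lambda>x. p (length \<alpha>) x ^ t * power_prod p \<alpha> x) \<in> poly_space N (t * E + sum_list \<alpha> * E)"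
    using Cons by (intro poly_space_mult poly_space_power) auto
  moreover have "power_prod p (t # \<alpha>) = (\<lambda>x. p (length \<alpha>) x ^ t * power_prod p \<alpha> x)" by auto
  ultimately show ?case by (simp add: algebra_simps)
qed

text \<open>The functions need not be distinct; two equal ones already satisfy a relation.\<close>

lemma poly_space_dependent:
  fixes F :: "'a \<Rightarrow> (nat \<Rightarrow> complex) \<Rightarrow> complex"
  assumes "finite A" "\<And>a. a \<in> A \<Longrightarrow> F a \<in> poly_space N E" "(E + 1) ^ N < card A"
  shows "\<exists>c. (\<exists>a\<in>A. c a \<noteq> 0) \<and> (\<forall>x. (\<Sum>a\<in>A. c a * F a x) = 0)"
proof (cases "inj_on F A")
  case False
  then obtain a b where ab: "a \<in> A" "b \<in> A" "a \<noteq> b" "F a = F b" by (auto simp: inj_on_def)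
  let ?c = "\<lambda>x. if x = a then 1 else if x = b then -1 else (0::complex)"
  have "(\<Sum>y\<in>A. ?c y * F y x) = 0" for x
  proof -
    have "(\<Sum>y\<in>A. ?c y * F y x) = (\<Sum>y\<in>{a, b}. ?c y * F y x)"
      by (rule sum.mono_neutral_right) (use assms ab in auto)
    then show ?thesis using ab by simp
  qed
  then show ?thesis using ab(1) by (intro exI[of _ ?c]) auto
next
  case True
  have "\<not> fun_space.independent (F ` A)"
  proof
    assume "fun_space.independent (F ` A)"
    then have "card (F ` A) \<le> card (bounded_monomials N E)"
      using fun_space.independent_span_bound[OF finite_bounded_monomials] assms(2) by blast
    then show False using card_bounded_monomials[of N E] assms(3) True by (simp add: card_image)
  qed
  then obtain u where u: "\<exists>f\<in>F ` A. u f \<noteq> 0" "(\<Sum>f\<in>F ` A. fun_scale (u f) f) = 0"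
    using fun_space.dependent_finite[of "F ` A"] assms(1) by auto
  have "(\<Sum>a\<in>A. u (F a) * F a x) = 0" for x
  proof -
    have ap: "(\<Sum>a\<in>B. G a) x = (\<Sum>a\<in>B. G a x)" if "finite B"
      for B and G :: "'a \<Rightarrow> (nat \<Rightarrow> complex) \<Rightarrow> complex"
      using that by (induction B rule: finite_induct) auto
    have "(\<Sum>a\<in>A. fun_scale (u (F a)) (F a)) = 0"
      using u(2) True by (simp add: sum.reindex)
    then have "(\<Sum>a\<in>A. fun_scale (u (F a)) (F a)) x = 0" by simp
    then show ?thesis unfolding ap[OF assms(1)] by (simp add: fun_scale_apply)
  qed
  then show ?thesis using u(1) by (intro exI[of _ "\<lambda>a. u (F a)"]) auto
qed

lemma krull_dim_leI:
  assumes "\<And>k Z. (\<forall>i\<le>k. closedin T (Z i) \<and> irreducible_in T (Z i)) \<Longrightarrow>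
    (\<forall>i<k. Z i \<subset> Z (Suc i)) \<Longrightarrow> k \<le> N"
  shows "krull_dim T \<le> ereal (real N)"
  unfolding krull_dim_def by (rule Sup_least) (use assms in auto)

text \<open>Let \<open>g\<^sub>0, \<dots>, g\<^bsub>k-1\<^esub>\<close> separate the members of a chain in \<open>X\<close>. There are \<open>(D+1)\<^sup>k\<close> monomials in
  them with exponents at most \<open>D\<close>, and these are linearly independent. Pulled back along \<open>G\<close> and
  multiplied by a power of a common denominator, they are polynomials in \<open>N\<close> variables whose
  exponents are bounded by \<open>k D E\<close> with \<open>E\<close> independent of \<open>D\<close>. Such polynomials form a
  space of dimension at most \<open>(k D E + 1)\<^sup>N\<close>, which is too small for large \<open>D\<close> if \<open>k > N\<close>.\<close>

theorem variety_dim_rational_image: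
  fixes X :: "('i \<Rightarrow> complex) set" and G :: "(nat \<Rightarrow> complex) \<Rightarrow> 'i \<Rightarrow> complex"
  assumes Y: "Y \<subseteq> affine_space {..<N}" and G: "\<And>i. fraction_on Y (\<lambda>y. G y i)"
    and X: "G ` Y = X"
  shows "variety_dim X \<le> ereal (real N)"
  unfolding variety_dim_def
proof (rule krull_dim_leI, rule ccontr)
  fix k and Z :: "nat \<Rightarrow> ('i \<Rightarrow> complex) set"
  assume irr: "\<forall>i\<le>k. closedin (subtopology zariski X) (Z i) \<and> irreducible_in (subtopology zariski X) (Z i)"
    and chain: "\<forall>i<k. Z i \<subset> Z (Suc i)" and k: "\<not> k \<le> N"
  have ZX: "Z i \<subseteq> X" if "i \<le> k" for i
    using irr that by (auto simp: irreducible_in_def)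
  have "\<forall>i. \<exists>p. i < k \<longrightarrow> polyfun p \<and> (\<forall>x\<in>Z i. p x = 0) \<and> (\<exists>x\<in>Z (Suc i). p x \<noteq> 0)"
  proof
    fix i
    show "\<exists>p. i < k \<longrightarrow> polyfun p \<and> (\<forall>x\<in>Z i. p x = 0) \<and> (\<exists>x\<in>Z (Suc i). p x \<noteq> 0)"
    proof (cases "i < k")
      case i: True
      then have "Z i \<subset> Z (Suc i)" "closedin (subtopology zariski X) (Z i)" "Z (Suc i) \<subseteq> X"
        using chain irr ZX by simp_all
      then have "\<exists>p. polyfun p \<and> (\<forall>x\<in>Z i. p x = 0) \<and> (\<exists>x\<in>Z (Suc i). p x \<noteq> 0)"
        by (intro closedin_separating_polyfun[of X]) auto
      then show ?thesis by blast
    qed simp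
  qed
  from choice[OF this] obtain g where g': "\<forall>i. i < k \<longrightarrow>
      polyfun (g i) \<and> (\<forall>x\<in>Z i. g i x = 0) \<and> (\<exists>x\<in>Z (Suc i). g i x \<noteq> 0)"
    by (elim exE)
  have g: "\<And>i. i < k \<Longrightarrow> polyfun (g i)" "\<And>i x. i < k \<Longrightarrow> x \<in> Z i \<Longrightarrow> g i x = 0"
      "\<And>i. i < k \<Longrightarrow> \<exists>x\<in>Z (Suc i). g i x \<noteq> 0"
    using g' by simp_all
  have "\<exists>p q. (\<forall>i<k. polyfun (p i)) \<and> polyfun q \<and>
      (\<forall>y\<in>Y. q y \<noteq> 0 \<and> (\<forall>i<k. g i (G y) = p i y / q y))"
    by (rule fraction_on_common_denominator) (rule fraction_on_compose_polyfun[OF g(1) G])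
  then obtain p q where pq': "(\<forall>i<k. polyfun (p i)) \<and> polyfun q \<and>
      (\<forall>y\<in>Y. q y \<noteq> 0 \<and> (\<forall>i<k. g i (G y) = p i y / q y))"
    by (elim exE)
  have pq: "\<And>i. i < k \<Longrightarrow> polyfun (p i)" "polyfun q" "\<And>y. y \<in> Y \<Longrightarrow> q y \<noteq> 0"
    "\<And>y i. y \<in> Y \<Longrightarrow> i < k \<Longrightarrow> g i (G y) = p i y / q y"
    using pq' by simp_all
  (* Y does not see the coordinates with index N or larger, so these can be replaced by 0. *)
  define R where "R f = (\<lambda>x. f (\<lambda>i. if i < N then x i else (0::complex)) :: complex)" for f
  have RY: "R f y = f y" if "y \<in> Y" for f y
  proof -
    have "(\<lambda>i. if i < N then y i else 0) = y"
      using subsetD[OF Y that] by (auto simp: affine_space_def fun_eq_iff)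
    then show ?thesis by (simp add: R_def)
  qed
  have "\<exists>E. \<forall>i<k. R (p i) \<in> poly_space N E"
  proof -
    have "\<exists>E. R (p i) \<in> poly_space N E" if "i < k" for i
      unfolding R_def by (rule polyfun_in_poly_space[OF pq(1)[OF that]])
    then have "\<forall>i. \<exists>E. i < k \<longrightarrow> R (p i) \<in> poly_space N E" by simp
    from choice[OF this] obtain e where e: "\<forall>i. i < k \<longrightarrow> R (p i) \<in> poly_space N (e i)"
      by (elim exE)
    have "\<forall>i<k. R (p i) \<in> poly_space N (sum e {..<k})"
    proof (intro allI impI)
      fix i assume i: "i < k"
      have "e i \<le> sum e {..<k}" by (rule member_le_sum) (use i in auto)
      then show "R (p i) \<in> poly_space N (sum e {..<k})"
        using e i poly_space_mono[THEN subsetD] by simp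
    qed
    then show ?thesis by (rule exI)
  qed
  then obtain E1 where E1': "\<forall>i<k. R (p i) \<in> poly_space N E1" by (elim exE)
  then have E1: "\<And>i. i < k \<Longrightarrow> R (p i) \<in> poly_space N E1" by simp
  have "\<exists>E2. R q \<in> poly_space N E2"
    unfolding R_def by (rule polyfun_in_poly_space[OF pq(2)])
  then obtain E2 where E2: "R q \<in> poly_space N E2" by (elim exE)
  (* k D E + 1 is at most (k E + 1) (D + 1), so this D gives (k D E + 1)^N < (D + 1)^(N + 1). *)
  define E where "E = E1 + E2"
  define D where "D = (k * E + 1) ^ N"
  define F where "F \<alpha> = (\<lambda>y. power_prod (\<lambda>i. R (p i)) \<alpha> y * R q y ^ (k * D - sum_list \<alpha>))"
    for \<alpha>
  have F: "F \<alpha> \<in> poly_space N (k * D * E)" if "\<alpha> \<in> exponents k D" for \<alpha>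
  proof -
    have len: "length \<alpha> = k" using that by (simp add: exponents_def)
    have le: "sum_list \<alpha> \<le> k * D"
      using that sum_list_mono[of \<alpha> "\<lambda>x. x" "\<lambda>_. D"]
      by (auto simp: exponents_def sum_list_triv mult.commute)
    have "F \<alpha> \<in> poly_space N (sum_list \<alpha> * E1 + (k * D - sum_list \<alpha>) * E2)"
      unfolding F_def using E1 len
      by (intro poly_space_mult power_prod_in_poly_space poly_space_power E2) auto
    moreover have "sum_list \<alpha> * E1 + (k * D - sum_list \<alpha>) * E2 \<le> k * D * E"
      unfolding E_def distrib_left by (intro add_mono mult_right_mono) (use le in auto)
    ultimately show ?thesis using poly_space_mono[THEN subsetD] by simp
  qed
  have "(k * D * E + 1) ^ N < card (exponents k D)"
  proof -
    have "k * D * E + 1 \<le> (k * E + 1) * (D + 1)" by (simp add: algebra_simps)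
    then have "(k * D * E + 1) ^ N \<le> ((k * E + 1) * (D + 1)) ^ N" by (rule power_mono) simp
    also have "\<dots> = D * (D + 1) ^ N" unfolding power_mult_distrib D_def[symmetric] by (rule refl)
    also have "\<dots> < (D + 1) ^ Suc N" by simp
    also have "\<dots> \<le> (D + 1) ^ k" by (rule power_increasing) (use k in auto)
    finally show ?thesis unfolding card_exponents .
  qed
  note card = this
  have "\<exists>c. (\<exists>\<alpha>\<in>exponents k D. c \<alpha> \<noteq> 0) \<and>
      (\<forall>y. (\<Sum>\<alpha>\<in>exponents k D. c \<alpha> * F \<alpha> y) = 0)"
    by (rule poly_space_dependent[OF finite_exponents _ card]) (rule F)
  then obtain c where c': "(\<exists>\<alpha>\<in>exponents k D. c \<alpha> \<noteq> 0) \<and>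
      (\<forall>y. (\<Sum>\<alpha>\<in>exponents k D. c \<alpha> * F \<alpha> y) = 0)"
    by (elim exE)
  have c: "\<exists>\<alpha>\<in>exponents k D. c \<alpha> \<noteq> 0" "\<And>y. (\<Sum>\<alpha>\<in>exponents k D. c \<alpha> * F \<alpha> y) = 0"
    using c' by simp_all
  have rel: "(\<Sum>\<alpha>\<in>exponents k D. c \<alpha> * power_prod g \<alpha> x) = 0" if "x \<in> Z k" for x
  proof -
    have "x \<in> G ` Y" using that ZX[of k] X by auto
    then obtain y where y: "y \<in> Y" "x = G y" by blast
    have e: "c \<alpha> * F \<alpha> y = c \<alpha> * power_prod g \<alpha> x * q y ^ (k * D)" if "\<alpha> \<in> exponents k D" for \<alpha>
    proof -
      have len: "length \<alpha> = k" using that by (simp add: exponents_def)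
      have "F \<alpha> y = power_prod p \<alpha> y * q y ^ (k * D - sum_list \<alpha>)"
        unfolding F_def RY[OF y(1)]
        by (subst power_prod_cong[where h = p]) (auto simp: RY[OF y(1)])
      also have "\<dots> = power_prod (\<lambda>i y. g i (G y)) \<alpha> y * q y ^ (k * D)"
        by (rule power_prod_quotient(1)[symmetric, OF _ _ that]) (use pq y len in auto)
      also have "power_prod (\<lambda>i y. g i (G y)) \<alpha> y = power_prod g \<alpha> x"
        unfolding y(2) by (induction \<alpha>) auto
      finally show ?thesis by simp
    qed
    have "(\<Sum>\<alpha>\<in>exponents k D. c \<alpha> * power_prod g \<alpha> x) * q y ^ (k * D) =
        (\<Sum>\<alpha>\<in>exponents k D. c \<alpha> * F \<alpha> y)"
      unfolding sum_distrib_right by (intro sum.cong refl e[symmetric])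
    then have "(\<Sum>\<alpha>\<in>exponents k D. c \<alpha> * power_prod g \<alpha> x) * q y ^ (k * D) = 0"
      unfolding c(2) .
    then show ?thesis using pq(3)[OF y(1)] by simp
  qed
  have "c \<alpha> = 0" if \<alpha>: "\<alpha> \<in> exponents k D" for \<alpha>
  proof (rule chain_algebraically_independent[where X = X and Z = Z and g = g, OF _ _ g rel \<alpha>])
    show "irreducible_in (subtopology zariski X) (Z i)" if "i \<le> k" for i using irr that by simp
    show "Z i \<subseteq> Z (Suc i)" if "i < k" for i using chain that by (simp add: psubset_imp_subset)
  qed
  then show False using c(1) by simp
qed

section \<open>A lower bound for the dimension\<close>

abbreviation line_point :: "('i \<Rightarrow> complex) \<Rightarrow> ('i \<Rightarrow> complex) \<Rightarrow> complex \<Rightarrow> 'i \<Rightarrow> complex" where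
  "line_point s t c \<equiv> (\<lambda>j. (1 - c) * s j + c * t j)"

lemma polyfun_on_line:
  assumes "polyfun p"
  shows "\<exists>q. \<forall>c. p (line_point s t c) = poly q c"
  using assms
proof (induction rule: polyfun.induct)
  case (const a)
  show ?case by (rule exI[of _ "[:a:]"]) simp
next
  case (coord i)
  show ?case by (rule exI[of _ "[:s i, t i - s i:]"]) (simp add: algebra_simps)
next
  case (add p q)
  then obtain a b where "\<forall>c. p (line_point s t c) = poly a c" "\<forall>c. q (line_point s t c) = poly b c"
    by blast
  then show ?case by (intro exI[of _ "a + b"]) simp
next
  case (mult p q)
  then obtain a b where "\<forall>c. p (line_point s t c) = poly a c" "\<forall>c. q (line_point s t c) = poly b c"
    by blast
  then show ?case by (intro exI[of _ "a * b"]) simp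
qed

text \<open>If two polynomials are nonzero somewhere on \<open>T\<close>, then so is their product: on the line through
  a point where the first and a point where the second is nonzero, both become nonzero polynomials
  in one variable, with finitely many zeros, and all but finitely many points of this line lie
  in \<open>T\<close>.\<close>

lemma irreducible_rational_image:
  assumes "T \<noteq> {}" and line: "\<And>s t. s \<in> T \<Longrightarrow> t \<in> T \<Longrightarrow> finite {c. line_point s t c \<notin> T}"
    and G: "\<And>i. fraction_on T (\<lambda>y. G y i)" and X: "G ` T \<subseteq> X"
  shows "irreducible_in (subtopology zariski X) (G ` T)"
  unfolding irreducible_in_def
proof (intro conjI allI impI)
  show "G ` T \<subseteq> topspace (subtopology zariski X)" using X by simp
  show "G ` T \<noteq> {}" using assms by simp
  fix A B
  assume AB: "closedin (subtopology zariski X) A \<and> closedin (subtopology zariski X) B \<and> G ` T \<subseteq> A \<union> B"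
  have witness: "\<exists>P s. polyfun P \<and> s \<in> T \<and> P s \<noteq> 0 \<and> (\<forall>y\<in>T. G y \<in> C \<longrightarrow> P y = 0)"
    if C: "closedin (subtopology zariski X) C" "\<not> G ` T \<subseteq> C" for C
  proof -
    obtain p s where p: "polyfun p" "\<forall>x\<in>C. p x = 0" "s \<in> T" "p (G s) \<noteq> 0"
      using closedin_separating_polyfun[OF C(1) X C(2)] by auto
    have "fraction_on T (\<lambda>y. p (G y))" by (rule fraction_on_compose_polyfun[OF p(1) G])
    then obtain P R where "polyfun P" "\<forall>y\<in>T. R y \<noteq> 0 \<and> p (G y) = P y / R y"
      unfolding fraction_on_def by (elim exE conjE)
    then show ?thesis using p by (intro exI[of _ P] exI[of _ s]) force
  qed
  show "G ` T \<subseteq> A \<or> G ` T \<subseteq> B"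
  proof (rule ccontr)
    assume "\<not> (G ` T \<subseteq> A \<or> G ` T \<subseteq> B)"
    then have nA: "\<not> G ` T \<subseteq> A" and nB: "\<not> G ` T \<subseteq> B" by simp_all
    obtain P s where P: "polyfun P" "s \<in> T" "P s \<noteq> 0" "\<forall>y\<in>T. G y \<in> A \<longrightarrow> P y = 0"
      using witness[OF _ nA] AB by (elim conjE) metis
    obtain Q t where Q: "polyfun Q" "t \<in> T" "Q t \<noteq> 0" "\<forall>y\<in>T. G y \<in> B \<longrightarrow> Q y = 0"
      using witness[OF _ nB] AB by (elim conjE) metis
    obtain a where a: "\<forall>c. P (line_point s t c) = poly a c" using polyfun_on_line[OF P(1)] by blast
    obtain b where b: "\<forall>c. Q (line_point s t c) = poly b c" using polyfun_on_line[OF Q(1)] by blast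
    have "poly a 0 \<noteq> 0" using a[rule_format, of 0] P(3) by simp
    moreover have "poly b 1 \<noteq> 0" using b[rule_format, of 1] Q(3) by simp
    ultimately have "a \<noteq> 0" "b \<noteq> 0" by auto
    then have "finite ({c. poly a c = 0} \<union> {c. poly b c = 0} \<union> {c. line_point s t c \<notin> T})"
      by (intro finite_UnI poly_roots_finite line[OF P(2) Q(2)])
    from ex_new_if_finite[OF infinite_UNIV_char_0 this]
    obtain c where "c \<notin> {c. poly a c = 0} \<union> {c. poly b c = 0} \<union> {c. line_point s t c \<notin> T}"
      by (elim exE)
    then have c: "poly a c \<noteq> 0" "poly b c \<noteq> 0" "line_point s t c \<in> T" by auto
    then have "G (line_point s t c) \<in> A \<union> B" using AB by blast
    then show False using c a b P(4) Q(4) by auto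
  qed
qed

text \<open>The chain consists of the subvarieties where the coordinates with index at least \<open>i\<close> are 1, for
  \<open>i = 0, \<dots>, d\<close>. They are closed since the inverse \<open>F\<close> of the parametrisation is polynomial.\<close>

theorem variety_dim_torus_parametrised:
  fixes X :: "('i \<Rightarrow> complex) set" and G :: "(nat \<Rightarrow> complex) \<Rightarrow> 'i \<Rightarrow> complex"
  assumes G: "\<And>i. fraction_on (torus d) (\<lambda>y. G y i)" and X: "G ` torus d = X"
    and F: "\<And>j. polyfun (\<lambda>x. F x j)" and FG: "\<And>y. y \<in> torus d \<Longrightarrow> F (G y) = y"
  shows "ereal (real d) \<le> variety_dim X"
proof -
  define T where "T i = {y \<in> torus d. \<forall>j. i \<le> j \<and> j < d \<longrightarrow> y j = 1}" for i
  have TX: "G ` T i \<subseteq> X" for i using X by (auto simp: T_def)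
  have Z: "G ` T i = X \<inter> {x. \<forall>j. i \<le> j \<and> j < d \<longrightarrow> F x j = 1}" for i
    using X FG by (auto simp: T_def)
  have closed: "closedin (subtopology zariski X) (G ` T i)" for i
  proof -
    let ?P = "(\<lambda>j x. F x j - 1) ` {j. i \<le> j \<and> j < d}"
    have "{x. \<forall>j. i \<le> j \<and> j < d \<longrightarrow> F x j = 1} = zero_locus ?P" by (auto simp: zero_locus_def)
    moreover have "\<forall>p\<in>?P. polyfun p"
      using polyfun.add[OF F polyfun.const[of "-1"]] by auto
    ultimately have "zariski_closed {x. \<forall>j. i \<le> j \<and> j < d \<longrightarrow> F x j = 1}"
      unfolding zariski_closed_def by blast
    then show ?thesis unfolding Z by (auto simp: closedin_subtopology closedin_zariski)
  qed
  have irr: "irreducible_in (subtopology zariski X) (G ` T i)" for i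
  proof (rule irreducible_rational_image[OF _ _ _ TX])
    have "(\<lambda>j. if j < d then 1 else 0) \<in> T i" by (auto simp: T_def torus_def affine_space_def)
    then show "T i \<noteq> {}" by blast
    show "fraction_on (T i) (\<lambda>y. G y k)" for k
      using G[of k] unfolding fraction_on_def T_def by blast
    fix s t assume st: "s \<in> T i" "t \<in> T i"
    have "{c. line_point s t c \<notin> T i} \<subseteq> (\<Union>j<d. {c. poly [:s j, t j - s j:] c = 0})"
    proof
      fix c assume c: "c \<in> {c. line_point s t c \<notin> T i}"
      have "line_point s t c \<in> affine_space {..<d}"
        using st by (auto simp: T_def torus_def affine_space_def)
      moreover have "\<forall>j. i \<le> j \<and> j < d \<longrightarrow> line_point s t c j = 1"
        using st by (auto simp: T_def)
      ultimately obtain j where "j < d" "line_point s t c j = 0"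
        using c by (auto simp: T_def torus_def)
      then show "c \<in> (\<Union>j<d. {c. poly [:s j, t j - s j:] c = 0})"
        by (auto simp: algebra_simps)
    qed
    moreover have "finite (\<Union>j<d. {c. poly [:s j, t j - s j:] c = 0})"
    proof (rule finite_UN_I)
      fix j assume "j \<in> {..<d}"
      then have "s j \<noteq> 0" using st by (auto simp: T_def torus_def)
      then show "finite {c. poly [:s j, t j - s j:] c = 0}" by (intro poly_roots_finite) simp
    qed simp
    ultimately show "finite {c. line_point s t c \<notin> T i}" by (rule finite_subset)
  qed
  have strict: "G ` T i \<subset> G ` T (Suc i)" if "i < d" for i
  proof
    show "G ` T i \<subseteq> G ` T (Suc i)" unfolding T_def by (intro image_mono) auto
    let ?y = "\<lambda>j. if j = i then 2 else if j < d then 1 else (0 :: complex)"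
    have y: "?y \<in> T (Suc i)" using that by (auto simp: T_def torus_def affine_space_def)
    then have Fy: "F (G ?y) = ?y" by (intro FG) (simp add: T_def)
    have "G ?y \<notin> G ` T i"
    proof
      assume "G ?y \<in> G ` T i"
      then have "F (G ?y) i = 1" unfolding Z using that by auto
      then show False unfolding Fy by simp
    qed
    then show "G ` T i \<noteq> G ` T (Suc i)" using y by blast
  qed
  have "\<exists>Z. (\<forall>i\<le>d. closedin (subtopology zariski X) (Z i) \<and> irreducible_in (subtopology zariski X) (Z i)) \<and>
      (\<forall>i<d. Z i \<subset> Z (Suc i))"
    by (rule exI[of _ "\<lambda>i. G ` T i"]) (use closed irr strict in blast)
  then show ?thesis unfolding variety_dim_def krull_dim_def by (intro Sup_upper) blast
qed

section \<open>Parametrisation of the correspondence\<close>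

text \<open>The parameters are numbered from the bottom of the weave, so that those of the remaining
  weave keep their numbers when a step is added at the top.\<close>

definition num_params :: "step list \<Rightarrow> nat" where
  "num_params ss = length (filter has_U ss)"

lemma num_params_simps [simp]:
  "num_params [] = 0" "num_params (s # ss) = num_params ss + (if has_U s then 1 else 0)"
  by (simp_all add: num_params_def)

text \<open>The bottom word contributes only zeros, because the variety of the half twist is the point 0.\<close>

primrec weave_param :: "nat \<Rightarrow> step list \<Rightarrow> (nat \<Rightarrow> complex) \<Rightarrow> coord \<Rightarrow> complex" where
  "weave_param n [] y = (\<lambda>_. 0)"
| "weave_param n (s # ss) y =
    (let x = weave_param n ss y; t = y (num_params ss); z' = z_vars x 0
     in cons_coords (lift_vars n s t z')
       (\<lambda>q r c. if has_U s \<and> q \<le> length (left_word s) \<and> r < n \<and> c < n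
          then lift_mats n s t z' q $$ (r, c) else 0) x)"

primrec read_params :: "step list \<Rightarrow> (coord \<Rightarrow> complex) \<Rightarrow> nat \<Rightarrow> complex" where
  "read_params [] x = (\<lambda>_. 0)"
| "read_params (s # ss) x =
    (if has_U s
     then (read_params ss (tail_coords x))(num_params ss := x (ZC 0 (step_param_index s)))
     else read_params ss (tail_coords x))"

primrec generic_params :: "step list \<Rightarrow> (nat \<Rightarrow> complex) \<Rightarrow> bool" where
  "generic_params [] y \<longleftrightarrow> True"
| "generic_params (s # ss) y \<longleftrightarrow> generic s (y (num_params ss)) \<and> generic_params ss y"

text \<open>For a step without matrices, \<open>weave_param\<close> passes on the parameter with number \<open>num_params ss\<close>,
  which does not belong to this step; the lift ignores it.\<close>

lemma lift_vars_no_U: "\<not> has_U s \<Longrightarrow> lift_vars n s t z' = lift_vars n s t' z'"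
  by (cases "vertex_of s") (simp_all add: lift_vars_def fun_eq_iff)

lemma weave_param_cong:
  "(\<And>k. k < num_params ss \<Longrightarrow> y k = y' k) \<Longrightarrow> weave_param n ss y = weave_param n ss y'"
proof (induction ss)
  case Nil
  show ?case by simp
next
  case (Cons s ss)
  have IH: "weave_param n ss y = weave_param n ss y'" using Cons by simp
  show ?case
  proof (cases "has_U s")
    case True
    then have "y (num_params ss) = y' (num_params ss)" using Cons.prems by simp
    then show ?thesis using IH by (simp add: Let_def)
  next
    case False
    then show ?thesis using IH lift_vars_no_U[OF False, of n "y (num_params ss)" _ "y' (num_params ss)"]
      by (simp add: Let_def)
  qed
qed

lemma generic_params_cong:
  "(\<And>k. k < num_params ss \<Longrightarrow> y k = y' k) \<Longrightarrow> generic_params ss y \<longleftrightarrow> generic_params ss y'"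
proof (induction ss)
  case Nil
  show ?case by simp
next
  case (Cons s ss)
  have "generic s (y (num_params ss)) \<longleftrightarrow> generic s (y' (num_params ss))"
    using Cons.prems[of "num_params ss"] by (cases "has_U s") (auto simp: generic_def has_U_def)
  then show ?case using Cons by simp
qed

lemma read_params_affine: "read_params ss x \<in> affine_space {..<num_params ss}"
  by (induction ss arbitrary: x) (auto simp: affine_space_def)

lemma read_weave_param:
  "read_params ss (weave_param n ss y) = (\<lambda>k. if k < num_params ss then y k else 0)"
proof (induction ss)
  case Nil
  show ?case by simp
next
  case (Cons s ss)
  then show ?case by (auto simp: Let_def fun_eq_iff lift_vars_param)
qed

lemma slide_left_carrier: "C \<in> carrier_mat n n \<Longrightarrow> slide_left n l w C \<in> carrier_mat n n"
  by (cases l) (simp_all add: slide_mat_def)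

lemma lift_mats_carrier: "lift_mats n s t z' q \<in> carrier_mat n n"
proof -
  have "step_corner n s t z' \<in> carrier_mat n n"
    by (auto simp: step_corner_def vertex_corner_def split: vertex.split
        intro: mult_carrier_mat[of _ n n])
  then show ?thesis by (simp add: lift_mats_def slide_left_carrier)
qed

text \<open>A point of the correspondence is determined by its parameters, which are among its
  coordinates, and the only condition on them is that those of trivalent vertices do not vanish.
  This is \<open>step_lift_iff\<close>, iterated.\<close>

theorem correspondence_param_iff:
  assumes "simplifying_weave n (Weave \<beta> ss) \<beta> (half_twist n)"
  shows "x \<in> correspondence n (Weave \<beta> ss) (longest_perm n) \<longleftrightarrow>
    generic_params ss (read_params ss x) \<and> x = weave_param n ss (read_params ss x)"
  using assms
proof (induction ss arbitrary: \<beta> x)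
  case Nil
  then have \<beta>: "\<beta> = half_twist n" by (simp add: simplifying_weave_Nil)
  have "x \<in> correspondence n (Weave \<beta> []) (longest_perm n) \<longleftrightarrow>
      x \<in> affine_space {ZC 0 k |k. k < length \<beta>} \<and> z_vars x 0 = (\<lambda>_. 0)"
    using X0_coset_normal[OF coset_normal_half_twist, of n] by (simp add: correspondence_Nil \<beta>)
  also have "\<dots> \<longleftrightarrow> x = (\<lambda>_. 0)"
  proof
    assume a: "x \<in> affine_space {ZC 0 k |k. k < length \<beta>} \<and> z_vars x 0 = (\<lambda>_. 0)"
    show "x = (\<lambda>_. 0)"
    proof
      fix i
      show "x i = 0"
      proof (cases "i \<in> {ZC 0 k |k. k < length \<beta>}")
        case True
        then obtain k where "i = ZC 0 k" by blast
        moreover have "z_vars x 0 k = 0" using a by simp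
        ultimately show ?thesis by (simp add: z_vars_def)
      next
        case False
        then show ?thesis using a unfolding affine_space_def by blast
      qed
    qed
  qed (simp add: affine_space_def z_vars_def)
  finally show ?case by simp
next
  case (Cons s ss)
  let ?C' = "correspondence n (Weave (step_target s) ss) (longest_perm n)"
  let ?t = "x (ZC 0 (step_param_index s))" and ?z = "z_vars x 0" and ?z' = "z_vars x (Suc 0)"
  let ?x' = "tail_coords x" and ?y' = "read_params ss (tail_coords x)"
  let ?y = "read_params (s # ss) x"
  note w = Cons.prems[unfolded simplifying_weave_Cons]
  have s: "valid_step n s" and src: "step_source s = \<beta>" using w by simp_all
  have IH: "?x' \<in> ?C' \<longleftrightarrow> generic_params ss ?y' \<and> ?x' = weave_param n ss ?y'"
    using Cons.IH[of "step_target s" ?x'] w by blast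
  have z'_eq: "?z' = z_vars ?x' 0" by (simp add: tail_coords_vars)
  have yy: "?y k = ?y' k" if "k < num_params ss" for k using that by simp
  have wp: "weave_param n ss ?y = weave_param n ss ?y'" by (rule weave_param_cong) (rule yy)
  have gp: "generic_params ss ?y \<longleftrightarrow> generic_params ss ?y'" by (rule generic_params_cong) (rule yy)
  have gen: "generic s (?y (num_params ss)) \<longleftrightarrow> generic s ?t"
    by (cases "has_U s") (simp_all add: generic_def has_U_def)
  have lv: "lift_vars n s (?y (num_params ss)) z = lift_vars n s ?t z" for z
  proof (cases "has_U s")
    case False
    then show ?thesis by (rule lift_vars_no_U)
  qed simp
  have lm: "lift_mats n s (?y (num_params ss)) z = lift_mats n s ?t z" if "has_U s" for z
    using that by simp
  let ?in = "\<lambda>q r c. has_U s \<and> q \<le> length (left_word s) \<and> r < n \<and> c < n"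
  let ?U = "\<lambda>q r c. if ?in q r c then lift_mats n s ?t ?z' q $$ (r, c) else 0"
  have Ueq: "(\<forall>q r c. \<not> ?in q r c \<longrightarrow> x (UC 0 q r c) = 0) \<and>
      (has_U s \<longrightarrow> (\<forall>q\<le>length (left_word s). U_mat n x 0 q = lift_mats n s ?t ?z' q)) \<longleftrightarrow>
      (\<forall>q r c. x (UC 0 q r c) = ?U q r c)" (is "?A \<and> ?B \<longleftrightarrow> ?D")
  proof
    assume ab: "?A \<and> ?B"
    show ?D
    proof (intro allI)
      fix q r c
      show "x (UC 0 q r c) = ?U q r c"
      proof (cases "?in q r c")
        case True
        then have "U_mat n x 0 q $$ (r, c) = lift_mats n s ?t ?z' q $$ (r, c)" using ab by simp
        then show ?thesis using True by (simp add: U_mat_def)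
      next
        case False
        then show ?thesis unfolding if_not_P[OF False] using conjunct1[OF ab] by blast
      qed
    qed
  next
    assume d: ?D
    have "U_mat n x 0 q = lift_mats n s ?t ?z' q" if "has_U s" "q \<le> length (left_word s)" for q
      by (rule eq_matI)
        (use d that carrier_matD[OF lift_mats_carrier[of n s ?t ?z' q]] in \<open>auto simp: U_mat_def\<close>)
    then show "?A \<and> ?B" using d by simp
  qed
  have step: "step_relations n s ?z ?z' (U_mat n x 0) \<longleftrightarrow> generic s ?t \<and> ?z = lift_vars n s ?t ?z' \<and>
       (has_U s \<longrightarrow> (\<forall>q\<le>length (left_word s). U_mat n x 0 q = lift_mats n s ?t ?z' q))"
    if "?z \<in> affine_space {..<length \<beta>}" "?z' \<in> affine_space {..<length (step_target s)}"
  proof -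
    have "step_relations n s ?z ?z' (U_mat n x 0) \<longleftrightarrow>
      (let t = ?z (step_param_index s) in generic s t \<and> ?z = lift_vars n s t ?z' \<and>
        (has_U s \<longrightarrow> (\<forall>q\<le>length (left_word s). U_mat n x 0 q = lift_mats n s t ?z' q)))"
    proof (rule step_lift_iff)
      show "U_mat n x 0 q \<in> carrier_mat n n" for q by (simp add: U_mat_def)
    qed (use s that src in \<open>simp_all add: valid_step_def\<close>)
    moreover have "?z (step_param_index s) = ?t" by (simp add: z_vars_def)
    ultimately show ?thesis by (simp add: Let_def)
  qed
  have "x \<in> correspondence n (Weave \<beta> (s # ss)) (longest_perm n) \<longleftrightarrow>
     ?x' \<in> ?C' \<and> ?z \<in> affine_space {..<length \<beta>} \<and>
     (\<forall>q r c. \<not> ?in q r c \<longrightarrow> x (UC 0 q r c) = 0) \<and> step_relations n s ?z ?z' (U_mat n x 0)"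
    by (rule correspondence_Cons)
  also have "\<dots> \<longleftrightarrow> ?x' \<in> ?C' \<and> generic s ?t \<and> ?z = lift_vars n s ?t ?z' \<and>
     (\<forall>q r c. x (UC 0 q r c) = ?U q r c)"
  proof (rule conj_cong[OF refl])
    assume "?x' \<in> ?C'"
    then have z': "?z' \<in> affine_space {..<length (step_target s)}"
      unfolding z'_eq by (rule correspondence_affine)
    show "?z \<in> affine_space {..<length \<beta>} \<and>
       (\<forall>q r c. \<not> ?in q r c \<longrightarrow> x (UC 0 q r c) = 0) \<and> step_relations n s ?z ?z' (U_mat n x 0) \<longleftrightarrow>
       generic s ?t \<and> ?z = lift_vars n s ?t ?z' \<and> (\<forall>q r c. x (UC 0 q r c) = ?U q r c)"
    proof
      assume a: "?z \<in> affine_space {..<length \<beta>} \<and>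
       (\<forall>q r c. \<not> ?in q r c \<longrightarrow> x (UC 0 q r c) = 0) \<and> step_relations n s ?z ?z' (U_mat n x 0)"
      have "generic s ?t \<and> ?z = lift_vars n s ?t ?z' \<and>
       (has_U s \<longrightarrow> (\<forall>q\<le>length (left_word s). U_mat n x 0 q = lift_mats n s ?t ?z' q))"
        by (rule iffD1[OF step[OF conjunct1[OF a] z'] conjunct2[OF conjunct2[OF a]]])
      then show "generic s ?t \<and> ?z = lift_vars n s ?t ?z' \<and> (\<forall>q r c. x (UC 0 q r c) = ?U q r c)"
        unfolding Ueq[symmetric] using conjunct1[OF conjunct2[OF a]]
        by - (elim conjE, intro conjI, assumption+)
    next
      assume a: "generic s ?t \<and> ?z = lift_vars n s ?t ?z' \<and> (\<forall>q r c. x (UC 0 q r c) = ?U q r c)"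
      have "lift_vars n s ?t ?z' \<in> affine_space {..<length \<beta>}"
        using lift_vars_affine[OF z'] src by simp
      then have z: "?z \<in> affine_space {..<length \<beta>}"
        by (rule subst[OF conjunct1[OF conjunct2[OF a], symmetric],
            where P = "\<lambda>z. z \<in> affine_space {..<length \<beta>}"])
      show "?z \<in> affine_space {..<length \<beta>} \<and>
       (\<forall>q r c. \<not> ?in q r c \<longrightarrow> x (UC 0 q r c) = 0) \<and> step_relations n s ?z ?z' (U_mat n x 0)"
        unfolding step[OF z z'] using z a[folded Ueq]
        by - (elim conjE, intro conjI, assumption+)
    qed
  qed
  also have "\<dots> \<longleftrightarrow> generic_params (s # ss) ?y \<and> x = weave_param n (s # ss) ?y"
  proof -
    let ?W = "weave_param n ss ?y'" and ?s = "?y (num_params ss)"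
    have U': "(if ?in q r c then lift_mats n s ?s ?z' q $$ (r, c) else 0) = ?U q r c" for q r c
      using lm by simp
    have "x = weave_param n (s # ss) ?y \<longleftrightarrow> ?z = lift_vars n s ?t (z_vars ?W 0) \<and>
        (\<forall>q r c. x (UC 0 q r c) =
          (if ?in q r c then lift_mats n s ?s (z_vars ?W 0) q $$ (r, c) else 0)) \<and> ?x' = ?W"
      unfolding weave_param.simps(2) Let_def wp lv cons_coords_eq_iff by (rule refl)
    also have "\<dots> \<longleftrightarrow> ?x' = ?W \<and> ?z = lift_vars n s ?t ?z' \<and> (\<forall>q r c. x (UC 0 q r c) = ?U q r c)"
    proof (cases "?x' = ?W")
      case True
      then have W: "z_vars ?W 0 = ?z'" using z'_eq by simp
      show ?thesis unfolding W U' using True by (simp only: simp_thms conj_ac)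
    qed (simp only: simp_thms)
    finally have "x = weave_param n (s # ss) ?y \<longleftrightarrow>
        ?x' = ?W \<and> ?z = lift_vars n s ?t ?z' \<and> (\<forall>q r c. x (UC 0 q r c) = ?U q r c)" .
    then show ?thesis unfolding IH generic_params.simps gp gen by (simp only: conj_ac)
  qed
  finally show ?case .
qed

definition param_space :: "step list \<Rightarrow> (nat \<Rightarrow> complex) set" where
  "param_space ss = {y \<in> affine_space {..<num_params ss}. generic_params ss y}"

lemma read_weave_param_affine:
  assumes "y \<in> affine_space {..<num_params ss}"
  shows "read_params ss (weave_param n ss y) = y"
  using assms by (auto simp: read_weave_param affine_space_def)

lemma weave_param_image:
  assumes "simplifying_weave n (Weave \<beta> ss) \<beta> (half_twist n)"
  shows "weave_param n ss ` param_space ss = correspondence n (Weave \<beta> ss) (longest_perm n)"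
proof (intro equalityI subsetI)
  fix x assume "x \<in> weave_param n ss ` param_space ss"
  then obtain y where "x = weave_param n ss y" "y \<in> param_space ss" by blast
  then show "x \<in> correspondence n (Weave \<beta> ss) (longest_perm n)"
    using read_weave_param_affine[of y ss n]
    by (simp add: correspondence_param_iff[OF assms] param_space_def)
next
  fix x assume "x \<in> correspondence n (Weave \<beta> ss) (longest_perm n)"
  then have "generic_params ss (read_params ss x)" "x = weave_param n ss (read_params ss x)"
    using correspondence_param_iff[OF assms] by blast+
  then show "x \<in> weave_param n ss ` param_space ss"
    using read_params_affine by (auto simp: param_space_def intro: image_eqI[where x = "read_params ss x"])
qed

lemma polyfun_read_params: "polyfun (\<lambda>x. read_params ss x k)"
proof (induction ss arbitrary: k)
  case Nil
  show ?case using polyfun.const[of 0] by simp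
next
  case (Cons s ss)
  have "polyfun (\<lambda>x. read_params ss (tail_coords x) k)"
    using polyfun_reindex[OF Cons.IH[of k], of raise_coord] by (simp add: tail_coords_def)
  then show ?case
    using polyfun.coord[of "ZC 0 (step_param_index s)"]
    by (cases "has_U s"; cases "k = num_params ss") simp_all
qed

lemma borel_step_corner:
  assumes s: "valid_step n s" "has_U s" and t: "generic s t"
  shows "borel n (step_corner n s t z')"
proof (cases "vertex_of s")
  case (Trivalent i)
  have i: "1 \<le> i" "i < n" using s Trivalent by (auto simp: valid_step_def step_source_def)
  have "t \<noteq> 0" using t Trivalent by (simp add: generic_def)
  then show ?thesis
    using trivalent_iff[OF i, of "step_corner n s t z'" t "z' (length (left_word s)) - 1 / t"
        "z' (length (left_word s))"]
    by (simp add: step_corner_def vertex_corner_def Trivalent)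
next
  case (Cup i)
  have i: "1 \<le> i" "i < n" using s Cup by (auto simp: valid_step_def step_source_def)
  show ?thesis using cup_iff[OF i, of 0 t] by (simp add: step_corner_def vertex_corner_def Cup)
qed (use s in \<open>simp_all add: has_U_def\<close>)

text \<open>Rationality of the parametrisation. The denominators that occur are the parameters of the
  trivalent vertices and, when sliding, diagonal entries of invertible triangular matrices.\<close>

definition fraction_mat_on ::
  "nat \<Rightarrow> ('i \<Rightarrow> complex) set \<Rightarrow> (('i \<Rightarrow> complex) \<Rightarrow> complex mat) \<Rightarrow> bool" where
  "fraction_mat_on n Y M \<longleftrightarrow> (\<forall>r<n. \<forall>c<n. fraction_on Y (\<lambda>y. M y $$ (r, c)))"

lemma fraction_mat_onD:
  "fraction_mat_on n Y M \<Longrightarrow> r < n \<Longrightarrow> c < n \<Longrightarrow> fraction_on Y (\<lambda>y. M y $$ (r, c))"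
  by (simp add: fraction_mat_on_def)

lemma fraction_on_if:
  "(P \<Longrightarrow> fraction_on Y f) \<Longrightarrow> (\<not> P \<Longrightarrow> fraction_on Y g) \<Longrightarrow> fraction_on Y (\<lambda>y. if P then f y else g y)"
  by (cases P) simp_all

lemmas fraction_on_intros = fraction_on_const fraction_on_add fraction_on_mult fraction_on_diff

lemma fraction_mat_on_braid_gen_mat:
  assumes "1 \<le> i" and a: "fraction_on Y a"
  shows "fraction_mat_on n Y (\<lambda>y. braid_gen_mat n i (a y))"
  unfolding fraction_mat_on_def
proof (intro allI impI)
  fix r c assume rc: "r < n" "c < n"
  obtain m where m: "i = Suc m" using assms(1) by (cases i) auto
  have e: "braid_gen_mat n i b $$ (r, c) =
      (if r = m \<and> c = m then 0 else if r = m \<and> c = i then 1 else if r = i \<and> c = m then 1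
       else if r = i \<and> c = i then b else if r = c then 1 else 0)" for b
    using rc by (simp add: braid_gen_mat_def m)
  show "fraction_on Y (\<lambda>y. braid_gen_mat n i (a y) $$ (r, c))"
    unfolding e by (intro fraction_on_if a fraction_on_const)
qed

lemma fraction_mat_on_braid_gen_mat_mult:
  assumes i: "1 \<le> i" "i < n" and a: "fraction_on Y a" and M: "fraction_mat_on n Y M"
    and c: "\<And>y. M y \<in> carrier_mat n n"
  shows "fraction_mat_on n Y (\<lambda>y. braid_gen_mat n i (a y) * M y)"
  unfolding fraction_mat_on_def
proof (intro allI impI)
  fix r s assume rs: "r < n" "s < n"
  have "i - 1 < n" using i by simp
  then show "fraction_on Y (\<lambda>y. (braid_gen_mat n i (a y) * M y) $$ (r, s))"
    unfolding braid_gen_mat_mult_entry[OF i c rs]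
    by (intro fraction_on_if fraction_on_intros fraction_mat_onD[OF M] a i rs)
qed

lemma fraction_mat_on_strip_right:
  assumes i: "1 \<le> i" "i < n" and a: "fraction_on Y a" and M: "fraction_mat_on n Y M"
  shows "fraction_mat_on n Y (\<lambda>y. strip_right n i (a y) (M y))"
  unfolding fraction_mat_on_def
proof (intro allI impI)
  fix r s assume rs: "r < n" "s < n"
  have "i - 1 < n" using i by simp
  moreover have "strip_right n i (a y) (M y) $$ (r, s) = (if s = i then M y $$ (r, i - 1)
     else if s = i - 1 then M y $$ (r, i) - a y * M y $$ (r, i - 1)
     else M y $$ (r, s))" for y
    using rs by (simp add: strip_right_def)
  ultimately show "fraction_on Y (\<lambda>y. strip_right n i (a y) (M y) $$ (r, s))"
    by (simp only:) (intro fraction_on_if fraction_on_intros fraction_mat_onD[OF M] a i rs)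
qed

lemma fraction_on_slide_var:
  assumes i: "1 \<le> i" "i < n" and a: "fraction_on Y a" and M: "fraction_mat_on n Y M"
    and b: "\<And>y. y \<in> Y \<Longrightarrow> borel n (M y)"
  shows "fraction_on Y (\<lambda>y. slide_var i (M y) (a y))"
  unfolding slide_var_def
proof (rule fraction_on_divide)
  have "i - 1 < n" using i by simp
  then show "fraction_on Y (\<lambda>y. M y $$ (i - 1, i - 1) * a y - M y $$ (i - 1, i))"
    using fraction_mat_onD[OF M] a i by (intro fraction_on_intros)
  show "fraction_on Y (\<lambda>y. M y $$ (i, i))" using fraction_mat_onD[OF M] i by simp
  show "M y $$ (i, i) \<noteq> 0" if "y \<in> Y" for y using borelD(5)[OF b[OF that]] i by simp
qed

lemma fraction_mat_on_slide_left:
  assumes "braid_word n l" and "\<And>k. fraction_on Y (\<lambda>y. w y k)" and "fraction_mat_on n Y C"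
    and "\<And>y. C y \<in> carrier_mat n n" and b: "\<And>y. y \<in> Y \<Longrightarrow> borel n (C y)"
  shows "fraction_mat_on n Y (\<lambda>y. slide_left n l (w y) (C y))"
  using assms(1,2)
proof (induction l arbitrary: w)
  case Nil
  show ?case using assms(3) by simp
next
  case (Cons i l)
  let ?M = "\<lambda>y. slide_left n l (\<lambda>k. w y (Suc k)) (C y)"
  have i: "1 \<le> i" "i < n" and l: "braid_word n l" using Cons.prems(1) by auto
  have M: "fraction_mat_on n Y ?M" by (rule Cons.IH[OF l]) (rule Cons.prems(2))
  have "borel n (?M y)" if "y \<in> Y" for y by (rule borel_slide_left[OF l b[OF that]])
  then have v: "fraction_on Y (\<lambda>y. slide_var i (?M y) (w y 0))"
    by (rule fraction_on_slide_var[OF i Cons.prems(2) M])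
  have c: "?M y \<in> carrier_mat n n" for y by (rule slide_left_carrier[OF assms(4)])
  show ?case unfolding slide_left.simps slide_mat_def
    by (rule fraction_mat_on_strip_right[OF i Cons.prems(2)
        fraction_mat_on_braid_gen_mat_mult[OF i v M c]])
qed

context
  fixes n :: nat and s :: step and Y :: "('i \<Rightarrow> complex) set"
    and t :: "('i \<Rightarrow> complex) \<Rightarrow> complex" and w :: "('i \<Rightarrow> complex) \<Rightarrow> nat \<Rightarrow> complex"
  assumes s: "valid_step n s"
    and t: "fraction_on Y t" "\<And>y. y \<in> Y \<Longrightarrow> generic s (t y)"
    and w: "\<And>k. fraction_on Y (\<lambda>y. w y k)"
begin

lemma fraction_on_trivalent_var:
  assumes "vertex_of s = Trivalent i"
  shows "fraction_on Y (\<lambda>y. w y k - 1 / t y)"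
proof (rule fraction_on_diff[OF w fraction_on_divide[OF fraction_on_const t(1)]])
  show "t y \<noteq> 0" if "y \<in> Y" for y using t(2)[OF that] assms by (simp add: generic_def)
qed

lemma fraction_mat_on_lift_mats:
  assumes U: "has_U s"
  shows "fraction_mat_on n Y (\<lambda>y. lift_mats n s (t y) (w y) q)"
proof -
  let ?p = "length (left_word s)"
  have l: "braid_word n (left_word s)" using s by (simp add: valid_step_def step_source_def)
  have C: "fraction_mat_on n Y (\<lambda>y. step_corner n s (t y) (w y))"
  proof (cases "vertex_of s")
    case (Trivalent i)
    have i: "1 \<le> i" "i < n" using s Trivalent by (auto simp: valid_step_def step_source_def)
    show ?thesis unfolding step_corner_def vertex_corner_def Trivalent vertex.case
      by (intro fraction_mat_on_strip_right fraction_mat_on_braid_gen_mat_mult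
          fraction_mat_on_braid_gen_mat[OF i(1)] fraction_on_trivalent_var[OF Trivalent] i w t(1)
          braid_gen_mat_carrier)
  next
    case (Cup i)
    have i: "1 \<le> i" "i < n" using s Cup by (auto simp: valid_step_def step_source_def)
    show ?thesis unfolding step_corner_def vertex_corner_def Cup vertex.case
      by (intro fraction_mat_on_braid_gen_mat_mult fraction_mat_on_braid_gen_mat[OF i(1)]
          fraction_on_const i t(1) braid_gen_mat_carrier)
  qed (use U in \<open>simp_all add: has_U_def\<close>)
  have c: "step_corner n s a z \<in> carrier_mat n n" for a z
    using lift_mats_carrier[of n s a z ?p] by (simp add: lift_mats_def)
  show ?thesis unfolding lift_mats_def
    by (rule fraction_mat_on_slide_left[OF braid_word_drop[OF l] w C c])
      (rule borel_step_corner[OF s U t(2)])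
qed

lemma fraction_on_lift_vars: "fraction_on Y (\<lambda>y. lift_vars n s (t y) (w y) k)"
proof -
  let ?p = "length (left_word s)"
  have l: "braid_word n (left_word s)" using s by (simp add: valid_step_def step_source_def)
  have left: "fraction_on Y (\<lambda>y. lift_left n s (t y) (w y) k)" if "has_U s" "k < ?p"
    unfolding lift_left_def
  proof (rule fraction_on_slide_var[OF _ _ w fraction_mat_on_lift_mats[OF that(1)]])
    show "1 \<le> left_word s ! k" "left_word s ! k < n" using braid_word_nth[OF l that(2)] by auto
    show "borel n (lift_mats n s (t y) (w y) (Suc k))" if "y \<in> Y" for y
      unfolding lift_mats_def
      by (rule borel_slide_left[OF braid_word_drop[OF l] borel_step_corner[OF s \<open>has_U s\<close> t(2)[OF that]]])
  qed
  show ?thesis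
  proof (cases "vertex_of s")
    case (Trivalent i)
    show ?thesis unfolding lift_vars_def Let_def Trivalent vertex.case
      by (intro fraction_on_if left fraction_on_trivalent_var[OF Trivalent] t(1) w)
        (use Trivalent in simp_all)
  next
    case (Cup i)
    show ?thesis unfolding lift_vars_def Let_def Cup vertex.case
      by (intro fraction_on_if left fraction_on_const t(1) w) (use Cup in simp_all)
  next
    case (Hexavalent i j)
    show ?thesis unfolding lift_vars_def Let_def Hexavalent vertex.case
      by (intro fraction_on_if fraction_on_intros w)
  next
    case (Tetravalent i j)
    show ?thesis unfolding lift_vars_def Let_def Tetravalent vertex.case
      by (intro fraction_on_if w)
  qed
qed

end

lemma fraction_on_weave_param:
  assumes "simplifying_weave n (Weave \<beta> ss) \<beta> \<delta>" and "\<And>y. y \<in> Y \<Longrightarrow> generic_params ss y"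
  shows "fraction_on Y (\<lambda>y. weave_param n ss y i)"
  using assms
proof (induction ss arbitrary: \<beta> i)
  case Nil
  show ?case by (simp add: fraction_on_const)
next
  case (Cons s ss)
  have s: "valid_step n s" and w: "simplifying_weave n (Weave (step_target s) ss) (step_target s) \<delta>"
    using Cons.prems(1) by (auto simp: simplifying_weave_Cons)
  have IH: "fraction_on Y (\<lambda>y. weave_param n ss y i)" for i
    using Cons.IH[OF w] Cons.prems(2) by simp
  let ?t = "\<lambda>y. y (num_params ss)" and ?w = "\<lambda>y. z_vars (weave_param n ss y) 0"
  have t: "fraction_on Y ?t" by (rule fraction_on_polyfun) (rule polyfun.coord)
  have g: "generic s (?t y)" if "y \<in> Y" for y using Cons.prems(2)[OF that] by simp
  have z: "fraction_on Y (\<lambda>y. ?w y k)" for k unfolding z_vars_def by (rule IH)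
  have L: "fraction_on Y (\<lambda>y. lift_vars n s (?t y) (?w y) k)" for k
    by (rule fraction_on_lift_vars[where t = ?t and w = ?w, OF s t _ z]) (erule g)
  have lift: "fraction_mat_on n Y (\<lambda>y. lift_mats n s (?t y) (?w y) q)" if "has_U s" for q
    by (rule fraction_mat_on_lift_mats[where t = ?t and w = ?w, OF s t _ z that]) (erule g)
  have M: "fraction_on Y (\<lambda>y. if has_U s \<and> q \<le> length (left_word s) \<and> r < n \<and> c < n
      then lift_mats n s (?t y) (?w y) q $$ (r, c) else 0)" for q r c
    by (intro fraction_on_if fraction_on_const fraction_mat_onD[OF lift]) simp_all
  show ?case
  proof (cases i)
    case (ZC j k)
    then show ?thesis using L IH by (cases j) (simp_all add: Let_def)
  next
    case (UC j q r c)
    then show ?thesis using M[of q r c] IH by (cases j) (simp_all add: Let_def)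
  qed
qed

section \<open>Dimensions of the pieces\<close>

definition num_cups :: "step list \<Rightarrow> nat" where
  "num_cups ss = length (filter (\<lambda>s. is_cup (vertex_of s)) ss)"

lemma length_half_twist: "length (half_twist m) = m choose 2"
  by (induction m) (simp_all add: numeral_2_eq_2)

text \<open>Trivalent vertices shorten the word by one letter and have one parameter; cups shorten it by two
  letters but also have only one parameter.\<close>

lemma simplifying_weave_length:
  assumes "simplifying_weave n (Weave \<beta> ss) \<beta> \<delta>"
  shows "length \<beta> = length \<delta> + num_params ss + num_cups ss"
  using assms
proof (induction ss arbitrary: \<beta>)
  case Nil
  then show ?case by (simp add: simplifying_weave_Nil num_cups_def)
next
  case (Cons s ss)
  have "length (step_target s) = length \<delta> + num_params ss + num_cups ss"
    using Cons.IH[of "step_target s"] Cons.prems by (simp add: simplifying_weave_Cons)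
  moreover have "\<beta> = step_source s" using Cons.prems by (simp add: simplifying_weave_Cons)
  ultimately show ?case
    by (cases "vertex_of s") (simp_all add: step_source_def step_target_def num_cups_def)
qed

lemma param_space_demazure:
  assumes "\<forall>s\<in>set ss. \<not> is_cup (vertex_of s)"
  shows "param_space ss = torus (num_params ss)"
proof -
  have "generic_params ss y \<longleftrightarrow> (\<forall>k<num_params ss. y k \<noteq> 0)" for y
    using assms
  proof (induction ss)
    case Nil
    show ?case by simp
  next
    case (Cons s ss)
    have "has_U s \<longleftrightarrow> is_trivalent (vertex_of s)" using Cons.prems by (simp add: has_U_def)
    then show ?case using Cons by (auto simp: generic_def less_Suc_eq)
  qed
  then show ?thesis by (simp add: param_space_def torus_def)
qed

lemma demazure_correspondence:
  assumes w: "demazure_weave n (Weave \<gamma> ss) \<gamma> (half_twist n)"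
  defines "X \<equiv> correspondence n (Weave \<gamma> ss) (longest_perm n)"
  shows "variety_isomorphic X (torus (length \<gamma> - (n choose 2)))"
    and "ereal (real (length \<gamma> - (n choose 2))) \<le> variety_dim X"
proof -
  have sw: "simplifying_weave n (Weave \<gamma> ss) \<gamma> (half_twist n)"
    and nc: "\<forall>s\<in>set ss. \<not> is_cup (vertex_of s)"
    using w by (auto simp: demazure_weave_def)
  have "num_cups ss = 0" using nc by (simp add: num_cups_def filter_empty_conv)
  then have d: "length \<gamma> - (n choose 2) = num_params ss"
    using simplifying_weave_length[OF sw] length_half_twist[of n] by simp
  note T = param_space_demazure[OF nc]
  let ?g = "weave_param n ss" and ?f = "read_params ss"
  have image: "?g ` torus (num_params ss) = X"
    using weave_param_image[OF sw] by (simp add: T X_def)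
  have fg: "?f (?g y) = y" if "y \<in> torus (num_params ss)" for y
    by (rule read_weave_param_affine) (use that in \<open>simp add: torus_def\<close>)
  have frac: "fraction_on (torus (num_params ss)) (\<lambda>y. ?g y i)" for i
    by (rule fraction_on_weave_param[OF sw]) (use T in \<open>auto simp: param_space_def\<close>)
  have gf: "?g (?f x) = x" if "x \<in> X" for x
    using correspondence_param_iff[OF sw, of x] that by (simp add: X_def)
  show "variety_isomorphic X (torus (length \<gamma> - (n choose 2)))"
    unfolding d variety_isomorphic_def
  proof (intro exI[of _ ?f] exI[of _ ?g] conjI ballI)
    show "variety_morphism X (torus (num_params ss)) ?f"
      unfolding variety_morphism_def
    proof (intro conjI allI)
      show "?f ` X \<subseteq> torus (num_params ss)" using image fg by auto
      show "regular_on X (\<lambda>x. ?f x j)" for j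
        by (rule fraction_on_imp_regular_on[OF fraction_on_polyfun[OF polyfun_read_params]])
    qed
    show "variety_morphism (torus (num_params ss)) X ?g"
      unfolding variety_morphism_def using image fraction_on_imp_regular_on[OF frac] by auto
  qed (use gf fg in auto)
  show "ereal (real (length \<gamma> - (n choose 2))) \<le> variety_dim X"
    unfolding d by (rule variety_dim_torus_parametrised[where G = ?g and F = ?f,
        OF frac image polyfun_read_params fg])
qed

lemma variety_dim_correspondence_le:
  assumes "simplifying_weave n (Weave \<beta> ss) \<beta> (half_twist n)"
  shows "variety_dim (correspondence n (Weave \<beta> ss) (longest_perm n)) \<le> ereal (real (num_params ss))"
proof (rule variety_dim_rational_image[OF _ _ weave_param_image[OF assms]])
  show "param_space ss \<subseteq> affine_space {..<num_params ss}" by (auto simp: param_space_def)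
  show "fraction_on (param_space ss) (\<lambda>y. weave_param n ss y i)" for i
    by (rule fraction_on_weave_param[OF assms]) (simp add: param_space_def)
qed

theorem theorem5p35:
  fixes n :: nat and \<gamma> :: word
  assumes "1 \<le> n" and "braid_word n \<gamma>"
  shows "(\<exists>ws. decomposes n \<gamma> ws) \<and>
    (\<forall>w. demazure_weave n w \<gamma> (half_twist n) \<longrightarrow>
      (\<exists>ws. decomposes n \<gamma> (w # ws) \<and>
        variety_isomorphic (correspondence n w (longest_perm n)) (torus (length \<gamma> - (n choose 2))) \<and>
        (\<forall>w'\<in>set ws. variety_dim (correspondence n w' (longest_perm n))
           < variety_dim (correspondence n w (longest_perm n)))))"
proof (intro conjI allI impI)
  show "\<exists>ws. decomposes n \<gamma> ws" by (rule decomposition_exists[OF assms(2)])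
next
  fix w assume d: "demazure_weave n w \<gamma> (half_twist n)"
  then have "w = Weave \<gamma> (weave_steps w)"
    using simplifying_weave_top by (auto simp: demazure_weave_def)
  then obtain ss where w: "w = Weave \<gamma> ss" by blast
  note d' = d[unfolded w]
  obtain ws where ws: "decomposes n \<gamma> (w # ws)" "\<forall>w\<in>set ws. has_cup w"
    using demazure_decomposition_exists[OF d'] w by blast
  have "variety_dim (correspondence n w' (longest_perm n)) < variety_dim (correspondence n w (longest_perm n))"
    if "w' \<in> set ws" for w'
  proof -
    have sw: "simplifying_weave n w' \<gamma> (half_twist n)"
      using ws(1) that by (simp add: decomposes_def)
    obtain ss' where w': "w' = Weave \<gamma> ss'" using simplifying_weave_top[OF sw] by blast
    note sw' = sw[unfolded w']
    have "has_cup w'" using ws(2) that by blast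
    then have "num_cups ss' > 0" by (simp add: w' has_cup_def num_cups_def filter_empty_conv)
    then have "num_params ss' < length \<gamma> - (n choose 2)"
      using simplifying_weave_length[OF sw'] length_half_twist[of n] by simp
    then have "ereal (real (num_params ss')) < ereal (real (length \<gamma> - (n choose 2)))" by simp
    then show ?thesis
      using variety_dim_correspondence_le[OF sw'] demazure_correspondence(2)[OF d']
      unfolding w w' by (meson le_less_trans less_le_trans)
  qed
  then show "\<exists>ws. decomposes n \<gamma> (w # ws) \<and>
        variety_isomorphic (correspondence n w (longest_perm n)) (torus (length \<gamma> - (n choose 2))) \<and>
        (\<forall>w'\<in>set ws. variety_dim (correspondence n w' (longest_perm n))
           < variety_dim (correspondence n w (longest_perm n)))"
    using ws(1) demazure_correspondence(1)[OF d'] unfolding w by blast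
qed

end
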